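(* Let $\mu,\nu\in\mathcal P_1^d$ with $\mu\preccurlyeq\nu$, and assume that $\delta F:=F_\nu-F_\mu$ has a single local maximizer on $(0,\infty)$. Let $(x_\star^S,L_d^S,L_u^S,q_L^S)$ be the quantities characterizing the left-monotone transference plan with marginals $S(\mu),S(\nu)$ (see context). Then the right-monotone transference plan $Q_R=Q_R(\mu,\nu)$ is given by $Q_R(dx,dy)=\mu(dx)\mathcal L_R(x,dy)$ with transition kernel $$\mathcal L_R(x,\cdot)=\delta_x\mathbf 1_{x\ge x^\star}+\big(q_R(x)\delta_{R_u(x)}+(1-q_R(x))\delta_{R_d(x)}\big)\mathbf 1_{x<x^\star},$$ where 1. $x^\star=1/x_\star^S$ is the unique minimizer of $\delta F$; 2. $R_d(x)=\dfrac{1}{L_u^S(1/x)}$ and $R_u(x)=\dfrac{1}{L_d^S(1/x)}$ for $x>0$; 3. $q_R(x)=\dfrac{x}{R_u(x)}\big(1-q_L^S(1/x)\big)$ for $0<x<x^\star$.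
   Context: Notation: $\mathbb R_+^*=(0,\infty)$. $\mathcal P_1$ is the set of Borel probability measures $\mu$ on $\mathbb R_+^*$ with $\int x\,\mu(dx)=1$; $\mathcal P_1^d\subset\mathcal P_1$ is the subset of those having a positive density with respect to Lebesgue measure. $\mu\preccurlyeq\nu$ (convex order) means $\int f\,d\mu\le\int f\,d\nu$ for all convex $f:\mathbb R_+^*\to\mathbb R$. $F_\mu$ is the cumulative distribution function of $\mu$, $G_\mu(x)=\int_0^x y\,\mu(dy)$, $\delta F=F_\nu-F_\mu$, $\delta G=G_\nu-G_\mu$. On $(\mathbb R_+^* )^2$ let $X,Y$ be the coordinate maps. $\mathcal M(\mu,\nu)$ is the set of probability measures $Q$ on $(\mathbb R_+^* )^2$ such that under $Q$: $X\sim\mu$, $Y\sim\nu$, and $\mathbb E^Q[Y\mid X]=X$. For $\mu\in\mathcal P_1$, $S(\mu)\in\mathcal P_1$ is defined by $\int f\,dS(\mu)=\int x f(1/x)\,\mu(dx)$ for bounded measurable $f$. A measure $Q\in\mathcal M(\mu,\nu)$ is left-monotone (resp. right-monotone) if there exists a Borel set $\Gamma\subset(\mathbb R_+^* )^2$ with $Q(\Gamma)=1$ such that for all $(x,y^-),(x,y^+),(x',y')\in\Gamma$ one cannot have $x<x'$ and $y^-<y'<y^+$ (resp. $x>x'$ and $y^-<y'<y^+$). By a theorem of Beiglböck and Juillet, for marginals in convex order there exist a unique left-monotone and a unique right-monotone element of $\mathcal M(\mu,\nu)$, denoted $Q_L(\mu,\nu)$ and $Q_R(\mu,\nu)$. Known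 characterization of $Q_L$ (Henry-Labordère and Touzi): if $\mu,\nu\in\mathcal P_1^d$, $\mu\preccurlyeq\nu$ and $\delta F$ has a single local maximizer $x_\star$, then $Q_L(\mu,\nu)(dx,dy)=\mu(dx)\mathcal L_L(x,dy)$ with $$\mathcal L_L(x,\cdot)=\delta_x\mathbf 1_{x\le x_\star}+\big(q_L(x)\delta_{L_u(x)}+(1-q_L(x))\delta_{L_d(x)}\big)\mathbf 1_{x>x_\star},\qquad q_L(x)=\frac{x-L_d(x)}{L_u(x)-L_d(x)},$$ where $L_d,L_u$ are positive continuous functions on $(0,\infty)$ such that $L_d(x)=L_u(x)=x$ for $x\le x_\star$; $L_d(x)<x<L_u(x)$ for $x>x_\star$; on $(x_\star,\infty)$ $L_d$ is decreasing and $L_u$ is increasing. Moreover $L_d$ is the unique (such) solution of $F_\nu^{-1}(F_\mu(x)+\delta F(L_d(x)))=G_\nu^{-1}(G_\mu(x)+\delta G(L_d(x)))$ for $x>x_\star$, and $L_u$ is given by $F_\nu(L_u(x))=F_\mu(x)+\delta F(L_d(x))$ for $x>x_\star$. Under the hypotheses on $\mu,\nu$, the pair $S(\mu),S(\nu)$ satisfies the same hypotheses; the superscript $S$ (in $x_\star^S,L_d^S,L_u^S,q_L^S$) denotes the quantities $x_\star,L_d,L_u,q_L$ of this characterization applied to the marginals $S(\mu),S(\nu)$. *)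

theory Defs
  imports "HOL-Probability.Probability"
begin

text \<open>Measures on the positive half-line are measures whose sigma-algebra is the Borel
  sigma-algebra of the open interval, not measures on the whole line supported there.\<close>

definition pos_borel :: "real measure" where
  "pos_borel = restrict_space borel {0<..}"

definition P1 :: "real measure set" where
  "P1 = {M. sets M = sets pos_borel \<and> prob_space M \<and>
            integrable M (\<lambda>x. x) \<and> (\<integral>x. x \<partial>M) = 1}"

definition P1d :: "real measure set" where
  "P1d = {M \<in> P1. \<exists>f :: real \<Rightarrow> real. f \<in> borel_measurable pos_borel \<and> (\<forall>x>0. 0 < f x) \<and>
            M = density (restrict_space lborel {0<..}) (\<lambda>x. ennreal (f x))}"

text \<open>Integral with values in the extended reals. A convex function on the half-line has an affine
  minorant, so its negative part is integrable under every element of P1 and the difference below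
  is never of the form \<open>\<infinity> - \<infinity>\<close>.\<close>

definition ext_integral :: "'a measure \<Rightarrow> ('a \<Rightarrow> real) \<Rightarrow> ereal" where
  "ext_integral M f =
     enn2ereal (\<integral>\<^sup>+x. ennreal (f x) \<partial>M) - enn2ereal (\<integral>\<^sup>+x. ennreal (- f x) \<partial>M)"

definition convex_order :: "real measure \<Rightarrow> real measure \<Rightarrow> bool" (infix "\<preceq>\<^sub>c" 50) where
  "\<mu> \<preceq>\<^sub>c \<nu> \<longleftrightarrow>
     (\<forall>f :: real \<Rightarrow> real. convex_on {0<..} f \<longrightarrow> ext_integral \<mu> f \<le> ext_integral \<nu> f)"

text \<open>The library's \<open>cdf\<close> evaluates the measure on \<open>{..x}\<close>, which is not a measurable set here.\<close>

definition Fcdf :: "real measure \<Rightarrow> real \<Rightarrow> real" where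
  "Fcdf M x = measure M {0<..x}"

definition Gmom :: "real measure \<Rightarrow> real \<Rightarrow> real" where
  "Gmom M x = (LINT y:{0<..x}|M. y)"

definition deltaF :: "real measure \<Rightarrow> real measure \<Rightarrow> real \<Rightarrow> real" where
  "deltaF \<mu> \<nu> x = Fcdf \<nu> x - Fcdf \<mu> x"

definition deltaG :: "real measure \<Rightarrow> real measure \<Rightarrow> real \<Rightarrow> real" where
  "deltaG \<mu> \<nu> x = Gmom \<nu> x - Gmom \<mu> x"

definition local_maximizer :: "(real \<Rightarrow> real) \<Rightarrow> real \<Rightarrow> bool" where
  "local_maximizer g x \<longleftrightarrow> 0 < x \<and> (\<forall>\<^sub>F y in nhds x. g y \<le> g x)"

definition single_local_maximizer :: "(real \<Rightarrow> real) \<Rightarrow> real \<Rightarrow> bool" where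
  "single_local_maximizer g x \<longleftrightarrow> (\<forall>y. local_maximizer g y \<longleftrightarrow> y = x)"

definition mart_couplings :: "real measure \<Rightarrow> real measure \<Rightarrow> (real \<times> real) measure set" where
  "mart_couplings \<mu> \<nu> =
     {Q. sets Q = sets (pos_borel \<Otimes>\<^sub>M pos_borel) \<and> prob_space Q \<and>
         distr Q pos_borel fst = \<mu> \<and> distr Q pos_borel snd = \<nu> \<and>
         (AE \<omega> in Q. real_cond_exp Q (vimage_algebra (space Q) fst pos_borel) snd \<omega> = fst \<omega>)}"

definition right_monotone :: "(real \<times> real) measure \<Rightarrow> bool" where
  "right_monotone Q \<longleftrightarrow>
     (\<exists>\<Gamma> \<in> sets (pos_borel \<Otimes>\<^sub>M pos_borel). emeasure Q \<Gamma> = 1 \<and>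
        (\<forall>x y1 y2 x' y'. (x, y1) \<in> \<Gamma> \<longrightarrow> (x, y2) \<in> \<Gamma> \<longrightarrow> (x', y') \<in> \<Gamma> \<longrightarrow>
           \<not> (x > x' \<and> y1 < y' \<and> y' < y2)))"

definition Q_R :: "real measure \<Rightarrow> real measure \<Rightarrow> (real \<times> real) measure" where
  "Q_R \<mu> \<nu> = (THE Q. Q \<in> mart_couplings \<mu> \<nu> \<and> right_monotone Q)"

definition S_transform :: "real measure \<Rightarrow> real measure" where
  "S_transform \<mu> = distr (density \<mu> (\<lambda>x. ennreal x)) pos_borel (\<lambda>x. 1 / x)"

lemma integral_S_transform:
  fixes f :: "real \<Rightarrow> real"
  assumes s: "sets \<mu> = sets pos_borel" and f: "f \<in> borel_measurable pos_borel"
  shows "(\<integral>x. f x \<partial>S_transform \<mu>) = (\<integral>x. x * f (1 / x) \<partial>\<mu>)"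
proof -
  have sp: "space \<mu> = {0<..}"
    using sets_eq_imp_space_eq[OF s] by (simp add: pos_borel_def space_restrict_space)
  have inv: "(\<lambda>x. 1 / x) \<in> \<mu> \<rightarrow>\<^sub>M pos_borel"
    unfolding measurable_cong_sets[OF s refl] pos_borel_def
    by (rule measurable_restrict_space3) auto
  have "(\<integral>x. f x \<partial>S_transform \<mu>) = (\<integral>x. f (1 / x) \<partial>density \<mu> (\<lambda>x. ennreal x))"
    unfolding S_transform_def using inv f by (subst integral_distr) auto
  also have "\<dots> = (\<integral>x. x * f (1 / x) \<partial>\<mu>)"
  proof (subst integral_density)
    show "(\<lambda>x. f (1 / x)) \<in> borel_measurable \<mu>"
      using measurable_compose[OF inv f] .
    show "(\<lambda>x. x) \<in> borel_measurable \<mu>"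
      unfolding measurable_cong_sets[OF s refl] pos_borel_def
      by (rule measurable_restrict_space1) simp
    show "AE x in \<mu>. 0 \<le> x"
      by (rule AE_I2) (simp add: sp)
  qed simp
  finally show ?thesis .
qed

text \<open>The data \<open>(x\<^sub>\<star>, L\<^sub>d, L\<^sub>u, q\<^sub>L)\<close> of the left-monotone plan. The two membership conditions say that
  the inverses in the equation for \<open>L\<^sub>d\<close> are taken inside their domains, since
  \<open>the_inv_into\<close> is unspecified elsewhere.\<close>

definition left_characteristics ::
  "real measure \<Rightarrow> real measure \<Rightarrow> real \<Rightarrow> (real \<Rightarrow> real) \<Rightarrow> (real \<Rightarrow> real) \<Rightarrow> (real \<Rightarrow> real) \<Rightarrow> bool"
where
  "left_characteristics \<mu> \<nu> xs Ld Lu q \<longleftrightarrow>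
     single_local_maximizer (deltaF \<mu> \<nu>) xs \<and>
     continuous_on {0<..} Ld \<and> continuous_on {0<..} Lu \<and>
     (\<forall>x>0. 0 < Ld x \<and> 0 < Lu x) \<and>
     (\<forall>x. 0 < x \<and> x \<le> xs \<longrightarrow> Ld x = x \<and> Lu x = x) \<and>
     (\<forall>x>xs. Ld x < x \<and> x < Lu x) \<and>
     antimono_on {xs<..} Ld \<and> mono_on {xs<..} Lu \<and>
     (\<forall>x>xs.
        Fcdf \<mu> x + deltaF \<mu> \<nu> (Ld x) \<in> Fcdf \<nu> ` {0<..} \<and>
        Gmom \<mu> x + deltaG \<mu> \<nu> (Ld x) \<in> Gmom \<nu> ` {0<..} \<and>
        the_inv_into {0<..} (Fcdf \<nu>) (Fcdf \<mu> x + deltaF \<mu> \<nu> (Ld x)) =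
        the_inv_into {0<..} (Gmom \<nu>) (Gmom \<mu> x + deltaG \<mu> \<nu> (Ld x))) \<and>
     (\<forall>x>xs. Fcdf \<nu> (Lu x) = Fcdf \<mu> x + deltaF \<mu> \<nu> (Ld x)) \<and>
     (\<forall>x>xs. q x = (x - Ld x) / (Lu x - Ld x))"

text \<open>The measure \<open>q \<delta>\<^sub>a + (1 - q) \<delta>\<^sub>b\<close>. As \<open>ennreal\<close> truncates negative reals, it has total
  mass 1 exactly when \<open>0 \<le> q \<le> 1\<close>.\<close>

definition two_point :: "real \<Rightarrow> real \<Rightarrow> real \<Rightarrow> real measure" where
  "two_point q a b = measure_of (space pos_borel) (sets pos_borel)
     (\<lambda>A. ennreal q * indicator A a + ennreal (1 - q) * indicator A b)"

lemma emeasure_two_point: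
  assumes "A \<in> sets pos_borel"
  shows "emeasure (two_point q a b) A = ennreal q * indicator A a + ennreal (1 - q) * indicator A b"
proof (rule emeasure_measure_of[OF two_point_def])
  show "sets pos_borel \<subseteq> Pow (space pos_borel)" by (rule sets.space_closed)
  show "A \<in> sets (two_point q a b)"
    using assms unfolding two_point_def by simp
  show "positive (sets (two_point q a b))
     (\<lambda>A. ennreal q * indicator A a + ennreal (1 - q) * indicator A b)"
    by (simp add: positive_def)
  show "countably_additive (sets (two_point q a b))
     (\<lambda>A. ennreal q * indicator A a + ennreal (1 - q) * indicator A b)"
    unfolding countably_additive_def
    by (auto simp: suminf_add[symmetric] suminf_indicator ennreal_suminf_cmult)
qed

definition right_kernel ::
  "real \<Rightarrow> (real \<Rightarrow> real) \<Rightarrow> (real \<Rightarrow> real) \<Rightarrow> (real \<Rightarrow> real) \<Rightarrow> real \<Rightarrow> real measure" where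
  "right_kernel xr q Ru Rd x =
     (if xr \<le> x then return pos_borel x else two_point (q x) (Ru x) (Rd x))"

text \<open>The measure \<open>\<mu>(dx) K(x, dy)\<close>, for a probability kernel \<open>K\<close>.\<close>

definition semidirect :: "real measure \<Rightarrow> (real \<Rightarrow> real measure) \<Rightarrow> (real \<times> real) measure" where
  "semidirect \<mu> K = \<mu> \<bind> (\<lambda>x. distr (K x) (pos_borel \<Otimes>\<^sub>M pos_borel) (\<lambda>y. (x, y)))"

end

theory Submission
  imports Defs
begin

text \<open>The difference \<open>\<delta>F\<close> of the distribution functions increases, decreases down to its minimum at
  \<open>c\<close>, and increases again, and \<open>\<delta>G\<close> has the same minimizer. Since the transform \<open>S\<close> turns
  \<open>F(y)\<close> into \<open>1 - G(1/y)\<close> and \<open>G(y)\<close> into \<open>1 - F(1/y)\<close>, this gives \<open>c = 1/xS\<close>, and the equations for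
  \<open>LdS\<close> and \<open>LuS\<close> say that \<open>\<mu>\<close> on \<open>(t, Ru t)\<close> and \<open>\<nu>\<close> on \<open>(Rd t, Ru t)\<close> have the same mass and
  the same first moment.

  Conversely, if a right-monotone martingale coupling is restricted to the starting points above
  \<open>t\<close>, then its second marginal is \<open>\<nu>\<close> on one interval \<open>(a, b)\<close> and \<open>\<mu>\<close> beyond \<open>b\<close>, where
  \<open>(a, b)\<close> solves these two equations. The solution is unique, so there is at most one such coupling.

  For existence, the mass and moment identities say that the starting point \<open>T\<close> of a terminal value
  has the right law under \<open>\<nu>\<close> and under its size-biased version. As \<open>y\<close> takes only the two values
  \<open>Rd (T y)\<close> and \<open>Ru (T y)\<close>, every function of \<open>y\<close> is affine in \<open>y\<close> given \<open>T y\<close>, so these two laws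
  determine the second marginal of the kernel.\<close>

section \<open>Laws on the half-line\<close>

text \<open>The convex order enters through the put functions (x - y)^+. The difference
  \<open>H\<close> of their integrals is nonnegative, vanishes at 0 and at infinity and has
  derivative \<delta>F, so its sign controls the sign of \<delta>F. As \<delta>G = x \<delta>F - H,
  equal masses and moments on an interval mean that the chord of \<open>H\<close> has as slope the
  common value of \<delta>F at both ends. The shape of \<delta>F decides when that can happen.

  First moments are masses of the size-biased law. Interval formulas and comparisons of laws are
  therefore proved once for atomless laws and applied twice.

  The branches are only known to be continuous and weakly monotone, which rules out a change of
  variables by derivatives. Laws are compared on tails instead: the event that the starting point is
  at least t is an interval with end points on the branches. The distance Ru - Rd, by which the
  two-point weights divide, vanishes at \<open>c\<close>; integrals are compared with this factor in
  place, and it is divided out afterwards, off a null set.\<close>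

lemma sets_pos_borel_iff: "A \<in> sets pos_borel \<longleftrightarrow> A \<in> sets borel \<and> A \<subseteq> {0<..}"
  unfolding pos_borel_def by (subst sets_restrict_space_iff) auto

lemma space_pos_borel [simp]: "space pos_borel = {0<..}"
  by (simp add: pos_borel_def space_restrict_space)

text \<open>A law in \<open>P1d\<close> and its size-biased version are both instances, so a formula
  proved here for \<open>Fcdf\<close> serves for \<open>Gmom\<close> too. Without atoms, open and
  closed end points give the same mass.\<close>

locale pos_law = prob_space M for M :: "real measure" +
  assumes sets_M: "sets M = sets pos_borel"
    and null_singleton: "emeasure M {x} = 0"
begin

lemma space_M [simp]: "space M = {0<..}"
  using sets_eq_imp_space_eq[OF sets_M] by simp

lemma sets_M_iff: "A \<in> sets M \<longleftrightarrow> A \<in> sets borel \<and> A \<subseteq> {0<..}"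
  by (simp add: sets_M sets_pos_borel_iff)

lemma borel_measurable_M: "f \<in> borel_measurable borel \<Longrightarrow> f \<in> borel_measurable M"
  unfolding measurable_cong_sets[OF sets_M refl] pos_borel_def
  by (rule measurable_restrict_space1)

lemma measure_null_diff:
  assumes "A \<in> sets M" "B \<in> sets M" "A \<subseteq> B" "B \<subseteq> A \<union> {c, d}"
  shows "measure M A = measure M B"
proof -
  have "B - A \<in> null_sets M"
  proof (rule null_sets_subset)
    show "{c, d} \<inter> {0<..} \<in> null_sets M"
    proof -
      have "{e} \<inter> {0<..} \<in> null_sets M" for e
        by (cases "e > 0") (auto simp: null_sets_def null_singleton sets_M_iff)
      from null_sets.Un[OF this[of c] this[of d]] show ?thesis
        by (simp add: Int_Un_distrib2[symmetric] insert_commute)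
    qed
    show "B - A \<in> sets M" using assms by auto
    show "B - A \<subseteq> {c, d} \<inter> {0<..}" using assms sets_M_iff by auto
  qed
  then have "measure M (B - A) = 0" by (simp add: measure_eq_0_null_sets)
  then show ?thesis using finite_measure_Diff[of B A] assms by simp
qed

lemma Fcdf_eq_cdf: "Fcdf M x = cdf (distr M borel (\<lambda>x. x)) x"
proof -
  have "{..x} \<inter> {0<..} = {0<..x}" by auto
  then show ?thesis
    by (simp add: cdf_def Fcdf_def measure_distr borel_measurable_M)
qed

sublocale D: real_distribution "distr M borel (\<lambda>x. x)"
  by (simp add: real_distribution_def real_distribution_axioms_def prob_space_distr borel_measurable_M)

lemma Fcdf_nonpos: "x \<le> 0 \<Longrightarrow> Fcdf M x = 0" by (simp add: Fcdf_def)

lemma Fcdf_le_1: "Fcdf M x \<le> 1" by (simp add: Fcdf_def)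

lemma Fcdf_nonneg: "0 \<le> Fcdf M x" by (simp add: Fcdf_def)

lemma isCont_Fcdf: "isCont (Fcdf M) x"
proof -
  have "measure (distr M borel (\<lambda>x. x)) {x} = 0"
    using null_singleton[of x]
    by (cases "x > 0") (simp_all add: measure_distr borel_measurable_M, simp add: measure_def)
  then show ?thesis
    using D.isCont_cdf[of x] Fcdf_eq_cdf by presburger
qed

lemma Fcdf_tendsto_1: "(Fcdf M \<longlongrightarrow> 1) at_top"
  using D.cdf_lim_at_top_prob Fcdf_eq_cdf by presburger

lemma measure_interval:
  assumes "A \<in> sets borel" "{a<..<b} \<subseteq> A" "A \<subseteq> {a..b}" "A \<subseteq> {0<..}" "0 \<le> a" "a \<le> b"
  shows "measure M A = Fcdf M b - Fcdf M a"
proof -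
  have "measure M A = measure M (A - {a, b})"
    by (rule measure_null_diff[symmetric, of _ _ a b]) (use assms in \<open>auto simp: sets_M_iff\<close>)
  also have "A - {a, b} = {a<..<b}" using assms by force
  also have "measure M {a<..<b} = measure M {a<..b}"
    by (rule measure_null_diff[of _ _ a b]) (use assms in \<open>auto simp: sets_M_iff\<close>)
  also have "{a<..b} = {0<..b} - {0<..a}" using assms by auto
  also have "measure M \<dots> = Fcdf M b - Fcdf M a"
    unfolding Fcdf_def by (rule finite_measure_Diff) (use assms in \<open>auto simp: sets_M_iff\<close>)
  finally show ?thesis .
qed

lemma measure_tail:
  assumes "A \<in> sets borel" "{a<..} \<subseteq> A" "A \<subseteq> {a..}" "A \<subseteq> {0<..}" "0 \<le> a"
  shows "measure M A = 1 - Fcdf M a"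
proof -
  have "measure M A = measure M {a<..}"
    by (rule measure_null_diff[symmetric, of _ _ a a]) (use assms in \<open>auto simp: sets_M_iff\<close>)
  also have "{a<..} = space M - {0<..a}" using assms by auto
  also have "measure M \<dots> = 1 - Fcdf M a"
    unfolding Fcdf_def by (rule prob_compl) (use assms in \<open>auto simp: sets_M_iff\<close>)
  finally show ?thesis .
qed

lemma measure_Ioo: "0 \<le> a \<Longrightarrow> a \<le> b \<Longrightarrow> measure M {a<..<b} = Fcdf M b - Fcdf M a"
  by (rule measure_interval) auto

lemma measure_Ioc: "0 \<le> a \<Longrightarrow> a \<le> b \<Longrightarrow> measure M {a<..b} = Fcdf M b - Fcdf M a"
  by (rule measure_interval) auto

lemma measure_Ico: "0 < a \<Longrightarrow> a \<le> b \<Longrightarrow> measure M {a..<b} = Fcdf M b - Fcdf M a"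
  by (rule measure_interval) auto

lemma measure_Icc: "0 < a \<Longrightarrow> a \<le> b \<Longrightarrow> measure M {a..b} = Fcdf M b - Fcdf M a"
  by (rule measure_interval) auto

lemma measure_Ioi: "0 \<le> a \<Longrightarrow> measure M {a<..} = 1 - Fcdf M a"
  by (rule measure_tail) auto

lemma measure_Ici: "0 < a \<Longrightarrow> measure M {a..} = 1 - Fcdf M a"
  by (rule measure_tail) auto

lemmas measure_intervals = measure_Ioo measure_Ioc measure_Ico measure_Icc measure_Ioi measure_Ici

end

section \<open>Size biasing, and laws with a positive density\<close>

definition size_biased :: "real measure \<Rightarrow> real measure" where
  "size_biased M = density M (\<lambda>x. ennreal x)"

locale P1d_law =
  fixes M assumes M: "M \<in> P1d"
begin

lemma sets_M0: "sets M = sets pos_borel" using M by (simp add: P1d_def P1_def)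

text \<open>Positivity of the density is used in this form. It excludes atoms and charges every
  nonempty interval, which makes \<open>Fcdf\<close> and \<open>Gmom\<close> strictly
  increasing.\<close>

lemma null_lborel: "A \<in> sets pos_borel \<Longrightarrow> emeasure M A = 0 \<longleftrightarrow> emeasure lborel A = 0"
proof -
  assume A: "A \<in> sets pos_borel"
  then have A': "A \<in> sets borel" "A \<subseteq> {0<..}" by (auto simp: sets_pos_borel_iff)
  obtain f where f: "f \<in> borel_measurable pos_borel" "\<And>x. x > 0 \<Longrightarrow> 0 < f x"
    and Mf: "M = density (restrict_space lborel {0<..}) (\<lambda>x. ennreal (f x))"
    using M by (auto simp: P1d_def)
  let ?L = "restrict_space lborel {0<..} :: real measure"
  have sL: "sets ?L = sets pos_borel"
    unfolding pos_borel_def by (rule sets_restrict_space_cong) simp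
  have AL: "A \<in> sets ?L" using A sL by simp
  have "f \<in> borel_measurable ?L"
    using f(1) unfolding measurable_cong_sets[OF sL refl] .
  then have "(\<lambda>x. ennreal (f x)) \<in> borel_measurable ?L" by measurable
  then have "emeasure M A = 0 \<longleftrightarrow> (AE x in ?L. x \<in> A \<longrightarrow> ennreal (f x) = 0)"
    unfolding Mf using AL by (subst emeasure_density) (auto simp: nn_integral_0_iff_AE indicator_def)
  also have "\<dots> \<longleftrightarrow> (AE x in ?L. x \<notin> A)"
    by (rule AE_cong) (use f(2) A' in \<open>force simp: ennreal_eq_0_iff not_le\<close>)
  also have "\<dots> \<longleftrightarrow> A \<in> null_sets ?L"
    using AL by (simp add: AE_iff_null_sets)
  also have "\<dots> \<longleftrightarrow> emeasure lborel A = 0"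
    using AL A' by (simp add: null_sets_def emeasure_restrict_space)
  finally show ?thesis .
qed

sublocale F: pos_law M
proof -
  have p: "prob_space M" using M by (simp add: P1d_def P1_def)
  have "emeasure M {x} = 0" for x
  proof (cases "x > 0")
    case True then show ?thesis by (subst null_lborel) (auto simp: sets_pos_borel_iff)
  next
    case False then show ?thesis
      by (intro emeasure_notin_sets) (auto simp: sets_M0 sets_pos_borel_iff)
  qed
  then show "pos_law M" using p sets_M0 by (simp add: pos_law_def pos_law_axioms_def)
qed

lemma integrable_id: "integrable M (\<lambda>x. x)" using M by (simp add: P1d_def P1_def)

lemma integral_id: "(\<integral>x. x \<partial>M) = 1" using M by (simp add: P1d_def P1_def)

lemma sets_size_biased [simp]: "sets (size_biased M) = sets M" by (simp add: size_biased_def)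

lemma emeasure_size_biased: "A \<in> sets M \<Longrightarrow> emeasure (size_biased M) A = ennreal (LINT x:A|M. x)"
proof -
  assume A: "A \<in> sets M"
  have "emeasure (size_biased M) A = (\<integral>\<^sup>+x. ennreal x * indicator A x \<partial>M)"
    unfolding size_biased_def using A by (intro emeasure_density) (auto intro: F.borel_measurable_M)
  also have "\<dots> = (\<integral>\<^sup>+x. ennreal (indicator A x * x) \<partial>M)"
    by (intro nn_integral_cong) (auto simp: indicator_def)
  also have "\<dots> = ennreal (\<integral>x. indicator A x * x \<partial>M)"
    using integrable_mult_indicator[OF A integrable_id] by (intro nn_integral_eq_integral AE_I2) auto
  finally show ?thesis by (simp add: set_lebesgue_integral_def)
qed

lemma set_integral_nonneg: "A \<in> sets M \<Longrightarrow> 0 \<le> (LINT x:A|M. x)"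
  unfolding set_lebesgue_integral_def
  by (intro integral_nonneg_AE AE_I2) (auto simp: indicator_def)

lemma measure_size_biased: "A \<in> sets M \<Longrightarrow> measure (size_biased M) A = (LINT x:A|M. x)"
  using emeasure_size_biased set_integral_nonneg by (simp add: measure_def)

lemma Fcdf_size_biased: "Fcdf (size_biased M) = Gmom M"
  unfolding Fcdf_def Gmom_def fun_eq_iff by (intro allI measure_size_biased) (auto simp: F.sets_M_iff)

sublocale G: pos_law "size_biased M"
proof -
  have "emeasure (size_biased M) (space M) = ennreal (LINT x:space M|M. x)"
    by (rule emeasure_size_biased) (rule sets.top)
  also have "(LINT x:space M|M. x) = 1"
    using integral_id set_integral_space[OF integrable_id] by metis
  finally have "prob_space (size_biased M)" by (intro prob_spaceI) (simp add: size_biased_def)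
  moreover have "emeasure (size_biased M) {x} = 0" for x
  proof (cases "x > 0")
    case True
    then have x: "{x} \<in> sets M" by (simp add: F.sets_M_iff)
    then have "AE y in M. y \<notin> {x}" using F.null_singleton AE_not_in null_setsI by blast
    then have "AE y in M. indicator {x} y *\<^sub>R y = 0" by (rule AE_mp) simp
    then have "(LINT y:{x}|M. y) = 0"
      unfolding set_lebesgue_integral_def by (rule integral_eq_zero_AE)
    then show ?thesis using emeasure_size_biased[OF x] by simp
  next
    case False then show ?thesis
      by (intro emeasure_notin_sets) (auto simp: F.sets_M_iff)
  qed
  ultimately show "pos_law (size_biased M)" using F.sets_M by (simp add: pos_law_def pos_law_axioms_def)
qed

lemma Fcdf_strict_mono: assumes "0 \<le> a" "a < b" shows "Fcdf M a < Fcdf M b"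
proof -
  have "{a<..b} \<in> sets pos_borel" using assms by (auto simp: sets_pos_borel_iff)
  with null_lborel[OF this] assms have "emeasure M {a<..b} \<noteq> 0" by simp
  then have "measure M {a<..b} > 0" by (simp add: F.emeasure_eq_measure zero_less_measure_iff)
  then show ?thesis using F.measure_interval[of "{a<..b}" a b] assms by (auto simp: subset_eq)
qed

text \<open>The integrand lies between a and b on \<open>{a<..b}\<close>. The two inequalities are
  the derivative-free form of dG = x dF.\<close>

lemma Gmom_bounds:
  assumes "0 \<le> a" "a \<le> b"
  shows "a * (Fcdf M b - Fcdf M a) \<le> Gmom M b - Gmom M a"
    "Gmom M b - Gmom M a \<le> b * (Fcdf M b - Fcdf M a)"
proof -
  let ?A = "{a<..b}"
  have A: "?A \<in> sets M" using assms by (auto simp: F.sets_M_iff)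
  have g: "(LINT x:?A|M. x) = Gmom M b - Gmom M a"
    using G.measure_interval[of ?A a b] assms by (auto simp: Fcdf_size_biased measure_size_biased[OF A] subset_eq)
  have f: "measure M ?A = Fcdf M b - Fcdf M a"
    using F.measure_interval[of ?A a b] assms by (auto simp: subset_eq)
  have c: "(LINT x:?A|M. c) = c * measure M ?A" for c :: real
    using A sets.Int_space_eq2[OF A] by (simp add: set_lebesgue_integral_def)
  have i: "set_integrable M ?A (\<lambda>x. x)" "set_integrable M ?A (\<lambda>x. c)" for c :: real
    unfolding set_integrable_def using integrable_mult_indicator[OF A integrable_id] A
    by (auto intro!: integrable_mult_left integrable_real_indicator simp: F.emeasure_finite less_top[symmetric])
  show "a * (Fcdf M b - Fcdf M a) \<le> Gmom M b - Gmom M a"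
    unfolding g[symmetric] f[symmetric] c[symmetric] by (rule set_integral_mono) (use i in auto)
  show "Gmom M b - Gmom M a \<le> b * (Fcdf M b - Fcdf M a)"
    unfolding g[symmetric] f[symmetric] c[symmetric] by (rule set_integral_mono) (use i in auto)
qed

text \<open>The right half of the interval has positive mass, and there the integrand is at least
  the midpoint.\<close>

lemma Gmom_lower_strict:
  assumes "0 \<le> a" "a < b"
  shows "a * (Fcdf M b - Fcdf M a) < Gmom M b - Gmom M a"
proof -
  let ?c = "(a + b) / 2"
  have c: "0 \<le> ?c" "a < ?c" "?c < b" using assms by auto
  have F: "Fcdf M a < Fcdf M ?c" "Fcdf M ?c < Fcdf M b"
    using Fcdf_strict_mono c assms by auto
  have m: "a * (Fcdf M b - Fcdf M ?c) < ?c * (Fcdf M b - Fcdf M ?c)"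
    using F c by (auto intro: mult_strict_right_mono)
  have e: "a * (Fcdf M b - Fcdf M a) = a * (Fcdf M b - Fcdf M ?c) + a * (Fcdf M ?c - Fcdf M a)"
    by (simp add: algebra_simps)
  show "a * (Fcdf M b - Fcdf M a) < Gmom M b - Gmom M a"
    using Gmom_bounds(1)[of a ?c] Gmom_bounds(1)[of ?c b] c m assms e by linarith
qed

lemma Gmom_strict_mono: assumes "0 \<le> a" "a < b" shows "Gmom M a < Gmom M b"
proof -
  have "0 \<le> a * (Fcdf M b - Fcdf M a)" using Fcdf_strict_mono[OF assms] assms by simp
  then show ?thesis using Gmom_lower_strict[OF assms] by linarith
qed

section \<open>The put potential of a law\<close>

definition Kpot :: "real \<Rightarrow> real" where "Kpot x = x * Fcdf M x - Gmom M x"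

lemma Kpot_bounds:
  assumes "0 \<le> a" "a \<le> b"
  shows "(b - a) * Fcdf M a \<le> Kpot b - Kpot a" "Kpot b - Kpot a \<le> (b - a) * Fcdf M b"
  using Gmom_bounds[OF assms] by (auto simp: Kpot_def algebra_simps)

text \<open>By \<open>Kpot_bounds\<close> each difference quotient lies between the values of
  \<open>Fcdf M\<close> at its two ends, and \<open>Fcdf M\<close> is continuous.\<close>

lemma Kpot_deriv: assumes "0 < x" shows "(Kpot has_real_derivative Fcdf M x) (at x)"
proof -
  have "((\<lambda>y. (Kpot y - Kpot x) / (y - x)) \<longlongrightarrow> Fcdf M x) (at x)"
  proof (rule tendsto_sandwich)
    have c: "(Fcdf M \<longlongrightarrow> Fcdf M x) (at x)" using F.isCont_Fcdf isContD by blast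
    show "((\<lambda>y. min (Fcdf M x) (Fcdf M y)) \<longlongrightarrow> Fcdf M x) (at x)"
      using tendsto_min[OF tendsto_const c, of "Fcdf M x"] by simp
    show "((\<lambda>y. max (Fcdf M x) (Fcdf M y)) \<longlongrightarrow> Fcdf M x) (at x)"
      using tendsto_max[OF tendsto_const c, of "Fcdf M x"] by simp
    have ev: "\<forall>\<^sub>F y in at x. 0 < y \<and> y \<noteq> x"
      using assms eventually_at_in_open[of "{0<..}" x] by (auto elim: eventually_mono)
    have "min (Fcdf M x) (Fcdf M y) \<le> (Kpot y - Kpot x) / (y - x) \<and>
       (Kpot y - Kpot x) / (y - x) \<le> max (Fcdf M x) (Fcdf M y)" if "0 < y \<and> y \<noteq> x" for y
    proof (cases "x < y")
      case True
      then show ?thesis using Kpot_bounds[of x y] assms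
        by (auto simp: min_le_iff_disj le_max_iff_disj field_simps)
    next
      case False
      then have "y < x" using that by auto
      moreover have "(Kpot y - Kpot x) / (y - x) = (Kpot x - Kpot y) / (x - y)"
        by (metis minus_diff_eq minus_divide_divide)
      ultimately show ?thesis using Kpot_bounds[of y x] that
        by (auto simp: min_le_iff_disj le_max_iff_disj field_simps)
    qed
    then show "\<forall>\<^sub>F y in at x. min (Fcdf M x) (Fcdf M y) \<le> (Kpot y - Kpot x) / (y - x)"
      "\<forall>\<^sub>F y in at x. (Kpot y - Kpot x) / (y - x) \<le> max (Fcdf M x) (Fcdf M y)"
      using ev by (auto elim!: eventually_mono)
  qed
  then show ?thesis by (simp add: has_field_derivative_iff)
qed

lemma Kpot_0: "Kpot 0 = 0" using G.Fcdf_nonpos[of 0] by (simp add: Kpot_def Fcdf_size_biased)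

text \<open>Recognises \<open>Kpot x\<close> as the integral of a convex function, which is what the
  convex order can compare.\<close>

lemma Kpot_nn_integral: assumes "0 < x"
  shows "(\<integral>\<^sup>+y. ennreal (max (x - y) 0) \<partial>M) = ennreal (Kpot x)"
proof -
  have A: "{0<..x} \<in> sets M" by (auto simp: F.sets_M_iff)
  have e: "max (x - y) 0 = x * indicator {0<..x} y - indicator {0<..x} y * y" if "y \<in> space M" for y
    using that by (auto simp: indicator_def)
  have i: "integrable M (\<lambda>y. indicator {0<..x} y * y)" "integrable M (\<lambda>y. x * indicator {0<..x} y)"
    using integrable_mult_indicator[OF A integrable_id] A
    by (auto intro!: integrable_mult_right integrable_real_indicator simp: F.emeasure_finite less_top[symmetric])
  have "(\<integral>\<^sup>+y. ennreal (max (x - y) 0) \<partial>M) =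
      (\<integral>\<^sup>+y. ennreal (x * indicator {0<..x} y - indicator {0<..x} y * y) \<partial>M)"
    by (intro nn_integral_cong) (simp add: e)
  also have "\<dots> = ennreal (\<integral>y. x * indicator {0<..x} y - indicator {0<..x} y * y \<partial>M)"
    using i by (intro nn_integral_eq_integral AE_I2 Bochner_Integration.integrable_diff) (auto simp: indicator_def)
  also have "(\<integral>y. x * indicator {0<..x} y - indicator {0<..x} y * y \<partial>M) = Kpot x"
  proof -
    have "{0<..x} \<inter> {0<..} = {0<..x}" by auto
    then show ?thesis using i A by (simp add: Kpot_def Fcdf_def Gmom_def set_lebesgue_integral_def)
  qed
  finally show ?thesis .
qed

lemma Kpot_nonneg: "0 \<le> x \<Longrightarrow> 0 \<le> Kpot x"
  using Kpot_bounds(1)[of 0 x] Kpot_0 F.Fcdf_nonpos[of 0] by auto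

text \<open>The difference equals (1 - G x) - x (1 - F x), the integral of (y - x)^+ for a law of
  mean 1, and lies between 0 and 1 - G x. Two laws with the same mean thus have potentials that
  merge at infinity.\<close>

lemma Kpot_tendsto: "((\<lambda>x. Kpot x - (x - 1)) \<longlongrightarrow> 0) at_top"
proof (rule tendsto_sandwich)
  have G: "(Gmom M \<longlongrightarrow> 1) at_top" using G.Fcdf_tendsto_1 by (simp add: Fcdf_size_biased)
  have "x * (1 - Fcdf M x) \<le> 1 - Gmom M x" if "0 \<le> x" for x
  proof (rule tendsto_le)
    show "((\<lambda>b. x * (Fcdf M b - Fcdf M x)) \<longlongrightarrow> x * (1 - Fcdf M x)) at_top"
      by (intro tendsto_intros F.Fcdf_tendsto_1)
    show "((\<lambda>b. Gmom M b - Gmom M x) \<longlongrightarrow> 1 - Gmom M x) at_top"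
      by (intro tendsto_intros G)
    show "\<forall>\<^sub>F b in at_top. x * (Fcdf M b - Fcdf M x) \<le> Gmom M b - Gmom M x"
      using eventually_ge_at_top[of x] by eventually_elim (use that Gmom_bounds in auto)
  qed simp
  then have "0 \<le> Kpot x - (x - 1)" if "0 \<le> x" for x
    using that by (simp add: Kpot_def algebra_simps)
  then show "\<forall>\<^sub>F x in at_top. 0 \<le> Kpot x - (x - 1)"
    by (rule eventually_mono[OF eventually_ge_at_top[of 0]])
  show "\<forall>\<^sub>F x in at_top. Kpot x - (x - 1) \<le> 1 - Gmom M x"
    using eventually_ge_at_top[of 0]
    by eventually_elim (use F.Fcdf_le_1 in \<open>auto simp: Kpot_def algebra_simps intro!: mult_left_le\<close>)
  show "((\<lambda>x. 1 - Gmom M x) \<longlongrightarrow> 0) at_top"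
    using tendsto_diff[OF tendsto_const G, of 1] by simp
qed simp

end

section \<open>The shape of the difference of the distribution functions\<close>

text \<open>The assumption is the convex order tested on put functions, the form in which the order
  is used from here on.\<close>

locale P1d_pair = mu: P1d_law \<mu> + nu: P1d_law \<nu> for \<mu> \<nu> :: "real measure" +
  assumes Kpot_le: "0 \<le> x \<Longrightarrow> mu.Kpot x \<le> nu.Kpot x"
begin

abbreviation \<delta> :: "real \<Rightarrow> real" where "\<delta> \<equiv> deltaF \<mu> \<nu>"

definition H :: "real \<Rightarrow> real" where "H x = nu.Kpot x - mu.Kpot x"

lemma H_eq: "H x = x * \<delta> x - deltaG \<mu> \<nu> x"
  by (simp add: H_def nu.Kpot_def mu.Kpot_def deltaF_def deltaG_def algebra_simps)

lemma H_nonneg: "0 \<le> x \<Longrightarrow> 0 \<le> H x" using Kpot_le by (simp add: H_def)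

lemma H_0: "H 0 = 0" by (simp add: H_def mu.Kpot_0 nu.Kpot_0)

lemma delta_0: "\<delta> 0 = 0" by (simp add: deltaF_def mu.F.Fcdf_nonpos nu.F.Fcdf_nonpos)

lemma isCont_delta: "isCont \<delta> x"
  unfolding deltaF_def[abs_def] by (intro continuous_intros mu.F.isCont_Fcdf nu.F.isCont_Fcdf)

lemma continuous_on_delta: "continuous_on A \<delta>"
  using isCont_delta continuous_at_imp_continuous_on by blast

lemma delta_tendsto: "(\<delta> \<longlongrightarrow> 0) at_top"
  unfolding deltaF_def[abs_def] using tendsto_diff[OF nu.F.Fcdf_tendsto_1 mu.F.Fcdf_tendsto_1] by simp

lemma H_tendsto: "(H \<longlongrightarrow> 0) at_top"
  using tendsto_diff[OF nu.Kpot_tendsto mu.Kpot_tendsto] by (simp add: H_def[abs_def])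

lemma H_deriv: "0 < x \<Longrightarrow> (H has_real_derivative \<delta> x) (at x)"
  unfolding H_def[abs_def] deltaF_def
  by (intro DERIV_diff nu.Kpot_deriv mu.Kpot_deriv)

lemma H_mvt:
  assumes "0 \<le> a" "a < b"
  obtains z where "a < z" "z < b" "H b - H a = (b - a) * \<delta> z"
proof -
  have c: "continuous_on {a..b} H"
  proof -
    have "isCont H x" for x
      unfolding H_def[abs_def] mu.Kpot_def[abs_def] nu.Kpot_def[abs_def]
        mu.Fcdf_size_biased[symmetric] nu.Fcdf_size_biased[symmetric]
      by (intro continuous_intros mu.F.isCont_Fcdf nu.F.isCont_Fcdf mu.G.isCont_Fcdf nu.G.isCont_Fcdf)
    then show ?thesis using continuous_at_imp_continuous_on by blast
  qed
  have d: "H differentiable (at x)" if "0 < x" for x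
    using H_deriv[OF that] real_differentiable_def by blast
  have "\<exists>l z. a < z \<and> z < b \<and> DERIV H z :> l \<and> H b - H a = (b - a) * l"
    using assms by (intro MVT c) (use assms in \<open>auto intro: d\<close>)
  then obtain l z where z: "a < z" "z < b" "DERIV H z :> l" "H b - H a = (b - a) * l" by blast
  moreover have "l = \<delta> z" using z(3) H_deriv[of z] z assms DERIV_unique by auto
  ultimately show ?thesis using that by blast
qed

text \<open>Integrated form of H' = \<delta>F: a one-sided bound on \<delta>F bounds the chords of
  \<open>H\<close>. Combined with \<open>H_eq\<close> it takes the place of integration by
  parts.\<close>

lemma H_less:
  assumes "0 \<le> a" "a < b" "\<And>z. a < z \<Longrightarrow> z < b \<Longrightarrow> k < \<delta> z"
  shows "k * (b - a) < H b - H a"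
  by (rule H_mvt[OF assms(1,2)]) (use assms in \<open>simp add: mult.commute\<close>)

lemma H_greater:
  assumes "0 \<le> a" "a < b" "\<And>z. a < z \<Longrightarrow> z < b \<Longrightarrow> \<delta> z < k"
  shows "H b - H a < k * (b - a)"
  by (rule H_mvt[OF assms(1,2)]) (use assms in \<open>simp add: mult.commute\<close>)

end

locale unimodal_pair = P1d_pair +
  fixes m c :: real
  assumes m_pos: "0 < m" and m_less_c: "m < c"
    and delta_inc_left: "\<lbrakk>0 \<le> u; u < v; v \<le> m\<rbrakk> \<Longrightarrow> deltaF \<mu> \<nu> u < deltaF \<mu> \<nu> v"
    and delta_dec: "\<lbrakk>m \<le> u; u < v; v \<le> c\<rbrakk> \<Longrightarrow> deltaF \<mu> \<nu> v < deltaF \<mu> \<nu> u"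
    and delta_inc: "\<lbrakk>c \<le> u; u < v\<rbrakk> \<Longrightarrow> deltaF \<mu> \<nu> u < deltaF \<mu> \<nu> v"

text \<open>Without further local maximizers, \<delta>F can have at most one valley on each side of
  m. The sign of \<open>H\<close> excludes a valley to the left of m, and the limit of
  \<open>H\<close> forces one to the right.\<close>

lemma (in P1d_pair) unimodal:
  assumes m: "single_local_maximizer \<delta> m"
  obtains c where "unimodal_pair \<mu> \<nu> m c"
proof -
  have m_pos: "0 < m" using m by (auto simp: single_local_maximizer_def local_maximizer_def)
  \<comment> \<open>Otherwise the maximum over \<open>{u..v}\<close> is attained inside: if only an
    end point seems to attain it, then w attains it too. This gives a local maximizer other than
    m.\<close>
  have between: "\<delta> w < max (\<delta> u) (\<delta> v)"
    if uv: "0 \<le> u" "u < w" "w < v" and nm: "m \<notin> {u<..<v}" for u v w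
  proof (rule ccontr)
    assume "\<not> ?thesis"
    then have w: "\<delta> u \<le> \<delta> w" "\<delta> v \<le> \<delta> w" by auto
    have "{u..v} \<noteq> {}" using uv by auto
    then obtain z where z: "z \<in> {u..v}" "\<And>y. y \<in> {u..v} \<Longrightarrow> \<delta> y \<le> \<delta> z"
      using continuous_attains_sup[OF compact_Icc _ continuous_on_delta] by blast
    have "\<exists>z'\<in>{u<..<v}. \<forall>y\<in>{u..v}. \<delta> y \<le> \<delta> z'"
    proof (cases "z \<in> {u<..<v}")
      case True then show ?thesis using z by blast
    next
      case False
      then have "z = u \<or> z = v" using z(1) by auto
      then have "\<delta> y \<le> \<delta> w" if "y \<in> {u..v}" for y using z(2)[OF that] w by auto
      moreover have "w \<in> {u<..<v}" using uv by simp
      ultimately show ?thesis by blast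
    qed
    then obtain z' where z': "z' \<in> {u<..<v}" "\<And>y. y \<in> {u..v} \<Longrightarrow> \<delta> y \<le> \<delta> z'" by blast
    have "\<forall>\<^sub>F y in nhds z'. \<delta> y \<le> \<delta> z'"
      using eventually_nhds_in_open[of "{u<..<v}" z'] z' by (auto elim!: eventually_mono)
    then have "local_maximizer \<delta> z'" using z'(1) uv(1) by (auto simp: local_maximizer_def)
    then show False using m z'(1) nm by (simp add: single_local_maximizer_def)
  qed
  \<comment> \<open>Since \<delta> 0 = 0, a value \<delta> w \<le> 0 makes \<delta> negative on all
    of (0, w), and \<open>H\<close> would fall below H 0 = 0.\<close>
  have pos: "0 < \<delta> w" if w: "0 < w" "w \<le> m" for w
  proof (rule ccontr)
    assume "\<not> ?thesis"
    then have "\<delta> z < 0" if "0 < z" "z < w" for z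
      using between[of 0 z w] that w delta_0 by auto
    then have "H w - H 0 < 0 * (w - 0)" using w by (intro H_greater) auto
    then show False using H_nonneg[of w] w H_0 by auto
  qed
  have inc0: "\<delta> u < \<delta> v" if "0 \<le> u" "u < v" "v \<le> m" for u v
  proof (cases "u = 0")
    case True then show ?thesis using pos[of v] that delta_0 by auto
  next
    case False
    then have "\<delta> u < max (\<delta> 0) (\<delta> v)" using that by (intro between) auto
    then show ?thesis using pos[of v] that delta_0 by auto
  qed
  have Hm: "0 < H m"
    using H_less[of 0 m 0] pos m_pos H_0 by auto
  \<comment> \<open>\<open>H m\<close> is positive while \<open>H\<close> tends to 0, so
    \<open>H\<close> must decrease somewhere beyond m.\<close>
  obtain z where z: "m < z" "\<delta> z < 0"
  proof (rule ccontr)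
    assume "\<not> thesis"
    with that have nn: "0 \<le> \<delta> z" if "m < z" for z using that by force
    have "H m \<le> H y" if y: "m < y" for y
    proof (rule H_mvt[of m y])
      fix x assume x: "m < x" "x < y" "H y - H m = (y - m) * \<delta> x"
      then have "0 \<le> (y - m) * \<delta> x" using nn[of x] by simp
      then show ?thesis using x by simp
    qed (use y m_pos in auto)
    then have "H m \<le> 0"
      by (intro tendsto_lowerbound[OF H_tendsto] eventually_mono[OF eventually_gt_at_top[of m]]) auto
    then show False using Hm by simp
  qed
  \<comment> \<open>Because \<delta> tends to 0 > \<delta> z, a minimum over the compact interval
    \<open>{m..V}\<close> is a minimum over all points above m.\<close>
  obtain V where V: "z < V" "\<And>y. V \<le> y \<Longrightarrow> \<delta> z < \<delta> y"
  proof -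
    have "\<forall>\<^sub>F y in at_top. \<delta> z < \<delta> y" using order_tendstoD(1)[OF delta_tendsto z(2)] .
    then obtain V where "\<And>y. V \<le> y \<Longrightarrow> \<delta> z < \<delta> y" by (auto simp: eventually_at_top_linorder)
    then show ?thesis using that[of "max V (z + 1)"] by auto
  qed
  have "{m..V} \<noteq> {}" using z V(1) by auto
  then obtain c where c: "c \<in> {m..V}" "\<And>y. y \<in> {m..V} \<Longrightarrow> \<delta> c \<le> \<delta> y"
    using continuous_attains_inf[OF compact_Icc _ continuous_on_delta] by blast
  have cmin: "\<delta> c \<le> \<delta> y" if "m \<le> y" for y
  proof (cases "y \<le> V")
    case False
    then have "\<delta> z < \<delta> y" using V(2)[of y] by auto
    moreover have "\<delta> c \<le> \<delta> z" using c(2)[of z] z V(1) by auto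
    ultimately show ?thesis by simp
  qed (use c that in auto)
  have "\<delta> c < 0" using cmin[of z] z by auto
  then have mc: "m < c" using pos[of m] m_pos c(1) by (cases "m = c") auto
  have inc1: "\<delta> u < \<delta> v" if "c \<le> u" "u < v" for u v
  proof (rule ccontr)
    assume n: "\<not> ?thesis"
    show False
    \<comment> \<open>For u other than c, \<open>between\<close> is applied to c, u, v. For u = c it
      is applied to the midpoint of c and v, which would fall below the minimum.\<close>
    proof (cases "u = c")
      case True
      then have "\<delta> ((u + v) / 2) < max (\<delta> u) (\<delta> v)" using that mc m_pos by (intro between) auto
      then show False using n True cmin[of "(u + v) / 2"] that mc by auto
    next
      case False
      then have "\<delta> u < max (\<delta> c) (\<delta> v)" using that mc m_pos by (intro between) auto
      then show False using n cmin[of u] that mc by auto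
    qed
  qed
  have dec: "\<delta> v < \<delta> u" if "m \<le> u" "u < v" "v \<le> c" for u v
  proof (rule ccontr)
    assume n: "\<not> ?thesis"
    show False
    proof (cases "v = c")
      case True
      then have "\<delta> ((u + v) / 2) < max (\<delta> u) (\<delta> v)" using that mc m_pos by (intro between) auto
      then show False using n True cmin[of "(u + v) / 2"] that mc by auto
    next
      case False
      then have "\<delta> v < max (\<delta> u) (\<delta> c)" using that mc m_pos by (intro between) auto
      then show False using n cmin[of v] that mc by auto
    qed
  qed
  have "unimodal_pair \<mu> \<nu> m c"
    by unfold_locales (use m_pos mc inc0 inc1 dec in auto)
  then show ?thesis by (rule that)
qed

lemma P1d_pairI:
  assumes "\<mu> \<in> P1d" "\<nu> \<in> P1d" "\<mu> \<preceq>\<^sub>c \<nu>"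
  shows "P1d_pair \<mu> \<nu>"
proof -
  interpret mu: P1d_law \<mu> by unfold_locales fact
  interpret nu: P1d_law \<nu> by unfold_locales fact
  show ?thesis
  proof
    fix x :: real assume x: "0 \<le> x"
    show "mu.Kpot x \<le> nu.Kpot x"
    proof (cases "x = 0")
      case True then show ?thesis by (simp add: mu.Kpot_0 nu.Kpot_0)
    next
      case False
      let ?f = "\<lambda>y. max (x - y) 0"
      have "convex_on {0<..} ?f"
      proof (rule convex_onI)
        fix t u v :: real assume t: "0 < t" "t < 1"
        have "x - ((1 - t) * u + t * v) = (1 - t) * (x - u) + t * (x - v)"
          by (simp add: algebra_simps)
        also have "\<dots> \<le> (1 - t) * max (x - u) 0 + t * max (x - v) 0"
          using t by (intro add_mono mult_left_mono) auto
        finally show "?f ((1 - t) *\<^sub>R u + t *\<^sub>R v) \<le> (1 - t) * ?f u + t * ?f v"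
          using t by auto
      qed simp
      then have "ext_integral \<mu> ?f \<le> ext_integral \<nu> ?f" using assms(3) by (simp add: convex_order_def)
      \<comment> \<open>The put function is nonnegative, so only the first term of
        \<open>ext_integral\<close> remains.\<close>
      moreover have "(\<lambda>y. ennreal (- ?f y)) = (\<lambda>y. 0)" by (auto simp: fun_eq_iff ennreal_neg)
      ultimately have "ennreal (mu.Kpot x) \<le> ennreal (nu.Kpot x)"
        using False x
        by (simp only: ext_integral_def mu.Kpot_nn_integral nu.Kpot_nn_integral)
          (simp add: mu.Kpot_nonneg nu.Kpot_nonneg ennreal_le_iff zero_ennreal.rep_eq)
      then show ?thesis using nu.Kpot_nonneg x by (simp add: ennreal_le_iff)
    qed
  qed
qed

section \<open>Minimizers, and intervals of equal mass and moment\<close>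

context unimodal_pair
begin

lemma c_pos: "0 < c" using m_pos m_less_c by simp

lemma delta_neg: assumes "c \<le> x" shows "\<delta> x < 0"
proof -
  \<comment> \<open>The limit 0 gives only a weak bound; the strict increase from x to x + 1 makes
    it strict at x.\<close>
  have "\<delta> (x + 1) \<le> 0"
  proof (rule tendsto_lowerbound[OF delta_tendsto])
    show "\<forall>\<^sub>F y in at_top. \<delta> (x + 1) \<le> \<delta> y"
      using eventually_gt_at_top[of "x + 1"]
      by eventually_elim (use delta_inc[of "x + 1"] assms in \<open>simp add: less_imp_le\<close>)
  qed simp
  then show ?thesis using delta_inc[of x "x + 1"] assms by auto
qed

lemma delta_pos: assumes "0 < x" "x \<le> m" shows "0 < \<delta> x"
  using delta_inc_left[of 0 x] assms delta_0 by auto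

lemma delta_min: assumes "0 < x" "x \<noteq> c" shows "\<delta> c < \<delta> x"
proof (cases "x \<le> m")
  case True then show ?thesis using delta_pos[of x] delta_neg[of c] assms by auto
next
  case False then show ?thesis using delta_inc[of c x] delta_dec[of x c] assms by (cases "x < c") auto
qed

text \<open>Formally d\<delta>G = x d\<delta>F, so \<delta>G turns where \<delta>F turns. The proof
  writes \<delta>G = x \<delta>F - H and bounds the chord of \<open>H\<close> between x and c by an
  extreme value of \<delta>F there.\<close>

lemma deltaG_min: assumes "m < x" shows "deltaG \<mu> \<nu> c \<le> deltaG \<mu> \<nu> x"
proof -
  have e: "deltaG \<mu> \<nu> x - deltaG \<mu> \<nu> c = x * \<delta> x - c * \<delta> c - (H x - H c)"
    by (simp add: H_eq)
  consider "x = c" | "c < x" | "x < c" by linarith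
  then show ?thesis
  proof cases
    case 2
    then have "H x - H c < \<delta> x * (x - c)"
      using c_pos delta_inc by (intro H_greater) auto
    moreover have "c * \<delta> c \<le> c * \<delta> x" using delta_min[of x] 2 c_pos by auto
    ultimately show ?thesis using e by (simp add: algebra_simps)
  next
    case 3
    then have "\<delta> c * (c - x) < H c - H x"
      using m_pos assms delta_dec by (intro H_less) auto
    moreover have "x * \<delta> c \<le> x * \<delta> x" using delta_min[of x] 3 assms m_pos by auto
    ultimately show ?thesis using e by (simp add: algebra_simps)
  qed simp
qed

text \<open>The mass that \<delta>F gains between b and b' sits at points above b. This is the
  moment bound behind \<open>endpoints_unique\<close>.\<close>

lemma deltaG_diff_ge:
  assumes "c \<le> b" "b < b'"
  shows "b * (\<delta> b' - \<delta> b) \<le> deltaG \<mu> \<nu> b' - deltaG \<mu> \<nu> b"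
proof -
  have "H b' - H b < \<delta> b' * (b' - b)"
    using c_pos assms delta_inc by (intro H_greater) auto
  then show ?thesis by (simp add: H_eq algebra_simps)
qed

text \<open>The hypotheses say that the chord of \<open>H\<close> over [a, b] has slope k = \<delta>
  a = \<delta> b. By the shape of \<delta>, either these end values differ, or \<delta> - k has a
  constant strict sign between them, and then the slope of the chord is not k.\<close>

lemma no_late_component:
  assumes "0 < a" "a < b" "\<delta> a = \<delta> b" "deltaG \<mu> \<nu> a = deltaG \<mu> \<nu> b"
  shows False
proof -
  let ?k = "\<delta> a"
  have e: "H b - H a = ?k * (b - a)" using assms by (simp add: H_eq algebra_simps)
  have up: False if "\<And>z. a < z \<Longrightarrow> z < b \<Longrightarrow> ?k < \<delta> z"
    using H_less[of a b ?k] that e assms by auto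
  have down: False if "\<And>z. a < z \<Longrightarrow> z < b \<Longrightarrow> \<delta> z < ?k"
    using H_greater[of a b ?k] that e assms by auto
  consider "b \<le> m" | "a < m" "m < b" "b \<le> c" | "a < m" "c < b" | "m \<le> a" "b \<le> c"
    | "m \<le> a" "a < c" "c < b" | "c \<le> a" by linarith
  then show False
  proof cases
    case 1 then show ?thesis using delta_inc_left[of a b] assms by auto
  next
    case 2
    show ?thesis
    proof (rule up)
      fix z assume z: "a < z" "z < b"
      show "?k < \<delta> z"
        using delta_inc_left[of a z] delta_dec[of z b] 2 z assms by (cases "z \<le> m") auto
    qed
  next
    case 3 then show ?thesis using delta_pos[of a] delta_neg[of b] assms by auto
  next
    case 4 then show ?thesis using delta_dec[of a b] assms by auto
  next
    case 5
    show ?thesis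
    proof (rule down)
      fix z assume z: "a < z" "z < b"
      show "\<delta> z < ?k"
        using delta_dec[of a z] delta_inc[of z b] 5 z assms by (cases "z \<le> c") auto
    qed
  next
    case 6 then show ?thesis using delta_inc[of a b] assms by auto
  qed
qed

text \<open>The analogue for an interval reaching to infinity. The hypotheses give H a = 0, but the
  signs of \<delta> place a between m and c, so \<delta> is positive on (0, a) and H a > 0.\<close>

lemma no_unbounded_component:
  assumes "0 < a" "\<delta> a = 0" "deltaG \<mu> \<nu> a = 0"
  shows False
proof -
  have a: "m < a" "a < c" using assms delta_pos[of a] delta_neg[of a] by linarith+
  have "0 * (a - 0) < H a - H 0"
  proof (rule H_less)
    fix z assume "0 < z" "z < a"
    then show "0 < \<delta> z" using delta_pos[of z] delta_dec[of z a] a assms by (cases "z \<le> m") auto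
  qed (use assms in auto)
  then show False using assms H_0 by (simp add: H_eq)
qed

end

section \<open>Martingale couplings\<close>

text \<open>Allows a coupling to be viewed as a Borel measure on the plane, where inner regularity
  by compact sets is available.\<close>

lemma sets_pos_borel_pair_imp_borel:
  assumes "A \<in> sets (pos_borel \<Otimes>\<^sub>M pos_borel)"
  shows "A \<in> sets (borel :: (real \<times> real) measure)" "A \<subseteq> {0<..} \<times> {0<..}"
proof -
  let ?S = "{0<..} \<times> {0<..} :: (real \<times> real) set"
  show sub: "A \<subseteq> ?S" using sets.sets_into_space[OF assms] by (simp add: space_pair_measure)
  have S: "?S \<in> sets borel" unfolding borel_prod[symmetric] by (rule pair_measureI) auto
  have "fst \<in> restrict_space borel ?S \<rightarrow>\<^sub>M pos_borel" "snd \<in> restrict_space borel ?S \<rightarrow>\<^sub>M pos_borel"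
    unfolding pos_borel_def by (auto intro!: measurable_restrict_space3 borel_measurable_continuous_onI continuous_intros)
  then have "(\<lambda>\<omega>. (fst \<omega>, snd \<omega>)) \<in> restrict_space borel ?S \<rightarrow>\<^sub>M pos_borel \<Otimes>\<^sub>M pos_borel"
    by (rule measurable_Pair)
  from measurable_sets[OF this assms] have "A \<in> sets (restrict_space borel ?S)"
    using sub by (simp add: space_restrict_space Int_absorb2)
  then show "A \<in> sets borel" using S by (simp add: sets_restrict_space_iff)
qed

lemma open_connected_halfline:
  fixes J :: "real set"
  assumes "open J" "connected J" "J \<noteq> {}" "J \<subseteq> {0<..}"
  obtains a where "0 \<le> a" "J = {a<..}" | a b where "0 \<le> a" "a < b" "J = {a<..<b}"
proof -
  have bb: "bdd_below J" using assms(4) by (intro bdd_belowI[of _ 0]) auto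
  define a where "a = Inf J"
  have a0: "0 \<le> a" unfolding a_def using assms by (intro cInf_greatest) auto
  have lower: "a < x" if "x \<in> J" for x
  proof -
    obtain e where "e > 0" "ball x e \<subseteq> J" using assms(1) \<open>x \<in> J\<close> open_contains_ball_eq by metis
    then have "x - e / 2 \<in> J" by (auto simp: dist_real_def)
    then have "a \<le> x - e / 2" unfolding a_def using bb by (rule cInf_lower)
    then show ?thesis using \<open>e > 0\<close> by simp
  qed
  have mid: "x \<in> J" if "u \<in> J" "v \<in> J" "u \<le> x" "x \<le> v" for u v x
    using assms(2) that by (meson connected_contains_Icc atLeastAtMost_iff subsetD)
  have low: "\<exists>u\<in>J. u < x" if "a < x" for x
    using cInf_lessD[of J x] that assms(3) a_def by auto
  show ?thesis
  proof (cases "bdd_above J")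
    case False
    have high: "\<exists>v\<in>J. x < v" for x
      using False by (meson bdd_above.I not_le)
    have "J = {a<..}"
    proof (intro equalityI subsetI)
      fix x assume "x \<in> {a<..}"
      then obtain u v where "u \<in> J" "u < x" "v \<in> J" "x < v" using low high by blast
      then show "x \<in> J" using mid[of u v x] by simp
    qed (use lower in auto)
    then show ?thesis using that(1) a0 by blast
  next
    case ba: True
    define b where "b = Sup J"
    have upper: "x < b" if "x \<in> J" for x
    proof -
      obtain e where "e > 0" "ball x e \<subseteq> J" using assms(1) \<open>x \<in> J\<close> open_contains_ball_eq by metis
      then have "x + e / 2 \<in> J" by (auto simp: dist_real_def)
      then have "x + e / 2 \<le> b" unfolding b_def using ba by (rule cSup_upper)
      then show ?thesis using \<open>e > 0\<close> by simp
    qed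
    have up: "\<exists>u\<in>J. x < u" if "x < b" for x
      using less_cSupD[of J x] that assms(3) b_def by auto
    have "J = {a<..<b}"
    proof (intro equalityI subsetI)
      fix x assume "x \<in> {a<..<b}"
      then have "a < x" "x < b" by auto
      then obtain u v where "u \<in> J" "u < x" "v \<in> J" "x < v" using low up by blast
      then show "x \<in> J" using mid[of u v x] by simp
    qed (use lower upper in auto)
    moreover have "a < b" using assms(3) lower upper by force
    ultimately show ?thesis using that(2) a0 by blast
  qed
qed

locale mart_coupling = P1d_pair +
  fixes Q assumes Q: "Q \<in> mart_couplings \<mu> \<nu>"
begin

lemma sets_Q: "sets Q = sets (pos_borel \<Otimes>\<^sub>M pos_borel)"
  using Q by (simp add: mart_couplings_def)

sublocale Q: prob_space Q using Q by (simp add: mart_couplings_def)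

lemma space_Q: "space Q = {0<..} \<times> {0<..}"
  using sets_eq_imp_space_eq[OF sets_Q] by (simp add: space_pair_measure)

lemma fst_meas [measurable]: "fst \<in> Q \<rightarrow>\<^sub>M pos_borel"
  unfolding measurable_cong_sets[OF sets_Q refl] by (rule measurable_fst)

lemma snd_meas [measurable]: "snd \<in> Q \<rightarrow>\<^sub>M pos_borel"
  unfolding measurable_cong_sets[OF sets_Q refl] by (rule measurable_snd)

lemma id_meas: "(\<lambda>x. x) \<in> pos_borel \<rightarrow>\<^sub>M borel"
  unfolding pos_borel_def by (rule measurable_restrict_space1) simp

lemma borel_fst [measurable]: "fst \<in> borel_measurable Q"
  using measurable_compose[OF fst_meas id_meas] by simp

lemma borel_snd [measurable]: "snd \<in> borel_measurable Q"
  using measurable_compose[OF snd_meas id_meas] by simp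

lemma distr_fst: "distr Q pos_borel fst = \<mu>" and distr_snd: "distr Q pos_borel snd = \<nu>"
  using Q by (auto simp: mart_couplings_def)

lemma measure_fst: "A \<in> sets pos_borel \<Longrightarrow> Q.prob {\<omega> \<in> space Q. fst \<omega> \<in> A} = measure \<mu> A"
  unfolding distr_fst[symmetric] by (subst measure_distr) (auto simp: vimage_def Int_def conj_commute)

lemma measure_snd: "A \<in> sets pos_borel \<Longrightarrow> Q.prob {\<omega> \<in> space Q. snd \<omega> \<in> A} = measure \<nu> A"
  unfolding distr_snd[symmetric] by (subst measure_distr) (auto simp: vimage_def Int_def conj_commute)

lemma integrable_fst: "integrable Q (fst :: _ \<Rightarrow> real)"
  using mu.integrable_id unfolding distr_fst[symmetric] by (subst (asm) integrable_distr_eq[OF fst_meas id_meas])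

lemma integrable_snd: "integrable Q (snd :: _ \<Rightarrow> real)"
  using nu.integrable_id unfolding distr_snd[symmetric] by (subst (asm) integrable_distr_eq[OF snd_meas id_meas])

lemma integral_fst: "A \<in> sets pos_borel \<Longrightarrow> (\<integral>\<omega>. indicator A (fst \<omega>) * fst \<omega> \<partial>Q) = measure (size_biased \<mu>) A"
  by (subst mu.measure_size_biased, simp add: mu.sets_M0, unfold set_lebesgue_integral_def,
      subst distr_fst[symmetric], subst integral_distr)
    (auto intro!: borel_measurable_times borel_measurable_indicator id_meas)

lemma integral_snd: "A \<in> sets pos_borel \<Longrightarrow> (\<integral>\<omega>. indicator A (snd \<omega>) * snd \<omega> \<partial>Q) = measure (size_biased \<nu>) A"
  by (subst nu.measure_size_biased, simp add: nu.sets_M0, unfold set_lebesgue_integral_def,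
      subst distr_snd[symmetric], subst integral_distr)
    (auto intro!: borel_measurable_times borel_measurable_indicator id_meas)

text \<open>The uniqueness argument uses the conditional expectation only through these integrals
  over events that depend on \<open>fst\<close>.\<close>

lemma martingale:
  assumes A: "A \<in> sets pos_borel"
  shows "(\<integral>\<omega>. indicator A (fst \<omega>) * snd \<omega> \<partial>Q) = (\<integral>\<omega>. indicator A (fst \<omega>) * fst \<omega> \<partial>Q)"
proof -
  let ?F = "vimage_algebra (space Q) fst pos_borel"
  have sub: "subalgebra Q ?F"
    unfolding subalgebra_def using fst_meas measurable_sets[OF fst_meas]
    by (subst sets_vimage_algebra2) (auto simp: space_Q)
  interpret S: sigma_finite_subalgebra Q ?F
    by (intro finite_measure_subalgebra_is_sigma_finite finite_measure_subalgebra.intro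
        finite_measure_subalgebra_axioms.intro Q.finite_measure_axioms sub)
  let ?B = "fst -` A \<inter> space Q"
  have B: "?B \<in> sets ?F" using A by (rule in_vimage_algebra)
  have i: "indicator ?B \<omega> = (indicator A (fst \<omega>) :: real)" if "\<omega> \<in> space Q" for \<omega>
    using that by (auto simp: indicator_def)
  have ae: "AE \<omega> in Q. real_cond_exp Q ?F snd \<omega> = fst \<omega>"
    using Q by (simp add: mart_couplings_def)
  have "(\<integral>\<omega>. indicator A (fst \<omega>) * snd \<omega> \<partial>Q) = (\<integral>\<omega>\<in>?B. snd \<omega> \<partial>Q)"
    unfolding set_lebesgue_integral_def by (rule Bochner_Integration.integral_cong) (auto simp: i)
  also have "\<dots> = (\<integral>\<omega>\<in>?B. real_cond_exp Q ?F snd \<omega> \<partial>Q)"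
    by (rule S.real_cond_exp_intA[OF integrable_snd B])
  also have "\<dots> = (\<integral>\<omega>. indicator A (fst \<omega>) * fst \<omega> \<partial>Q)"
    unfolding set_lebesgue_integral_def
  proof (rule integral_cong_AE)
    show "AE \<omega> in Q. indicator ?B \<omega> *\<^sub>R real_cond_exp Q ?F snd \<omega> = indicator A (fst \<omega>) * fst \<omega>"
      using ae AE_space by eventually_elim (simp add: i)
    show "(\<lambda>\<omega>. indicator ?B \<omega> *\<^sub>R real_cond_exp Q ?F snd \<omega>) \<in> borel_measurable Q"
      using A by measurable
    show "(\<lambda>\<omega>. indicator A (fst \<omega>) * fst \<omega>) \<in> borel_measurable Q"
      using A by measurable
  qed
  finally show ?thesis .
qed

text \<open>If the mass started in A is exactly the mass that ends in B, the masses agree at once.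
  The moments agree because \<open>martingale\<close> allows \<open>snd\<close> to be replaced by
  \<open>fst\<close> on an event that depends on \<open>fst\<close>.\<close>

lemma marginals_agree:
  assumes A: "A \<in> sets pos_borel" and B: "B \<in> sets pos_borel"
    and ae: "AE \<omega> in Q. fst \<omega> \<in> A \<longleftrightarrow> snd \<omega> \<in> B"
  shows "measure \<nu> B = measure \<mu> A" "measure (size_biased \<nu>) B = measure (size_biased \<mu>) A"
proof -
  have m: "{\<omega> \<in> space Q. fst \<omega> \<in> A} \<in> sets Q" "{\<omega> \<in> space Q. snd \<omega> \<in> B} \<in> sets Q"
    using A B by measurable
  have "Q.prob {\<omega> \<in> space Q. fst \<omega> \<in> A} = Q.prob {\<omega> \<in> space Q. snd \<omega> \<in> B}"
    by (rule Q.finite_measure_eq_AE) (use ae m in auto)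
  then show "measure \<nu> B = measure \<mu> A" by (simp add: measure_fst[OF A] measure_snd[OF B])
  have "(\<integral>\<omega>. indicator B (snd \<omega>) * snd \<omega> \<partial>Q) = (\<integral>\<omega>. indicator A (fst \<omega>) * snd \<omega> \<partial>Q)"
  proof (rule integral_cong_AE)
    show "AE \<omega> in Q. indicator B (snd \<omega>) * snd \<omega> = indicator A (fst \<omega>) * snd \<omega>"
      using ae by eventually_elim (auto simp: indicator_def)
    show "(\<lambda>\<omega>. indicator B (snd \<omega>) * snd \<omega>) \<in> borel_measurable Q" using B by measurable
    show "(\<lambda>\<omega>. indicator A (fst \<omega>) * snd \<omega>) \<in> borel_measurable Q" using A by measurable
  qed
  then show "measure (size_biased \<nu>) B = measure (size_biased \<mu>) A"
    by (simp add: martingale[OF A] integral_fst[OF A] integral_snd[OF B])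
qed

text \<open>Replacing a carrier of the coupling by a countable union of compact subsets makes its
  projections measurable, so that no disintegration of the coupling is needed.\<close>

lemma sigma_compact_carrier:
  assumes G: "\<Gamma> \<in> sets (pos_borel \<Otimes>\<^sub>M pos_borel)" "emeasure Q \<Gamma> = 1"
  obtains K :: "nat \<Rightarrow> (real \<times> real) set" where "\<And>n. compact (K n)" "\<And>n. K n \<subseteq> \<Gamma>"
    "AE \<omega> in Q. \<omega> \<in> (\<Union>n. K n)"
proof -
  have meas: "(\<lambda>\<omega>. \<omega>) \<in> Q \<rightarrow>\<^sub>M borel"
    using borel_measurable_Pair[OF borel_fst borel_snd] by simp
  let ?Q = "distr Q borel (\<lambda>\<omega>. \<omega>)"
  interpret D: prob_space ?Q by (rule Q.prob_space_distr[OF meas])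
  have sub: "\<Gamma> \<subseteq> space Q" using sets_pos_borel_pair_imp_borel(2)[OF G(1)] by (simp add: space_Q)
  have emQ: "emeasure ?Q A = emeasure Q A" if "A \<in> sets borel" "A \<subseteq> \<Gamma>" for A
    using that sub by (simp add: emeasure_distr[OF meas] Int_absorb2)
  have setsG: "\<Gamma> \<in> sets borel" by (rule sets_pos_borel_pair_imp_borel[OF G(1)])
  have one: "(SUP K \<in> {K. K \<subseteq> \<Gamma> \<and> compact K}. emeasure ?Q K) = 1"
    using inner_regular[of ?Q \<Gamma>] setsG emQ[OF setsG] G(2) D.finite_measure_axioms by simp
  have "\<exists>K. compact K \<and> K \<subseteq> \<Gamma> \<and> ennreal (1 - 1 / real (Suc n)) < emeasure ?Q K" for n
  proof -
    have "ennreal (1 - 1 / real (Suc n)) < 1" by (simp add: ennreal_less_one_iff)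
    then show ?thesis unfolding one[symmetric] by (subst (asm) less_SUP_iff) auto
  qed
  then obtain K where K: "\<And>n. compact (K n)" "\<And>n. K n \<subseteq> \<Gamma>"
    "\<And>n. ennreal (1 - 1 / real (Suc n)) < emeasure ?Q (K n)" by metis
  have Kb: "K n \<in> sets borel" for n using K(1) by (simp add: compact_imp_closed)
  have ev: "(\<Union>n. K n) \<in> sets Q"
  proof -
    have "(\<Union>n. K n) \<in> sets borel" using Kb by auto
    show ?thesis
    proof -
      have "(\<lambda>\<omega>. \<omega>) -` (\<Union>n. K n) \<inter> space Q = (\<Union>n. K n)" using K(2) sub by blast
      then show ?thesis using measurable_sets[OF meas \<open>(\<Union>n. K n) \<in> sets borel\<close>] by simp
    qed
  qed
  have "1 - 1 / real (Suc n) \<le> Q.prob (\<Union>n. K n)" for n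
  proof -
    have "ennreal (1 - 1 / real (Suc n)) \<le> emeasure Q (K n)"
      using K(3)[of n] emQ[OF Kb K(2)] by (simp add: less_imp_le)
    also have "\<dots> \<le> emeasure Q (\<Union>n. K n)" using ev by (intro emeasure_mono) auto
    finally show ?thesis by (simp add: Q.emeasure_eq_measure)
  qed
  then have "1 \<le> Q.prob (\<Union>n. K n)"
    by (intro LIMSEQ_le_const2[of "\<lambda>n. 1 - 1 / real (Suc n)"]) (real_asymp | auto)+
  then have "Q.prob (\<Union>n. K n) = 1" using Q.prob_le_1[of "\<Union>n. K n"] by linarith
  then have "AE \<omega> in Q. \<omega> \<in> (\<Union>n. K n)" using Q.prob_eq_1[OF ev] by simp
  then show ?thesis using that K by blast
qed

text \<open>Over the starting points whose fiber has no carrier point below the diagonal, or none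
  above it, the difference Y - X has a constant sign and integral zero, so it vanishes almost
  surely.\<close>

lemma straddle_AE:
  fixes K :: "nat \<Rightarrow> (real \<times> real) set"
  assumes K: "\<And>n. compact (K n)" and ae: "AE \<omega> in Q. \<omega> \<in> (\<Union>n. K n)"
  defines "S \<equiv> (\<Union>n. K n)"
  shows "AE \<omega> in Q. \<omega> \<in> S \<and> (snd \<omega> = fst \<omega> \<or>
    (\<exists>y1 y2. (fst \<omega>, y1) \<in> S \<and> (fst \<omega>, y2) \<in> S \<and> y1 < fst \<omega> \<and> fst \<omega> < y2))"
proof -
  define G1 where "G1 = {x. \<exists>y. (x, y) \<in> S \<and> y < x}"
  define G2 where "G2 = {x. \<exists>y. (x, y) \<in> S \<and> x < y}"
  \<comment> \<open>Projections of compact sets are compact, hence Borel. The strict inequalities in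
    \<open>G1\<close> and \<open>G2\<close> become unions over k of closed conditions with margin 1
    / (k + 1).\<close>
  have proj: "fst ` (K n \<inter> C) \<in> sets borel" if "closed C" for n C
    using K that by (intro borel_compact compact_continuous_image continuous_intros compact_Int_closed)
  have cl: "closed {z :: real \<times> real. snd z + e \<le> fst z}" "closed {z :: real \<times> real. fst z + e \<le> snd z}" for e :: real
    by (intro closed_Collect_le continuous_intros)+
  have arch: "\<exists>k. u + 1 / real (Suc k) \<le> v" if "u < v" for u v :: real
  proof -
    obtain k where "inverse (real (Suc k)) < v - u" using reals_Archimedean[of "v - u"] \<open>u < v\<close> by fastforce
    then show ?thesis by (intro exI[of _ k]) (simp add: inverse_eq_divide)
  qed
  have pos: "u < v" if "u + 1 / real (Suc k) \<le> v" for u v :: real and k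
    using that by (smt (verit) divide_pos_pos of_nat_0_less_iff zero_less_Suc)
  have fst_im: "x \<in> fst ` A \<longleftrightarrow> (\<exists>y. (x, y) \<in> A)" for x :: real and A :: "(real \<times> real) set"
    by force
  have less_iff: "u < v \<longleftrightarrow> (\<exists>k. u + 1 / real (Suc k) \<le> v)" for u v :: real
    using arch pos by blast
  have "G1 = (\<Union>n k. fst ` (K n \<inter> {z. snd z + 1 / real (Suc k) \<le> fst z}))"
  proof (intro set_eqI)
    fix x
    have "x \<in> G1 \<longleftrightarrow> (\<exists>y n k. (x, y) \<in> K n \<and> y + 1 / real (Suc k) \<le> x)"
      unfolding G1_def S_def less_iff by blast
    also have "\<dots> \<longleftrightarrow> x \<in> (\<Union>n k. fst ` (K n \<inter> {z. snd z + 1 / real (Suc k) \<le> fst z}))"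
      by (simp add: fst_im) blast
    finally show "x \<in> G1 \<longleftrightarrow> x \<in> (\<Union>n k. fst ` (K n \<inter> {z. snd z + 1 / real (Suc k) \<le> fst z}))" .
  qed
  then have G1: "G1 \<in> sets borel" using proj cl(1) by auto
  have "G2 = (\<Union>n k. fst ` (K n \<inter> {z. fst z + 1 / real (Suc k) \<le> snd z}))"
  proof (intro set_eqI)
    fix x
    have "x \<in> G2 \<longleftrightarrow> (\<exists>y n k. (x, y) \<in> K n \<and> x + 1 / real (Suc k) \<le> y)"
      unfolding G2_def S_def less_iff by blast
    also have "\<dots> \<longleftrightarrow> x \<in> (\<Union>n k. fst ` (K n \<inter> {z. fst z + 1 / real (Suc k) \<le> snd z}))"
      by (simp add: fst_im) blast
    finally show "x \<in> G2 \<longleftrightarrow> x \<in> (\<Union>n k. fst ` (K n \<inter> {z. fst z + 1 / real (Suc k) \<le> snd z}))" .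
  qed
  then have G2: "G2 \<in> sets borel" using proj cl(2) by auto
  \<comment> \<open>The sign s selects the side of the diagonal, so that one argument serves both
    \<open>G1\<close> and \<open>G2\<close>.\<close>
  have key: "AE \<omega> in Q. fst \<omega> \<notin> G \<longrightarrow> snd \<omega> = fst \<omega>"
    if G: "G \<in> sets borel" and sgn: "s = 1 \<or> s = -1"
      and le: "\<And>x y. (x, y) \<in> S \<Longrightarrow> x \<notin> G \<Longrightarrow> 0 \<le> s * (y - x)" for G and s :: real
  proof -
    let ?A = "{0<..} - G"
    have A: "?A \<in> sets pos_borel" using G by (auto simp: sets_pos_borel_iff)
    let ?f = "\<lambda>\<omega>. s * (indicator ?A (fst \<omega>) * snd \<omega> - indicator ?A (fst \<omega>) * fst \<omega>)"
    have B: "{\<omega> \<in> space Q. fst \<omega> \<in> ?A} \<in> sets Q" using A by measurable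
    have i: "integrable Q (\<lambda>\<omega>. indicator ?A (fst \<omega>) * h \<omega>)" if "integrable Q h" for h :: "real \<times> real \<Rightarrow> real"
    proof -
      have "integrable Q (\<lambda>\<omega>. indicator {\<omega> \<in> space Q. fst \<omega> \<in> ?A} \<omega> * h \<omega>)"
        using integrable_mult_indicator[OF B that] by simp
      then show ?thesis by (rule Bochner_Integration.integrable_cong[THEN iffD1, rotated -1])
        (auto simp: indicator_def)
    qed
    have int: "integrable Q ?f" using i[OF integrable_fst] i[OF integrable_snd] by simp
    have "(\<integral>\<omega>. ?f \<omega> \<partial>Q) = 0"
      using martingale[OF A] i[OF integrable_fst] i[OF integrable_snd] by simp
    moreover have nn: "AE \<omega> in Q. 0 \<le> ?f \<omega>"
      using ae unfolding S_def[symmetric]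
    proof eventually_elim
      fix \<omega> assume "\<omega> \<in> S"
      then show "0 \<le> ?f \<omega>" using le[of "fst \<omega>" "snd \<omega>"] by (cases "fst \<omega> \<in> ?A") auto
    qed
    ultimately have "AE \<omega> in Q. ?f \<omega> = 0"
      using integral_nonneg_eq_0_iff_AE[OF int nn] by blast
    then show ?thesis
      using AE_space
    proof eventually_elim
      fix \<omega> assume "?f \<omega> = 0" "\<omega> \<in> space Q"
      then show "fst \<omega> \<notin> G \<longrightarrow> snd \<omega> = fst \<omega>" using sgn by (auto simp: space_Q)
    qed
  qed
  have "AE \<omega> in Q. fst \<omega> \<notin> G1 \<longrightarrow> snd \<omega> = fst \<omega>"
    by (rule key[OF G1, of 1]) (auto simp: G1_def not_less)
  moreover have "AE \<omega> in Q. fst \<omega> \<notin> G2 \<longrightarrow> snd \<omega> = fst \<omega>"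
    by (rule key[OF G2, of "-1"]) (auto simp: G2_def not_less)
  ultimately show ?thesis
    using ae unfolding S_def[symmetric]
  proof eventually_elim
    case (elim \<omega>)
    show ?case
    proof (cases "fst \<omega> \<in> G1 \<and> fst \<omega> \<in> G2")
      case True
      then show ?thesis using elim(3) unfolding G1_def G2_def by blast
    next
      case False
      then have "snd \<omega> = fst \<omega>" using elim(1,2) by meson
      then show ?thesis using elim(3) by simp
    qed
  qed
qed

end

section \<open>Uniqueness of right-monotone couplings\<close>

locale right_monotone_coupling = unimodal_pair \<mu> \<nu> m c + mart_coupling \<mu> \<nu> Q
  for \<mu> \<nu> m c Q +
  assumes right_mono: "right_monotone Q"
begin

lemmas law_intervals = mu.F.measure_intervals mu.G.measure_intervals[unfolded mu.Fcdf_size_biased]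
  nu.F.measure_intervals nu.G.measure_intervals[unfolded nu.Fcdf_size_biased]

lemma AE_snd_neq: "AE \<omega> in Q. snd \<omega> \<noteq> z"
proof (cases "z > 0")
  case True
  then have "{z} \<in> sets pos_borel" by (auto simp: sets_pos_borel_iff)
  then have "Q.prob {\<omega> \<in> space Q. snd \<omega> \<in> {z}} = 0"
    by (subst measure_snd) (simp_all add: measure_def nu.F.null_singleton)
  moreover have "{\<omega> \<in> space Q. snd \<omega> \<in> {z}} \<in> sets Q"
    using \<open>{z} \<in> sets pos_borel\<close> by measurable
  ultimately have "AE \<omega> in Q. \<omega> \<notin> {\<omega> \<in> space Q. snd \<omega> \<in> {z}}"
    using Q.prob_eq_0 by blast
  then show ?thesis using AE_space by eventually_elim simp
qed (use AE_space in eventually_elim, auto simp: space_Q)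

text \<open>Let \<open>O'\<close> be the union of the open intervals \<open>(y1, y2)\<close> that straddle some \<open>x \<ge> t\<close> with both
  \<open>(x, y1)\<close> and \<open>(x, y2)\<close> in the carrier. Right-monotonicity keeps the mass started below \<open>t\<close>
  out of \<open>O'\<close>, and the mass started in \<open>[t, \<infinity>)\<close> neither enters nor leaves a component of
  \<open>O'\<close>. So \<open>\<mu>\<close> restricted to \<open>[t, \<infinity>)\<close> and \<open>\<nu>\<close> have the same mass and mean on each component, which
  the shape of \<open>\<delta>\<close> forbids unless the component contains \<open>t\<close>.\<close>

lemma structure_AE:
  assumes t: "0 < t"
  obtains "AE \<omega> in Q. t \<le> fst \<omega> \<longrightarrow> snd \<omega> = fst \<omega>"
  | a where "0 \<le> a" "a < t"
    "AE \<omega> in Q. snd \<omega> \<in> {a<..} \<longleftrightarrow> fst \<omega> \<in> {t..}"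
  | a b where "0 \<le> a" "a < t" "t < b"
    "AE \<omega> in Q. snd \<omega> \<in> {a<..<b} \<longleftrightarrow> fst \<omega> \<in> {t..<b}"
    "AE \<omega> in Q. b \<le> fst \<omega> \<longrightarrow> snd \<omega> = fst \<omega>"
proof -
  obtain \<Gamma> where \<Gamma>: "\<Gamma> \<in> sets (pos_borel \<Otimes>\<^sub>M pos_borel)" "emeasure Q \<Gamma> = 1"
    and rm: "\<And>x y1 y2 x' y'. \<lbrakk>(x, y1) \<in> \<Gamma>; (x, y2) \<in> \<Gamma>; (x', y') \<in> \<Gamma>; x' < x; y1 < y'; y' < y2\<rbrakk> \<Longrightarrow> False"
    using right_mono unfolding right_monotone_def by blast
  obtain K :: "nat \<Rightarrow> (real \<times> real) set" where K: "\<And>n. compact (K n)" "\<And>n. K n \<subseteq> \<Gamma>"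
    "AE \<omega> in Q. \<omega> \<in> (\<Union>n. K n)"
    using sigma_compact_carrier[OF \<Gamma>] by blast
  define S where "S = (\<Union>n. K n)"
  have S\<Gamma>: "S \<subseteq> \<Gamma>" using K(2) by (auto simp: S_def)
  then have Spos: "0 < x \<and> 0 < y" if "(x, y) \<in> S" for x y
    using sets_pos_borel_pair_imp_borel(2)[OF \<Gamma>(1)] that by auto
  have st: "AE \<omega> in Q. \<omega> \<in> S \<and> (snd \<omega> = fst \<omega> \<or>
    (\<exists>y1 y2. (fst \<omega>, y1) \<in> S \<and> (fst \<omega>, y2) \<in> S \<and> y1 < fst \<omega> \<and> fst \<omega> < y2))"
    unfolding S_def by (rule straddle_AE[OF K(1,3)])
  define O' where "O' = \<Union>{{y1<..<y2} | x y1 y2. t \<le> x \<and> (x, y1) \<in> S \<and> (x, y2) \<in> S \<and> y1 < x \<and> x < y2}"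
  have O'_I: "{y1<..<y2} \<subseteq> O'" if "t \<le> x" "(x, y1) \<in> S" "(x, y2) \<in> S" "y1 < x" "x < y2" for x y1 y2
    unfolding O'_def using that by blast
  have O'_E: "\<exists>x y1 y2. t \<le> x \<and> (x, y1) \<in> S \<and> (x, y2) \<in> S \<and> y1 < x \<and> x < y2 \<and> y1 < z \<and> z < y2"
    if "z \<in> O'" for z
  proof -
    from that obtain x y1 y2 where "z \<in> {y1<..<y2}" "t \<le> x" "(x, y1) \<in> S" "(x, y2) \<in> S" "y1 < x" "x < y2"
      unfolding O'_def by blast
    then show ?thesis by (intro exI[of _ x] exI[of _ y1] exI[of _ y2]) auto
  qed
  have open_O': "open O'" unfolding O'_def by (auto intro!: open_Union)
  have pos_O': "O' \<subseteq> {0<..}"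
  proof
    fix z assume "z \<in> O'"
    from O'_E[OF this] obtain x y1 where "(x, y1) \<in> S" "y1 < z" by blast
    then show "z \<in> {0<..}" using Spos[of x y1] by simp
  qed
  define J where "J = connected_component_set O'"
  have J_sub: "J z \<subseteq> O'" and J_conn: "connected (J z)" and J_open: "open (J z)" for z
    unfolding J_def using open_O' by (simp_all add: connected_component_subset open_connected_component)
  have J_self: "z \<in> J z" if "z \<in> O'" for z using that by (simp add: J_def)
  have J_max: "C \<subseteq> J z" if "connected C" "C \<subseteq> O'" "u \<in> C" "u \<in> J z" for C u z
  proof -
    have "C \<subseteq> J u" unfolding J_def using that by (intro connected_component_maximal)
    also have "J u = J z" using that(4) unfolding J_def using connected_component_eq by blast
    finally show ?thesis .
  qed
  have outside: "AE \<omega> in Q. fst \<omega> < t \<longrightarrow> snd \<omega> \<notin> O'"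
    using st
  proof eventually_elim
    case (elim \<omega>)
    show ?case
    proof (intro impI notI)
      assume *: "fst \<omega> < t" "snd \<omega> \<in> O'"
      then obtain x y1 y2 where x: "t \<le> x" "(x, y1) \<in> S" "(x, y2) \<in> S" "y1 < snd \<omega>" "snd \<omega> < y2"
        using O'_E by blast
      have "(fst \<omega>, snd \<omega>) \<in> \<Gamma>" using elim S\<Gamma> by auto
      then show False using rm[of x y1 y2 "fst \<omega>" "snd \<omega>"] x * S\<Gamma> by auto
    qed
  qed
  \<comment> \<open>A straddling interval contains its own starting point x \<ge> t. In the bounded
    case this puts the right end of a component beyond t.\<close>
  have late: "\<exists>x\<in>J z. t \<le> x" if z: "z \<in> O'" for z
  proof -
    obtain x y1 y2 where x: "t \<le> x" "(x, y1) \<in> S" "(x, y2) \<in> S" "y1 < x" "x < y2" "y1 < z" "z < y2"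
      using O'_E[OF z] by blast
    then have "{y1<..<y2} \<subseteq> J z" using O'_I[of x y1 y2] J_self[OF z]
      by (intro J_max[of _ z]) auto
    then show ?thesis using x by auto
  qed
  \<comment> \<open>A move from x \<ge> t to y \<noteq> x spans an open interval of O' that contains
    x and has y as an end point, so y is in the closure of the component of x. As \<nu> has no
    atoms, y almost surely avoids the ends a and b of the component.\<close>
  have comp: "AE \<omega> in Q. t \<le> fst \<omega> \<longrightarrow> (fst \<omega> \<in> J z \<longleftrightarrow> snd \<omega> \<in> J z)"
    if fr: "closure (J z) \<subseteq> J z \<union> {a, b}" for z a b
    using st AE_snd_neq[of a] AE_snd_neq[of b]
  proof eventually_elim
    case (elim \<omega>)
    define x where "x = fst \<omega>"
    define y where "y = snd \<omega>"
    have yab: "y \<noteq> a" "y \<noteq> b" using elim by (auto simp: y_def)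
    have xy: "(x, y) \<in> S" "y = x \<or> (\<exists>y1 y2. (x, y1) \<in> S \<and> (x, y2) \<in> S \<and> y1 < x \<and> x < y2)"
      using elim by (auto simp: x_def y_def)
    have "x \<in> J z \<longleftrightarrow> y \<in> J z" if tx: "t \<le> x"
    proof (cases "y = x")
      case False
      then obtain y1 y2 where Y: "(x, y1) \<in> S" "(x, y2) \<in> S" "y1 < x" "x < y2" using xy by blast
      \<comment> \<open>One end is y itself, the other a point of the fiber on the opposite side of
        x.\<close>
      define u where "u = (if y < x then y else y1)"
      define v where "v = (if y < x then y2 else y)"
      have uv: "(x, u) \<in> S" "(x, v) \<in> S" "u < x" "x < v" "y = u \<or> y = v"
        using Y xy False by (auto simp: u_def v_def)
      have sub: "{u<..<v} \<subseteq> O'" using O'_I[OF tx uv(1-4)] .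
      have ycl: "y \<in> closure {u<..<v}" using uv by auto
      show ?thesis
      proof
        assume "x \<in> J z"
        then have "{u<..<v} \<subseteq> J z" using sub uv by (intro J_max[of _ x]) auto
        then have "y \<in> closure (J z)" using ycl closure_mono by blast
        then show "y \<in> J z" using fr yab by auto
      next
        assume "y \<in> J z"
        then obtain w where "w \<in> {u<..<v}" "w \<in> J z"
          using ycl J_open[of z] open_Int_closure_eq_empty[of "J z" "{u<..<v}"] by blast
        then have "{u<..<v} \<subseteq> J z" using sub by (intro J_max[of _ w]) auto
        then show "x \<in> J z" using uv by auto
      qed
    qed simp
    then show ?case by (simp add: x_def y_def)
  qed
  have comp': "AE \<omega> in Q. snd \<omega> \<in> J z \<longleftrightarrow> t \<le> fst \<omega> \<and> fst \<omega> \<in> J z"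
    if fr: "closure (J z) \<subseteq> J z \<union> {a, b}" for z a b
    using comp[OF fr] outside AE_space
    by eventually_elim (use J_sub[of z] in \<open>auto simp: not_le\<close>)
  have cl1: "closure {a<..} \<subseteq> {a<..} \<union> {a, a}" for a :: real
    unfolding closure_greaterThan by auto
  have cl2: "closure {a<..<b} \<subseteq> {a<..<b} \<union> {a, b}" for a b :: real
    by (cases "a < b") auto
  have diag: "AE \<omega> in Q. t \<le> fst \<omega> \<and> fst \<omega> \<notin> O' \<longrightarrow> snd \<omega> = fst \<omega>"
    using st
  proof eventually_elim
    case (elim \<omega>)
    show ?case
    proof (intro impI)
      assume *: "t \<le> fst \<omega> \<and> fst \<omega> \<notin> O'"
      show "snd \<omega> = fst \<omega>"
      proof (rule ccontr)
        assume "snd \<omega> \<noteq> fst \<omega>"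
        then obtain y1 y2 where "(fst \<omega>, y1) \<in> S" "(fst \<omega>, y2) \<in> S" "y1 < fst \<omega>" "fst \<omega> < y2"
          using elim by blast
        then show False using O'_I[of "fst \<omega>" y1 y2] * by auto
      qed
    qed
  qed
  have shape: "(\<exists>a. 0 \<le> a \<and> a < t \<and> J z = {a<..}) \<or> (\<exists>a b. 0 \<le> a \<and> a < t \<and> t < b \<and> J z = {a<..<b})"
    if z: "z \<in> O'" for z
  proof -
    have "J z \<noteq> {}" "J z \<subseteq> {0<..}" using J_self[OF z] J_sub pos_O' by auto
    then consider a where "0 \<le> a" "J z = {a<..}" | a b where "0 \<le> a" "a < b" "J z = {a<..<b}"
      using open_connected_halfline[OF J_open J_conn] by metis
    then show ?thesis
    proof cases
      case 1
      have "a < t"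
      proof (rule ccontr)
        assume "\<not> a < t"
        then have at: "t \<le> a" by simp
        have A: "{a<..} \<in> sets pos_borel" using 1 by (auto simp: sets_pos_borel_iff)
        have ae: "AE \<omega> in Q. snd \<omega> \<in> J z \<longleftrightarrow> t \<le> fst \<omega> \<and> fst \<omega> \<in> J z"
          by (rule comp'[of z a a]) (unfold 1(2), rule cl1)
        have "AE \<omega> in Q. fst \<omega> \<in> {a<..} \<longleftrightarrow> snd \<omega> \<in> {a<..}"
          using ae unfolding 1(2)
        proof eventually_elim
          case (elim \<omega>)
          then show ?case using at by (cases "a < fst \<omega>") simp_all
        qed
        note ma = marginals_agree[OF A A this]
        have "Fcdf \<mu> a = Fcdf \<nu> a" "Gmom \<mu> a = Gmom \<nu> a"
          using ma 1(1) by (simp_all add: law_intervals)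
        then show False using no_unbounded_component[of a] at t by (simp add: deltaF_def deltaG_def)
      qed
      then show ?thesis using 1 by blast
    next
      case 2
      have "a < t"
      proof (rule ccontr)
        assume "\<not> a < t"
        then have at: "t \<le> a" by simp
        have A: "{a<..<b} \<in> sets pos_borel" using 2 by (auto simp: sets_pos_borel_iff)
        have ae: "AE \<omega> in Q. snd \<omega> \<in> J z \<longleftrightarrow> t \<le> fst \<omega> \<and> fst \<omega> \<in> J z"
          by (rule comp'[of z a b]) (unfold 2(3), rule cl2)
        have "AE \<omega> in Q. fst \<omega> \<in> {a<..<b} \<longleftrightarrow> snd \<omega> \<in> {a<..<b}"
          using ae unfolding 2(3)
        proof eventually_elim
          case (elim \<omega>)
          then show ?case using at by (cases "a < fst \<omega>") simp_all
        qed
        note ma = marginals_agree[OF A A this]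
        have "Fcdf \<mu> b - Fcdf \<mu> a = Fcdf \<nu> b - Fcdf \<nu> a" "Gmom \<mu> b - Gmom \<mu> a = Gmom \<nu> b - Gmom \<nu> a"
          using ma 2(1,2) by (simp_all add: law_intervals)
        then show False using no_late_component[of a b] at t 2 by (simp add: deltaF_def deltaG_def)
      qed
      moreover have "t < b" using late[OF z] 2 by auto
      ultimately show ?thesis using 2 by blast
    qed
  qed
  show ?thesis
  proof (cases "O' = {}")
    case True
    then show ?thesis using that(1) diag by simp
  next
    case False
    \<comment> \<open>Every component contains t, so there is only one.\<close>
    have all_t: "t \<in> J z" if "z \<in> O'" for z using shape[OF that] by (elim disjE exE conjE) simp_all
    obtain z where z: "z \<in> O'" using False by blast
    have OJ: "O' = J z"
    proof
      show "O' \<subseteq> J z"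
      proof
        fix w assume w: "w \<in> O'"
        have "J w \<subseteq> J z" using all_t[OF w] all_t[OF z] by (intro J_max[of _ t] J_conn J_sub)
        then show "w \<in> J z" using J_self[OF w] by auto
      qed
    qed (rule J_sub)
    from shape[OF z] show ?thesis
    proof (elim disjE exE conjE)
      fix a assume a: "0 \<le> a" "a < t" "J z = {a<..}"
      have "AE \<omega> in Q. snd \<omega> \<in> J z \<longleftrightarrow> t \<le> fst \<omega> \<and> fst \<omega> \<in> J z"
        by (rule comp'[of z a a]) (unfold a(3), rule cl1)
      then have "AE \<omega> in Q. snd \<omega> \<in> {a<..} \<longleftrightarrow> fst \<omega> \<in> {t..}"
        unfolding a(3)
      proof eventually_elim
        case (elim \<omega>)
        then show ?case using a(2) by (cases "t \<le> fst \<omega>") simp_all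
      qed
      then show ?thesis using that(2) a by blast
    next
      fix a b assume a: "0 \<le> a" "a < t" "t < b" "J z = {a<..<b}"
      have "AE \<omega> in Q. snd \<omega> \<in> J z \<longleftrightarrow> t \<le> fst \<omega> \<and> fst \<omega> \<in> J z"
        by (rule comp'[of z a b]) (unfold a(4), rule cl2)
      then have "AE \<omega> in Q. snd \<omega> \<in> {a<..<b} \<longleftrightarrow> fst \<omega> \<in> {t..<b}"
        unfolding a(4)
      proof eventually_elim
        case (elim \<omega>)
        then show ?case using a(2) by (cases "t \<le> fst \<omega>") simp_all
      qed
      moreover have "AE \<omega> in Q. b \<le> fst \<omega> \<longrightarrow> snd \<omega> = fst \<omega>"
        using diag unfolding OJ a(4)
      proof eventually_elim
        case (elim \<omega>)
        then show ?case using a(3) by simp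
      qed
      ultimately show ?thesis using that(3) a by blast
    qed
  qed
qed

text \<open>U receives exactly what starts in [t, \<infinity>) outside V, and V stays put. Neither
  part mixes with mass from below t, so each is read off from one marginal.\<close>

lemma prob_split:
  assumes U: "U \<in> sets pos_borel" and V: "V \<in> sets pos_borel" and t: "0 < t"
    and ae: "AE \<omega> in Q. snd \<omega> \<in> U \<longleftrightarrow> fst \<omega> \<in> {t..} - V"
    and diag: "AE \<omega> in Q. fst \<omega> \<in> V \<longrightarrow> snd \<omega> = fst \<omega>" and Vt: "V \<subseteq> {t..}"
    and B: "B \<in> sets pos_borel"
  shows "Q.prob {\<omega> \<in> space Q. t \<le> fst \<omega> \<and> snd \<omega> \<in> B} = measure \<nu> (B \<inter> U) + measure \<mu> (B \<inter> V)"
proof -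
  have BU: "B \<inter> U \<in> sets pos_borel" "B \<inter> V \<in> sets pos_borel" "{t..} \<in> sets pos_borel"
    using B U V t by (auto simp: sets_pos_borel_iff)
  let ?E = "{\<omega> \<in> space Q. t \<le> fst \<omega> \<and> snd \<omega> \<in> B}"
  let ?E1 = "{\<omega> \<in> space Q. snd \<omega> \<in> B \<inter> U}"
  \<comment> \<open>The condition \<open>snd \<omega> \<notin> U\<close> holds almost surely over V;
    it makes the two events disjoint.\<close>
  let ?E2 = "{\<omega> \<in> space Q. snd \<omega> \<notin> U \<and> fst \<omega> \<in> B \<inter> V}"
  have E: "?E \<in> sets Q" "?E1 \<in> sets Q" "?E2 \<in> sets Q" "{\<omega> \<in> space Q. fst \<omega> \<in> B \<inter> V} \<in> sets Q"
    using B BU U V by measurable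
  have "Q.prob ?E = Q.prob (?E1 \<union> ?E2)"
  proof (rule Q.finite_measure_eq_AE)
    show "AE \<omega> in Q. \<omega> \<in> ?E \<longleftrightarrow> \<omega> \<in> ?E1 \<union> ?E2"
      using ae diag by eventually_elim (use Vt in auto)
  qed (use E in auto)
  also have "\<dots> = Q.prob ?E1 + Q.prob ?E2"
    by (rule Q.finite_measure_Union) (use E in auto)
  also have "Q.prob ?E2 = Q.prob {\<omega> \<in> space Q. fst \<omega> \<in> B \<inter> V}"
  proof (rule Q.finite_measure_eq_AE)
    show "AE \<omega> in Q. \<omega> \<in> ?E2 \<longleftrightarrow> \<omega> \<in> {\<omega> \<in> space Q. fst \<omega> \<in> B \<inter> V}"
      using ae by eventually_elim auto
  qed (use E in auto)
  finally show ?thesis by (simp only: measure_fst[OF BU(2)] measure_snd[OF BU(1)])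
qed

lemma measure_le_outside:
  assumes B: "B \<in> sets pos_borel" and BV: "B \<subseteq> V"
    and diag: "AE \<omega> in Q. fst \<omega> \<in> V \<longrightarrow> snd \<omega> = fst \<omega>"
  shows "measure \<mu> B \<le> measure \<nu> B"
proof -
  have "{\<omega> \<in> space Q. snd \<omega> \<in> B} \<in> sets Q" using B by measurable
  then have "Q.prob {\<omega> \<in> space Q. fst \<omega> \<in> B} \<le> Q.prob {\<omega> \<in> space Q. snd \<omega> \<in> B}"
  proof (rule Q.finite_measure_mono_AE[rotated])
    show "AE \<omega> in Q. \<omega> \<in> {\<omega> \<in> space Q. fst \<omega> \<in> B} \<longrightarrow> \<omega> \<in> {\<omega> \<in> space Q. snd \<omega> \<in> B}"
      using diag by eventually_elim (use BV in auto)
  qed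
  then show ?thesis by (simp only: measure_fst[OF B] measure_snd[OF B])
qed

text \<open>Mass that stays put is part of the terminal law, so \<nu> dominates \<mu> there. This
  excludes diagonal behaviour wherever \<delta>F decreases.\<close>

lemma delta_mono_outside:
  assumes "0 < u" "u \<le> v" "{u<..v} \<subseteq> V"
    and diag: "AE \<omega> in Q. fst \<omega> \<in> V \<longrightarrow> snd \<omega> = fst \<omega>"
  shows "\<delta> u \<le> \<delta> v"
proof -
  have B: "{u<..v} \<in> sets pos_borel" using assms by (auto simp: sets_pos_borel_iff)
  have "measure \<mu> {u<..v} \<le> measure \<nu> {u<..v}"
    by (rule measure_le_outside[OF B assms(3) diag])
  then show ?thesis
    using assms(1,2) by (simp add: law_intervals deltaF_def)
qed

text \<open>The equations for (a, b) say that \<mu> on [t, b) and \<nu> on (a, b) have equal mass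
  and moment, with the terms at b collected in \<delta>F and \<delta>G. They involve the marginals
  alone and not \<open>Q\<close>.\<close>

lemma tail_determined:
  assumes t: "0 < t"
  shows "c \<le> t \<and> (\<forall>B \<in> sets pos_borel.
      Q.prob {\<omega> \<in> space Q. t \<le> fst \<omega> \<and> snd \<omega> \<in> B} = measure \<mu> (B \<inter> {t..})) \<or>
    t < c \<and> (\<exists>a b. 0 \<le> a \<and> a < t \<and> c \<le> b \<and>
      Fcdf \<nu> a = Fcdf \<mu> t + \<delta> b \<and> Gmom \<nu> a = Gmom \<mu> t + deltaG \<mu> \<nu> b \<and>
      (\<forall>B \<in> sets pos_borel. Q.prob {\<omega> \<in> space Q. t \<le> fst \<omega> \<and> snd \<omega> \<in> B} =
        measure \<nu> (B \<inter> {a<..<b}) + measure \<mu> (B \<inter> {b..})))"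
  using t
proof (cases rule: structure_AE)
  case 1
  have "c \<le> t"
  proof (rule ccontr)
    assume "\<not> c \<le> t"
    \<comment> \<open>Between \<open>max t m\<close> and c the function \<delta> strictly decreases,
      which the diagonal behaviour above t forbids.\<close>
    then have "\<delta> (max t m) \<le> \<delta> c"
      using m_less_c t 1 by (intro delta_mono_outside[where V = "{t..}"]) auto
    then show False using delta_min[of "max t m"] m_less_c t \<open>\<not> c \<le> t\<close> by (simp add: max_def split: if_splits)
  qed
  moreover have "Q.prob {\<omega> \<in> space Q. t \<le> fst \<omega> \<and> snd \<omega> \<in> B} = measure \<mu> (B \<inter> {t..})"
    if B: "B \<in> sets pos_borel" for B
  proof -
    have "{t..} \<in> sets pos_borel" using t by (auto simp: sets_pos_borel_iff)
    from prob_split[OF _ this t _ _ _ B, of "{}"] 1 show ?thesis by simp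
  qed
  ultimately show ?thesis by blast
next
  case (2 a)
  have A: "{a<..} \<in> sets pos_borel" "{t..} \<in> sets pos_borel"
    using 2 t by (auto simp: sets_pos_borel_iff)
  have "AE \<omega> in Q. fst \<omega> \<in> {t..} \<longleftrightarrow> snd \<omega> \<in> {a<..}"
    using 2(3) by eventually_elim auto
  note ma = marginals_agree[OF A(2,1) this]
  have e: "Fcdf \<nu> a = Fcdf \<mu> t" "Gmom \<nu> a = Gmom \<mu> t"
    using ma 2(1,2) t by (simp_all add: law_intervals)
  \<comment> \<open>Inserting the two equations, H a becomes a (F t - F a) - (G t - G a) with F and
    G taken for \<mu>. This is negative, so an unbounded component cannot occur.\<close>
  have "a * (Fcdf \<mu> t - Fcdf \<mu> a) < Gmom \<mu> t - Gmom \<mu> a"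
    by (rule mu.Gmom_lower_strict) (use 2 in auto)
  then have "H a < 0" by (simp add: H_eq deltaF_def deltaG_def e algebra_simps)
  then show ?thesis using H_nonneg[of a] 2 by simp
next
  case (3 a b)
  have A: "{a<..<b} \<in> sets pos_borel" "{t..<b} \<in> sets pos_borel" "{b..} \<in> sets pos_borel"
    using 3 t by (auto simp: sets_pos_borel_iff)
  have "AE \<omega> in Q. fst \<omega> \<in> {t..<b} \<longleftrightarrow> snd \<omega> \<in> {a<..<b}"
    using 3(4) by eventually_elim auto
  note ma = marginals_agree[OF A(2,1) this]
  have e: "Fcdf \<nu> a = Fcdf \<mu> t + \<delta> b" "Gmom \<nu> a = Gmom \<mu> t + deltaG \<mu> \<nu> b"
    using ma 3(1-3) t by (simp_all add: law_intervals deltaF_def deltaG_def)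
  \<comment> \<open>For t \<ge> c the mass equation would give
    \<open>Fcdf \<nu> a > Fcdf \<nu> t\<close> although a < t.\<close>
  have tc: "t < c"
  proof (rule ccontr)
    assume "\<not> t < c"
    then have "\<delta> t < \<delta> b" using delta_inc[of t b] 3 by auto
    moreover have "Fcdf \<nu> a < Fcdf \<nu> t" using nu.Fcdf_strict_mono[of a t] 3 by auto
    ultimately show False using e by (simp add: deltaF_def)
  qed
  have diag: "AE \<omega> in Q. fst \<omega> \<in> {b..} \<longrightarrow> snd \<omega> = fst \<omega>"
    using 3(5) by simp
  have bc: "c \<le> b"
  proof (rule ccontr)
    assume "\<not> c \<le> b"
    then have "\<delta> (max b m) \<le> \<delta> c"
      using m_less_c t 3 diag by (intro delta_mono_outside[where V = "{b..}"]) auto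
    then show False using delta_min[of "max b m"] m_less_c t 3 \<open>\<not> c \<le> b\<close>
      by (simp add: max_def split: if_splits)
  qed
  have "AE \<omega> in Q. snd \<omega> \<in> {a<..<b} \<longleftrightarrow> fst \<omega> \<in> {t..} - {b..}"
    using 3(4) by eventually_elim auto
  then have "Q.prob {\<omega> \<in> space Q. t \<le> fst \<omega> \<and> snd \<omega> \<in> B} =
      measure \<nu> (B \<inter> {a<..<b}) + measure \<mu> (B \<inter> {b..})" if "B \<in> sets pos_borel" for B
    using prob_split[OF A(1,3) t _ diag _ that] 3 by auto
  then show ?thesis using tc bc e 3 by blast
qed

end

section \<open>Uniqueness from the tails\<close>

context unimodal_pair
begin

text \<open>Raising b to b' adds mass that has to be matched by \<nu> between a and a'. In \<delta>G
  this mass counts with weight at least b, under \<nu> with weight at most a' < t < c \<le> b, so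
  the moments cannot balance.\<close>

lemma endpoints_unique:
  assumes "0 \<le> a" "a < t" "t < c" "c \<le> b"
    and e: "Fcdf \<nu> a = Fcdf \<mu> t + \<delta> b" "Gmom \<nu> a = Gmom \<mu> t + deltaG \<mu> \<nu> b"
    and "0 \<le> a'" "a' < t" "c \<le> b'"
    and e': "Fcdf \<nu> a' = Fcdf \<mu> t + \<delta> b'" "Gmom \<nu> a' = Gmom \<mu> t + deltaG \<mu> \<nu> b'"
  shows "a = a' \<and> b = b'"
proof -
  have no: False if "0 \<le> a" "a < t" "c \<le> b" "0 \<le> a'" "a' < t" "b < b'"
    and e: "Fcdf \<nu> a = Fcdf \<mu> t + \<delta> b" "Gmom \<nu> a = Gmom \<mu> t + deltaG \<mu> \<nu> b"
    and e': "Fcdf \<nu> a' = Fcdf \<mu> t + \<delta> b'" "Gmom \<nu> a' = Gmom \<mu> t + deltaG \<mu> \<nu> b'"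
    for a b a' b'
  proof -
    have d: "0 < \<delta> b' - \<delta> b" using delta_inc[of b b'] that by auto
    have aa: "a < a'"
      using nu.Fcdf_strict_mono[of a' a] d e e' that by (cases a a' rule: linorder_cases) auto
    have "b * (\<delta> b' - \<delta> b) \<le> deltaG \<mu> \<nu> b' - deltaG \<mu> \<nu> b" using that by (intro deltaG_diff_ge)
    also have "\<dots> = Gmom \<nu> a' - Gmom \<nu> a" using e e' by simp
    also have "\<dots> \<le> a' * (Fcdf \<nu> a' - Fcdf \<nu> a)" using aa that by (intro nu.Gmom_bounds) auto
    also have "\<dots> = a' * (\<delta> b' - \<delta> b)" using e e' by simp
    finally show False using d that assms(3) by (simp add: mult_le_cancel_right)
  qed
  have "b = b'" using no[of a b a' b'] no[of a' b' a b] assms by (cases b b' rule: linorder_cases) auto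
  moreover then have "a = a'"
    using nu.Fcdf_strict_mono[of a a'] nu.Fcdf_strict_mono[of a' a] assms
    by (cases a a' rule: linorder_cases) auto
  ultimately show ?thesis by simp
qed

end

text \<open>Tails are the test sets on which the couplings, and later the laws of \<open>T\<close>
  and \<open>Z\<close>, can be computed.\<close>

lemma measure_eqI_atLeast:
  fixes M N :: "real measure"
  assumes sets: "sets M = sets borel" "sets N = sets borel"
    and fin: "\<And>x. emeasure M {x..} \<noteq> \<infinity>"
    and eq: "\<And>x. emeasure M {x..} = emeasure N {x..}"
  shows "M = N"
proof (rule measure_eqI_generator_eq[where E = "range (\<lambda>a::real. {a..})" and A = "\<lambda>n. {- real n..}"])
  show "Int_stable (range (\<lambda>a::real. {a..}))"
  proof (rule Int_stableI_image)
    show "\<exists>z\<in>UNIV. {x..} \<inter> {y..} = {z..}" for x y :: real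
      by (intro bexI[of _ "max x y"]) auto
  qed
  show "sets M = sigma_sets UNIV (range (\<lambda>a::real. {a..}))" "sets N = sigma_sets UNIV (range (\<lambda>a::real. {a..}))"
    by (simp_all add: sets borel_Ici)
  show "(\<Union>n. {- real n..}) = (UNIV :: real set)"
  proof (intro set_eqI iffI UNIV_I)
    fix x :: real
    obtain n where "- x \<le> real n" using real_arch_simple by blast
    then have "x \<in> {- real n..}" by simp
    then show "x \<in> (\<Union>n. {- real n..})" by blast
  qed
qed (use fin eq in auto)

text \<open>For fixed Y, the measure that takes X to the mass of X \<times> Y is determined by its
  tails, and these depend only on the marginals, by \<open>tail_determined\<close> and
  \<open>endpoints_unique\<close>. Rectangles then determine the coupling.\<close>

lemma (in unimodal_pair) right_monotone_unique:
  assumes Q1: "Q1 \<in> mart_couplings \<mu> \<nu>" "right_monotone Q1"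
    and Q2: "Q2 \<in> mart_couplings \<mu> \<nu>" "right_monotone Q2"
  shows "Q1 = Q2"
proof -
  interpret A: right_monotone_coupling \<mu> \<nu> m c Q1
    by unfold_locales (use Q1 in auto)
  interpret B: right_monotone_coupling \<mu> \<nu> m c Q2
    by unfold_locales (use Q2 in auto)
  have tail: "A.Q.prob {\<omega> \<in> space Q1. t \<le> fst \<omega> \<and> snd \<omega> \<in> Y} =
      B.Q.prob {\<omega> \<in> space Q2. t \<le> fst \<omega> \<and> snd \<omega> \<in> Y}" if t: "0 < t" and Y: "Y \<in> sets pos_borel" for t Y
  proof (cases "c \<le> t")
    case True
    then show ?thesis using A.tail_determined[OF t] B.tail_determined[OF t] Y by auto
  next
    case False
    then obtain a b where ab: "0 \<le> a" "a < t" "c \<le> b"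
      "Fcdf \<nu> a = Fcdf \<mu> t + \<delta> b" "Gmom \<nu> a = Gmom \<mu> t + deltaG \<mu> \<nu> b"
      and 1: "A.Q.prob {\<omega> \<in> space Q1. t \<le> fst \<omega> \<and> snd \<omega> \<in> Y} =
        measure \<nu> (Y \<inter> {a<..<b}) + measure \<mu> (Y \<inter> {b..})"
      using A.tail_determined[OF t] Y by auto
    from False obtain a' b' where ab': "0 \<le> a'" "a' < t" "c \<le> b'"
      "Fcdf \<nu> a' = Fcdf \<mu> t + \<delta> b'" "Gmom \<nu> a' = Gmom \<mu> t + deltaG \<mu> \<nu> b'"
      and 2: "B.Q.prob {\<omega> \<in> space Q2. t \<le> fst \<omega> \<and> snd \<omega> \<in> Y} =
        measure \<nu> (Y \<inter> {a'<..<b'}) + measure \<mu> (Y \<inter> {b'..})"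
      using B.tail_determined[OF t] Y by auto
    have "a = a' \<and> b = b'" using False by (intro endpoints_unique[of a t b a' b'] ab ab') auto
    then show ?thesis using 1 2 by simp
  qed
  have rect: "emeasure Q1 (X \<times> Y) = emeasure Q2 (X \<times> Y)"
    if X: "X \<in> sets pos_borel" and Y: "Y \<in> sets pos_borel" for X Y
  proof -
    have sub: "X \<subseteq> {0<..}" "Y \<subseteq> {0<..}" "X \<in> sets borel" using X Y by (auto simp: sets_pos_borel_iff)
    let ?D = "\<lambda>Q. distr (density Q (\<lambda>\<omega>. indicator Y (snd \<omega>))) borel fst"
    have em: "emeasure (?D Q) C = emeasure Q {\<omega> \<in> space Q. fst \<omega> \<in> C \<and> snd \<omega> \<in> Y}"
      if Q: "Q = Q1 \<or> Q = Q2" and C: "C \<in> sets borel" for Q C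
    proof -
      have f: "fst \<in> borel_measurable Q" and s: "snd \<in> Q \<rightarrow>\<^sub>M pos_borel"
        using Q A.borel_fst B.borel_fst A.snd_meas B.snd_meas by auto
      have m: "(\<lambda>\<omega>. indicator Y (snd \<omega>) :: ennreal) \<in> borel_measurable Q"
        using s Y by measurable
      have fC: "fst -` C \<inter> space Q \<in> sets Q" using f C by measurable
      have E: "{\<omega> \<in> space Q. fst \<omega> \<in> C \<and> snd \<omega> \<in> Y} \<in> sets Q"
      proof -
        have "{\<omega> \<in> space Q. fst \<omega> \<in> C \<and> snd \<omega> \<in> Y} = (fst -` C \<inter> space Q) \<inter> (snd -` Y \<inter> space Q)" by auto
        then show ?thesis using fC measurable_sets[OF s Y] by auto
      qed
      have "emeasure (?D Q) C = (\<integral>\<^sup>+\<omega>. indicator Y (snd \<omega>) * indicator (fst -` C \<inter> space Q) \<omega> \<partial>Q)"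
        using f m C fC by (subst emeasure_distr) (auto simp: emeasure_density)
      also have "\<dots> = (\<integral>\<^sup>+\<omega>. indicator {\<omega> \<in> space Q. fst \<omega> \<in> C \<and> snd \<omega> \<in> Y} \<omega> \<partial>Q)"
        by (intro nn_integral_cong) (auto simp: indicator_def)
      also have "\<dots> = emeasure Q {\<omega> \<in> space Q. fst \<omega> \<in> C \<and> snd \<omega> \<in> Y}"
        using E by simp
      finally show ?thesis .
    qed
    have "?D Q1 = ?D Q2"
    proof (rule measure_eqI_atLeast)
      fix t :: real
      \<comment> \<open>For t \<le> 0 the tail is no restriction, and both couplings give the
        \<nu>-mass of Y.\<close>
      have fs: "{\<omega> \<in> space Q. fst \<omega> \<in> {t..} \<and> snd \<omega> \<in> Y} = {\<omega> \<in> space Q. snd \<omega> \<in> Y}"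
        if t: "t \<le> 0" and sp: "space Q = {0<..} \<times> {0<..}" for Q :: "(real \<times> real) measure"
      proof (rule Collect_cong)
        fix \<omega>
        have "t \<le> fst \<omega>" if "\<omega> \<in> space Q"
          using that t unfolding sp mem_Times_iff by simp
        then show "(\<omega> \<in> space Q \<and> fst \<omega> \<in> {t..} \<and> snd \<omega> \<in> Y) = (\<omega> \<in> space Q \<and> snd \<omega> \<in> Y)"
          by blast
      qed
      have "measure Q1 {\<omega> \<in> space Q1. fst \<omega> \<in> {t..} \<and> snd \<omega> \<in> Y} =
          measure Q2 {\<omega> \<in> space Q2. fst \<omega> \<in> {t..} \<and> snd \<omega> \<in> Y}"
      proof (cases "0 < t")
        case True then show ?thesis using tail[OF _ Y] by simp
      next
        case False
        then have t0: "t \<le> 0" by simp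
        show ?thesis
          by (simp only: fs[OF t0 A.space_Q] fs[OF t0 B.space_Q] A.measure_snd[OF Y] B.measure_snd[OF Y])
      qed
      then show "emeasure (?D Q1) {t..} = emeasure (?D Q2) {t..}"
        using em[of Q1 "{t..}"] em[of Q2 "{t..}"]
        by (simp only: borel_closed closed_atLeast A.Q.emeasure_eq_measure B.Q.emeasure_eq_measure simp_thms)
      show "emeasure (?D Q1) {t..} \<noteq> \<infinity>"
        using em[of Q1 "{t..}"] by (simp only: borel_closed closed_atLeast simp_thms) simp
    qed simp_all
    then have eqX: "emeasure (?D Q1) X = emeasure (?D Q2) X" by (rule arg_cong)
    have R: "{\<omega> \<in> space Q. fst \<omega> \<in> X \<and> snd \<omega> \<in> Y} = X \<times> Y"
      if sp: "space Q = {0<..} \<times> {0<..}" for Q :: "(real \<times> real) measure"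
      unfolding sp using sub(1,2) by (auto simp: mem_Times_iff)
    show ?thesis
      using eqX em[OF disjI1[OF refl] sub(3)] em[OF disjI2[OF refl] sub(3)]
      unfolding R[OF A.space_Q] R[OF B.space_Q] by (simp only:)
  qed
  show ?thesis
  proof (rule measure_eqI_generator_eq[where E = "{a \<times> b | a b. a \<in> sets pos_borel \<and> b \<in> sets pos_borel}"
        and \<Omega> = "{0<..} \<times> {0<..}" and A = "\<lambda>_. {0<..} \<times> {0<..}"])
    show "Int_stable {a \<times> b |a b. a \<in> sets pos_borel \<and> b \<in> sets pos_borel}"
      by (rule Int_stable_pair_measure_generator)
    show "{a \<times> b |a b. a \<in> sets pos_borel \<and> b \<in> sets pos_borel} \<subseteq> Pow ({0<..} \<times> {0<..})"
      by (auto simp: sets_pos_borel_iff)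
    show "range (\<lambda>_. {0<..} \<times> {0<..}) \<subseteq> {a \<times> b |a b. a \<in> sets pos_borel \<and> b \<in> sets pos_borel}"
    proof -
      have "{0<..} \<in> sets pos_borel" by (simp add: sets_pos_borel_iff)
      then show ?thesis by blast
    qed
    show "emeasure Q1 ({0<..} \<times> {0<..}) \<noteq> \<infinity>" by simp
  qed (use rect in \<open>auto simp: A.sets_Q B.sets_Q sets_pair_measure\<close>)
qed

section \<open>Transport along the two branches\<close>

text \<open>Monotonicity is weak, as in the left characteristics. Continuity includes the point c,
  where the branches meet, so that the search for a largest starting point takes place in compact
  intervals ending at c.\<close>

locale right_map = unimodal_pair \<mu> \<nu> m c for \<mu> \<nu> m c +
  fixes Rd Ru :: "real \<Rightarrow> real"
  assumes cont: "continuous_on {0<..c} Rd" "continuous_on {0<..c} Ru"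
    and at_c: "Rd c = c" "Ru c = c"
    and Rd_pos: "0 < x \<Longrightarrow> x < c \<Longrightarrow> 0 < Rd x"
    and Rd_less: "0 < x \<Longrightarrow> x < c \<Longrightarrow> Rd x < x"
    and less_Ru: "0 < x \<Longrightarrow> x < c \<Longrightarrow> x < Ru x"
    and mono': "0 < x \<Longrightarrow> x \<le> y \<Longrightarrow> y < c \<Longrightarrow> Rd x \<le> Rd y"
    and antimono': "0 < x \<Longrightarrow> x \<le> y \<Longrightarrow> y < c \<Longrightarrow> Ru y \<le> Ru x"
    and F_eq: "0 < x \<Longrightarrow> x < c \<Longrightarrow> Fcdf \<nu> (Rd x) = Fcdf \<mu> x + deltaF \<mu> \<nu> (Ru x)"
    and G_eq: "0 < x \<Longrightarrow> x < c \<Longrightarrow> Gmom \<nu> (Rd x) = Gmom \<mu> x + deltaG \<mu> \<nu> (Ru x)"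
begin

lemma c_le_Ru: assumes "0 < x" "x \<le> c" shows "c \<le> Ru x"
proof (cases "x = c")
  case False
  then have xc: "x < c" using assms by simp
  have "(Ru \<longlongrightarrow> Ru c) (at c within {0<..c})"
    using cont(2) c_pos by (auto simp: continuous_on_def)
  then have lim: "(Ru \<longlongrightarrow> c) (at c within {x<..<c})"
    unfolding at_c using assms by (elim tendsto_within_subset) auto
  have "at c within {x<..<c} \<noteq> bot"
    using xc by (simp add: trivial_limit_within islimpt_greaterThanLessThan2)
  then show ?thesis
  proof (rule tendsto_upperbound[OF lim, rotated])
    show "\<forall>\<^sub>F y in at c within {x<..<c}. Ru y \<le> Ru x"
      unfolding eventually_at_filter
      by (rule always_eventually) (use assms(1) in \<open>auto intro: antimono'\<close>)
  qed
qed (use at_c in simp)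

lemma Rd_le: assumes "0 < x" "x \<le> c" shows "Rd x \<le> x"
  using Rd_less[of x] at_c assms by (cases "x = c") auto

lemma Rd_mono: assumes "0 < x" "x \<le> y" "y \<le> c" shows "Rd x \<le> Rd y"
  using mono'[of x y] at_c Rd_le[of x] assms by (cases "y = c") auto

lemma Ru_antimono: assumes "0 < x" "x \<le> y" "y \<le> c" shows "Ru y \<le> Ru x"
  using antimono'[of x y] at_c c_le_Ru[of x] assms by (cases "y = c") auto

text \<open>As t tends to 0, \<open>Fcdf \<mu> t\<close> drops below - \<delta> N. If Ru t stayed
  below N, the mass equation would make \<open>Fcdf \<nu> (Rd t)\<close> negative. Hence every
  terminal value is below some Ru t.\<close>

lemma Ru_unbounded: obtains t where "0 < t" "t < c" "M \<le> Ru t"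
proof -
  \<comment> \<open>Exceeding c ensures that \<delta> N is negative and that \<delta> increases from
    Ru t \<ge> c up to N.\<close>
  define N where "N = max M c + 1"
  have N: "c < N" "M \<le> N" by (auto simp: N_def)
  have dN: "\<delta> N < 0" using delta_neg N by auto
  have "Fcdf \<mu> \<midarrow>0\<rightarrow> 0" using mu.F.isCont_Fcdf[of 0] mu.F.Fcdf_nonpos[of 0] by (simp add: isCont_def)
  then have "\<forall>\<^sub>F t in at_right 0. Fcdf \<mu> t < - \<delta> N"
    using dN by (intro order_tendstoD(2)[OF tendsto_mono[OF at_le]]) auto
  moreover have "\<forall>\<^sub>F t in at_right 0. t \<in> {0<..<c}"
    using eventually_at_right_real[OF c_pos] .
  ultimately have "\<forall>\<^sub>F t in at_right 0. Fcdf \<mu> t < - \<delta> N \<and> t \<in> {0<..<c}"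
    by (rule eventually_conj)
  then obtain t where t: "Fcdf \<mu> t < - \<delta> N" "0 < t" "t < c"
    using eventually_happens'[OF trivial_limit_at_right_real] by (auto simp: greaterThanLessThan_iff)
  have "N \<le> Ru t"
  proof (rule ccontr)
    assume "\<not> N \<le> Ru t"
    then have "\<delta> (Ru t) < \<delta> N" using delta_inc[of "Ru t" N] c_le_Ru[of t] t by auto
    moreover have "0 \<le> Fcdf \<nu> (Rd t)" by (rule nu.F.Fcdf_nonneg)
    ultimately show False using F_eq[of t] t by linarith
  qed
  then show thesis using that[of t] t N by auto
qed

section \<open>Starting points of terminal values\<close>

definition W :: "real \<Rightarrow> real set" where
  "W y = {t \<in> {0<..c}. Rd t \<le> y \<and> y \<le> Ru t}"

text \<open>\<open>T y\<close> is the point of \<open>(0, c]\<close> whose mass is sent to \<open>y\<close>, a common inverse of \<open>Rd\<close> and \<open>Ru\<close>.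
  The largest candidate is taken because \<open>Ru\<close> is not assumed to be injective.\<close>

definition T :: "real \<Rightarrow> real" where
  "T y = (SOME s. s \<in> W y \<and> (\<forall>t\<in>W y. t \<le> s))"

lemma W_down: "t \<in> W y \<Longrightarrow> 0 < s \<Longrightarrow> s \<le> t \<Longrightarrow> s \<in> W y"
  unfolding W_def using Rd_mono[of s t] Ru_antimono[of s t] by auto

lemma T_props:
  assumes y: "0 < y"
  shows "T y \<in> W y" "t \<in> W y \<Longrightarrow> t \<le> T y"
proof -
  obtain t1 where t1: "0 < t1" "t1 < c" "y \<le> Ru t1" using Ru_unbounded by blast
  \<comment> \<open>Being at most y keeps Rd t0 below y, being at most t1 keeps Ru t0 above y. So t0
    is a candidate, and the largest one can be sought in the compact interval [t0, c].\<close>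
  define t0 where "t0 = min t1 y"
  have t0: "0 < t0" "t0 \<le> t1" "t0 \<le> y" "t0 < c" using t1 y by (auto simp: t0_def)
  have t0W: "t0 \<in> W y"
    unfolding W_def using t0 t1 Rd_less[of t0] antimono'[of t0 t1] by auto
  have sub: "{t0..c} \<subseteq> {0<..c}" using t0 by auto
  let ?C = "({t0..c} \<inter> Rd -` {..y}) \<inter> ({t0..c} \<inter> Ru -` {y..})"
  have "closed ?C"
    by (intro closed_Int continuous_closed_preimage continuous_on_subset[OF cont(1) sub]
        continuous_on_subset[OF cont(2) sub] closed_atLeastAtMost closed_atMost closed_atLeast)
  moreover have "bounded ?C" by (rule bounded_subset[OF bounded_closed_interval[of t0 c]]) auto
  ultimately have "compact ?C" by (simp add: compact_eq_bounded_closed)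
  moreover have t0C: "t0 \<in> ?C" using t0W t0 by (auto simp: W_def)
  ultimately obtain s where s: "s \<in> ?C" "\<And>t. t \<in> ?C \<Longrightarrow> t \<le> s"
    using compact_attains_sup[of ?C] by blast
  have "s \<in> W y" using s(1) t0 by (auto simp: W_def)
  moreover have "t \<le> s" if t: "t \<in> W y" for t
  proof (cases "t0 \<le> t")
    case True then show ?thesis using t by (intro s(2)) (auto simp: W_def)
  next
    case False then show ?thesis using s(2)[OF t0C] by simp
  qed
  ultimately have "\<exists>s. s \<in> W y \<and> (\<forall>t\<in>W y. t \<le> s)" by blast
  from someI_ex[OF this] show "T y \<in> W y" "t \<in> W y \<Longrightarrow> t \<le> T y"
    unfolding T_def by blast+
qed

lemma T_range: assumes "0 < y" shows "0 < T y" "T y \<le> c" "Rd (T y) \<le> y" "y \<le> Ru (T y)"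
  using T_props(1)[OF assms] by (auto simp: W_def)

text \<open>\<open>W y\<close> is an initial segment of (0, c] with greatest element
  \<open>T y\<close>. The event \<open>t \<le> T y\<close> is thus the interval [Rd t, Ru t], whose
  mass and moment are given by \<open>F_eq\<close> and \<open>G_eq\<close>.\<close>

lemma T_ge_iff: assumes "0 < y" "0 < t" "t \<le> c" shows "t \<le> T y \<longleftrightarrow> Rd t \<le> y \<and> y \<le> Ru t"
proof
  assume "t \<le> T y"
  then have "t \<in> W y" using W_down[OF T_props(1)[OF assms(1)]] assms by blast
  then show "Rd t \<le> y \<and> y \<le> Ru t" by (simp add: W_def)
next
  assume "Rd t \<le> y \<and> y \<le> Ru t"
  then show "t \<le> T y" using T_props(2)[OF assms(1), of t] assms by (simp add: W_def)
qed

lemma T_eq_c: assumes "0 < y" shows "T y = c \<longleftrightarrow> y = c"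
proof
  assume "T y = c"
  then show "y = c" using T_range[OF assms] at_c by simp
next
  assume "y = c"
  then have "c \<le> T y" using T_ge_iff[of y c] assms c_pos at_c by simp
  then show "T y = c" using T_range(2)[OF assms] by simp
qed

text \<open>If y were strictly between the branches at \<open>T y\<close>, continuity would keep it
  between them a little to the right of \<open>T y\<close>, against maximality.\<close>

lemma T_endpoint: assumes y: "0 < y" shows "y = Rd (T y) \<or> y = Ru (T y)"
proof (rule ccontr)
  assume "\<not> ?thesis"
  then have lt: "Rd (T y) < y" "y < Ru (T y)" using T_range[OF y] by auto
  then have Tc: "0 < T y" "T y < c" using T_range[OF y] at_c by (auto simp: less_le)
  have io: "T y \<in> interior {0<..c}"
    using Tc by (intro interiorI[of "{0<..<c}"]) auto
  have "isCont Rd (T y)" "isCont Ru (T y)"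
    using cont io by (auto intro: continuous_on_interior)
  then have "\<forall>\<^sub>F t in at (T y). Rd t < y" "\<forall>\<^sub>F t in at (T y). y < Ru t"
    using lt by (auto simp: isCont_def intro: order_tendstoD)
  then have "\<forall>\<^sub>F t in at_right (T y). Rd t < y \<and> y < Ru t"
    by (auto simp: eventually_at_split intro: eventually_conj)
  moreover have "\<forall>\<^sub>F t in at_right (T y). t \<in> {T y<..<c}"
    using eventually_at_right_real[OF Tc(2)] .
  ultimately have "\<forall>\<^sub>F t in at_right (T y). (Rd t < y \<and> y < Ru t) \<and> t \<in> {T y<..<c}"
    by (rule eventually_conj)
  then obtain t where "Rd t < y" "y < Ru t" "T y < t" "t < c"
    using eventually_happens'[OF trivial_limit_at_right_real] by (auto simp: greaterThanLessThan_iff)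
  then show False using T_ge_iff[OF y, of t] Tc by auto
qed

text \<open>Under \<open>\<mu>\<close>, points above \<open>c\<close> stay where they are; \<open>Z\<close> sends them to the starting point of the
  mass that reaches the same place. The laws of \<open>T\<close> under \<open>\<nu>\<close> and of \<open>Z\<close> under \<open>\<mu>\<close> agree.\<close>

definition Z :: "real \<Rightarrow> real" where "Z x = (if x \<le> c then x else T x)"

text \<open>Compared with \<open>T_ge_iff\<close> the lower end is t instead of Rd t; these are the
  two intervals balanced by \<open>F_eq\<close> and \<open>G_eq\<close>.\<close>

lemma Z_ge_iff: assumes "0 < x" "0 < t" "t \<le> c" shows "t \<le> Z x \<longleftrightarrow> t \<le> x \<and> x \<le> Ru t"
proof (cases "x \<le> c")
  case True
  then show ?thesis using c_le_Ru[of t] assms by (auto simp: Z_def)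
next
  case False
  then show ?thesis using T_ge_iff[OF assms] Rd_le[of t] assms by (auto simp: Z_def)
qed

lemma Z_le: "0 < x \<Longrightarrow> Z x \<le> c" using T_range[of x] by (simp add: Z_def)

lemma Z_pos: "0 < x \<Longrightarrow> 0 < Z x" using T_range[of x] by (simp add: Z_def)

lemma T_vimage: "{y \<in> {0<..}. t \<le> T y} = (if t \<le> 0 then {0<..} else if t \<le> c then {Rd t..Ru t} else {})"
proof -
  have "Rd t > 0" if "0 < t" "t \<le> c" using Rd_pos[of t] at_c c_pos that by (cases "t = c") auto
  moreover have "t \<le> T y" if "0 < y" "t \<le> 0" for y using T_range(1)[of y] that by linarith
  moreover have "\<not> t \<le> T y" if "0 < y" "\<not> t \<le> c" for y using T_range(2)[of y] that by linarith
  ultimately show ?thesis using T_ge_iff[of _ t]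
    by (intro set_eqI) (smt (verit, del_insts) mem_Collect_eq greaterThan_iff atLeastAtMost_iff empty_iff)
qed

lemma Z_vimage: "{y \<in> {0<..}. t \<le> Z y} = (if t \<le> 0 then {0<..} else if t \<le> c then {t..Ru t} else {})"
proof -
  have "t \<le> Z y" if "0 < y" "t \<le> 0" for y using Z_pos[of y] that by linarith
  moreover have "\<not> t \<le> Z y" if "0 < y" "\<not> t \<le> c" for y using Z_le[of y] that by linarith
  ultimately show ?thesis using Z_ge_iff[of _ t]
    by (intro set_eqI) (smt (verit, del_insts) mem_Collect_eq greaterThan_iff atLeastAtMost_iff empty_iff)
qed

lemma T_meas: "T \<in> borel_measurable pos_borel"
proof (rule borel_measurableI_ge)
  fix t
  have "{y \<in> {0<..}. t \<le> T y} \<in> sets pos_borel"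
    unfolding T_vimage sets_pos_borel_iff using Rd_pos[of t] at_c c_pos
    by (cases "t = c") (auto simp: not_le)
  then show "{y \<in> space pos_borel. t \<le> T y} \<in> sets pos_borel" by simp
qed

lemma Z_meas: "Z \<in> borel_measurable pos_borel"
proof (rule borel_measurableI_ge)
  fix t
  have "{y \<in> {0<..}. t \<le> Z y} \<in> sets pos_borel"
    unfolding Z_vimage sets_pos_borel_iff by (auto simp: not_le)
  then show "{y \<in> space pos_borel. t \<le> Z y} \<in> sets pos_borel" by simp
qed

text \<open>Stated for arbitrary atomless laws because it is applied both to \<nu>, \<mu> and to
  their size-biased versions.\<close>

lemma distr_T_eq_Z:
  assumes n: "pos_law n" and u: "pos_law u"
    and eq: "\<And>t. 0 < t \<Longrightarrow> t < c \<Longrightarrow> Fcdf n (Ru t) - Fcdf n (Rd t) = Fcdf u (Ru t) - Fcdf u t"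
  shows "distr n borel T = distr u borel Z"
proof -
  interpret n: pos_law n by fact
  interpret u: pos_law u by fact
  have Tn: "T \<in> borel_measurable n" using T_meas measurable_cong_sets[OF n.sets_M refl] by blast
  have Zu: "Z \<in> borel_measurable u" using Z_meas measurable_cong_sets[OF u.sets_M refl] by blast
  show ?thesis
  proof (rule measure_eqI_atLeast)
    fix t :: real
    have e1: "emeasure (distr n borel T) {t..} = emeasure n {y \<in> {0<..}. t \<le> T y}"
      using Tn by (subst emeasure_distr) (auto intro!: arg_cong[where f = "emeasure n"])
    moreover have "emeasure (distr u borel Z) {t..} = emeasure u {y \<in> {0<..}. t \<le> Z y}"
      using Zu by (subst emeasure_distr) (auto intro!: arg_cong[where f = "emeasure u"])
    moreover have "emeasure n {y \<in> {0<..}. t \<le> T y} = emeasure u {y \<in> {0<..}. t \<le> Z y}"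
    proof -
      consider "t \<le> 0" | "0 < t" "t < c" | "t = c" | "c < t" by linarith
      then show ?thesis
      proof cases
        case 1
        then show ?thesis unfolding T_vimage Z_vimage
          using n.emeasure_space_1 u.emeasure_space_1 by simp
      next
        case 2
        then have "measure n {Rd t..Ru t} = measure u {t..Ru t}"
          using eq[of t] Rd_pos[of t] Rd_less[of t] less_Ru[of t]
          by (simp add: n.measure_Icc u.measure_Icc)
        then show ?thesis unfolding T_vimage Z_vimage
          using 2 by (simp add: n.emeasure_eq_measure u.emeasure_eq_measure)
      next
        case 3
        then show ?thesis unfolding T_vimage Z_vimage
          using c_pos at_c by (simp add: n.null_singleton u.null_singleton)
      next
        case 4
        then show ?thesis unfolding T_vimage Z_vimage using c_pos by simp
      qed
    qed
    ultimately show "emeasure (distr n borel T) {t..} = emeasure (distr u borel Z) {t..}" by simp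
    show "emeasure (distr n borel T) {t..} \<noteq> \<infinity>"
      unfolding e1 by (simp add: n.emeasure_finite)
  qed simp_all
qed

lemma T_mean:
  assumes g: "(g :: real \<Rightarrow> ennreal) \<in> borel_measurable borel"
  shows "(\<integral>\<^sup>+y. g (T y) \<partial>\<nu>) = (\<integral>\<^sup>+x. g (Z x) \<partial>\<mu>)"
    "(\<integral>\<^sup>+y. ennreal y * g (T y) \<partial>\<nu>) = (\<integral>\<^sup>+x. ennreal x * g (Z x) \<partial>\<mu>)"
proof -
  have T[measurable]: "T \<in> borel_measurable \<nu>" using T_meas measurable_cong_sets[OF nu.sets_M0 refl] by blast
  have Z[measurable]: "Z \<in> borel_measurable \<mu>" using Z_meas measurable_cong_sets[OF mu.sets_M0 refl] by blast
  have T': "T \<in> borel_measurable (size_biased \<nu>)" using T measurable_cong_sets[OF nu.sets_size_biased refl] by blast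
  have Z': "Z \<in> borel_measurable (size_biased \<mu>)" using Z measurable_cong_sets[OF mu.sets_size_biased refl] by blast
  have "distr \<nu> borel T = distr \<mu> borel Z"
    by (rule distr_T_eq_Z[OF nu.F.pos_law_axioms mu.F.pos_law_axioms])
      (use F_eq in \<open>simp add: deltaF_def\<close>)
  then have "(\<integral>\<^sup>+t. g t \<partial>distr \<nu> borel T) = (\<integral>\<^sup>+t. g t \<partial>distr \<mu> borel Z)" by simp
  then show "(\<integral>\<^sup>+y. g (T y) \<partial>\<nu>) = (\<integral>\<^sup>+x. g (Z x) \<partial>\<mu>)"
    using g by (simp add: nn_integral_distr[OF T] nn_integral_distr[OF Z])
  have "distr (size_biased \<nu>) borel T = distr (size_biased \<mu>) borel Z"
    by (rule distr_T_eq_Z[OF nu.G.pos_law_axioms mu.G.pos_law_axioms])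
      (use G_eq in \<open>simp add: deltaG_def mu.Fcdf_size_biased nu.Fcdf_size_biased\<close>)
  then have "(\<integral>\<^sup>+t. g t \<partial>distr (size_biased \<nu>) borel T) = (\<integral>\<^sup>+t. g t \<partial>distr (size_biased \<mu>) borel Z)" by simp
  then have "(\<integral>\<^sup>+y. g (T y) \<partial>size_biased \<nu>) = (\<integral>\<^sup>+x. g (Z x) \<partial>size_biased \<mu>)"
    using g by (simp add: nn_integral_distr[OF T'] nn_integral_distr[OF Z'])
  then show "(\<integral>\<^sup>+y. ennreal y * g (T y) \<partial>\<nu>) = (\<integral>\<^sup>+x. ennreal x * g (Z x) \<partial>\<mu>)"
  proof -
    have "(\<lambda>y. g (T y)) \<in> borel_measurable \<nu>" "(\<lambda>x. g (Z x)) \<in> borel_measurable \<mu>"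
      using g by measurable
    moreover have "(\<lambda>x. ennreal x) \<in> borel_measurable \<nu>" "(\<lambda>x. ennreal x) \<in> borel_measurable \<mu>"
      by (simp_all add: mu.F.borel_measurable_M nu.F.borel_measurable_M)
    ultimately show "(\<integral>\<^sup>+y. g (T y) \<partial>size_biased \<nu>) = (\<integral>\<^sup>+x. g (Z x) \<partial>size_biased \<mu>) \<Longrightarrow>
        (\<integral>\<^sup>+y. ennreal y * g (T y) \<partial>\<nu>) = (\<integral>\<^sup>+x. ennreal x * g (Z x) \<partial>\<mu>)"
      unfolding size_biased_def by (simp only: nn_integral_density)
  qed
qed

end

section \<open>The candidate plan\<close>

locale right_plan = right_map \<mu> \<nu> m c Rd Ru for \<mu> \<nu> m c Rd Ru +
  fixes q :: "real \<Rightarrow> real"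
  assumes q_eq: "0 < x \<Longrightarrow> x < c \<Longrightarrow> q x = (x - Rd x) / (Ru x - Rd x)"
begin

text \<open>Outside (0, c) the branches are replaced by the constant c, their common value at c.
  This gives Borel functions on the whole line.\<close>

definition rd :: "real \<Rightarrow> real" where "rd t = (if t \<in> {0<..<c} then Rd t else c)"
definition ru :: "real \<Rightarrow> real" where "ru t = (if t \<in> {0<..<c} then Ru t else c)"
definition w :: "real \<Rightarrow> real" where "w t = ru t - rd t"

lemma rd_meas [measurable]: "rd \<in> borel_measurable borel"
  unfolding rd_def[abs_def]
  by (intro borel_measurable_continuous_on_if continuous_on_subset[OF cont(1)] continuous_intros) auto

lemma ru_meas [measurable]: "ru \<in> borel_measurable borel"
  unfolding ru_def[abs_def]
  by (intro borel_measurable_continuous_on_if continuous_on_subset[OF cont(2)] continuous_intros) auto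

lemma w_meas [measurable]: "w \<in> borel_measurable borel"
  unfolding w_def[abs_def] by measurable

lemma rd_eq: "0 < t \<Longrightarrow> t \<le> c \<Longrightarrow> rd t = Rd t" using at_c by (auto simp: rd_def)

lemma ru_eq: "0 < t \<Longrightarrow> t \<le> c \<Longrightarrow> ru t = Ru t" using at_c by (auto simp: ru_def)

lemma rd_pos: "0 < rd t" using Rd_pos[of t] c_pos by (simp add: rd_def)

lemma rd_le_c: "rd t \<le> c" using Rd_less[of t] by (auto simp: rd_def)

lemma ru_ge_c: "c \<le> ru t" using c_le_Ru[of t] by (auto simp: ru_def)

lemma ru_pos: "0 < ru t" using ru_ge_c[of t] c_pos by simp

lemma w_nonneg: "0 \<le> w t" using rd_le_c[of t] ru_ge_c[of t] by (simp add: w_def)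

lemma w_pos: "0 < t \<Longrightarrow> t < c \<Longrightarrow> 0 < w t"
  using Rd_less[of t] less_Ru[of t] by (simp add: w_def rd_def ru_def)

abbreviation K :: "real \<Rightarrow> real measure" where "K \<equiv> right_kernel c q Ru Rd"

definition k :: "real set \<Rightarrow> real \<Rightarrow> real" where
  "k B x = (if c \<le> x then indicator B x
    else (x - rd x) / w x * indicator B (ru x) + (ru x - x) / w x * indicator B (rd x))"

lemma q_bounds: assumes "0 < x" "x < c" shows "0 \<le> q x" "q x \<le> 1"
  using Rd_less[OF assms] less_Ru[OF assms] by (auto simp: q_eq[OF assms])

lemma q_eq': assumes "0 < x" "x < c"
  shows "q x = (x - rd x) / w x" "1 - q x = (ru x - x) / w x"
  using w_pos[OF assms] assms by (auto simp: q_eq w_def rd_eq ru_eq field_simps)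

lemma emeasure_kernel:
  assumes x: "0 < x" and B: "B \<in> sets pos_borel"
  shows "emeasure (K x) B = ennreal (k B x)"
proof (cases "c \<le> x")
  case True
  then show ?thesis using B by (simp add: right_kernel_def k_def ennreal_indicator)
next
  case False
  then have xc: "x < c" by simp
  have "emeasure (K x) B = ennreal (q x) * ennreal (indicator B (Ru x)) + ennreal (1 - q x) * ennreal (indicator B (Rd x))"
    using False by (simp add: right_kernel_def emeasure_two_point[OF B] ennreal_indicator)
  also have "\<dots> = ennreal (q x * indicator B (Ru x) + (1 - q x) * indicator B (Rd x))"
    using q_bounds[OF x xc] by (simp add: ennreal_mult ennreal_plus)
  also have "q x * indicator B (Ru x) + (1 - q x) * indicator B (Rd x) = k B x"
    unfolding q_eq'(2)[OF x xc] unfolding q_eq'(1)[OF x xc]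
    using False by (simp add: k_def rd_eq[OF x] ru_eq[OF x])
  finally show ?thesis .
qed

lemma k_nonneg: assumes "0 < x" shows "0 \<le> k B x"
proof (cases "c \<le> x")
  case False
  then have xc: "x < c" by simp
  have "0 \<le> (x - rd x) / w x" "0 \<le> (ru x - x) / w x"
    using q_bounds[OF assms xc] q_eq'[OF assms xc] by simp_all
  then have "0 \<le> (x - rd x) / w x * indicator B (ru x) + (ru x - x) / w x * indicator B (rd x)"
    by (intro add_nonneg_nonneg mult_nonneg_nonneg) simp_all
  then show ?thesis using False by (simp add: k_def)
qed (simp add: k_def)

lemma k_meas: "B \<in> sets borel \<Longrightarrow> k B \<in> borel_measurable borel"
proof -
  assume [measurable]: "B \<in> sets borel"
  show ?thesis unfolding k_def[abs_def] by measurable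
qed

lemma sets_kernel: "sets (K x) = sets pos_borel"
  by (simp add: right_kernel_def two_point_def sets.sets_measure_of_eq del: space_pos_borel)

lemma space_kernel: "space (K x) = {0<..}"
  using sets_eq_imp_space_eq[OF sets_kernel] by simp

lemma k_space: assumes "0 < x" shows "k {0<..} x = 1"
proof (cases "c \<le> x")
  case False
  then show ?thesis using q_eq'[of x] assms rd_pos[of x] ru_pos[of x]
    by (simp add: k_def)
qed (use assms in \<open>simp add: k_def\<close>)

lemma prob_kernel: assumes "0 < x" shows "prob_space (K x)"
proof (rule prob_spaceI)
  have "{0<..} \<in> sets pos_borel" by (simp add: sets_pos_borel_iff)
  then show "emeasure (K x) (space (K x)) = 1"
    by (simp add: space_kernel emeasure_kernel assms k_space)
qed

lemma kernel_meas: "K \<in> pos_borel \<rightarrow>\<^sub>M prob_algebra pos_borel"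
proof (rule measurable_prob_algebraI)
  show "prob_space (K x)" if "x \<in> space pos_borel" for x using that prob_kernel by simp
  show "K \<in> pos_borel \<rightarrow>\<^sub>M subprob_algebra pos_borel"
  proof (rule measurable_subprob_algebra)
    show "subprob_space (K x)" if "x \<in> space pos_borel" for x
      using that prob_kernel[of x] by (simp add: prob_space_imp_subprob_space)
    fix B assume B: "B \<in> sets pos_borel"
    have "k B \<in> borel_measurable pos_borel"
      unfolding pos_borel_def using B by (intro measurable_restrict_space1 k_meas) (simp add: sets_pos_borel_iff)
    then have "(\<lambda>x. ennreal (k B x)) \<in> borel_measurable pos_borel" by measurable
    then show "(\<lambda>x. emeasure (K x) B) \<in> borel_measurable pos_borel"
      by (rule measurable_cong[THEN iffD1, rotated]) (simp add: emeasure_kernel B)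
  qed (rule sets_kernel)
qed

lemma kernel_mean: assumes x: "0 < x" shows "(\<integral>\<^sup>+y. ennreal y \<partial>K x) = ennreal x"
proof (cases "c \<le> x")
  case True
  have "(\<lambda>y. ennreal y) \<in> borel_measurable pos_borel"
    unfolding pos_borel_def by (rule measurable_restrict_space1) simp
  then show ?thesis using True x by (simp add: right_kernel_def nn_integral_return)
next
  case False
  then have xc: "x < c" by simp
  let ?a = "ru x" and ?b = "rd x"
  have ab: "?b < x" "x < ?a" "0 < ?b" "?b \<noteq> ?a"
    using Rd_less[OF x xc] less_Ru[OF x xc] x xc rd_pos[of x] by (auto simp: rd_eq ru_eq)
  have S: "{?a} \<in> sets pos_borel" "{?b} \<in> sets pos_borel" "{0<..} - {?a, ?b} \<in> sets pos_borel"
    using ab x by (auto simp: sets_pos_borel_iff)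
  have "k ({0<..} - {?a, ?b}) x = 0" using False by (simp add: k_def)
  then have "{0<..} - {?a, ?b} \<in> null_sets (K x)"
    by (intro null_setsI) (simp_all add: emeasure_kernel[OF x S(3)] sets_kernel S)
  then have "AE y in K x. y \<notin> {0<..} - {?a, ?b}" by (rule AE_not_in)
  then have "AE y in K x. ennreal y = ennreal ?a * indicator {?a} y + ennreal ?b * indicator {?b} y"
    using AE_space
  proof eventually_elim
    case (elim y)
    then have "y = ?a \<or> y = ?b" unfolding space_kernel by blast
    then show ?case using ab(4) by auto
  qed
  then have "(\<integral>\<^sup>+y. ennreal y \<partial>K x) = (\<integral>\<^sup>+y. ennreal ?a * indicator {?a} y + ennreal ?b * indicator {?b} y \<partial>K x)"
    by (rule nn_integral_cong_AE)
  also have "\<dots> = ennreal ?a * emeasure (K x) {?a} + ennreal ?b * emeasure (K x) {?b}"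
  proof -
    have S': "{?a} \<in> sets (K x)" "{?b} \<in> sets (K x)" using S by (simp_all add: sets_kernel)
    have "(\<lambda>y. ennreal ?a * indicator {?a} y) \<in> borel_measurable (K x)"
      "(\<lambda>y. ennreal ?b * indicator {?b} y) \<in> borel_measurable (K x)"
      by (intro borel_measurable_times_ennreal borel_measurable_const borel_measurable_indicator S')+
    then show ?thesis by (simp add: nn_integral_add nn_integral_cmult_indicator S')
  qed
  also have "\<dots> = ennreal ?a * ennreal (q x) + ennreal ?b * ennreal (1 - q x)"
    unfolding q_eq'(2)[OF x xc] unfolding q_eq'(1)[OF x xc]
    using False ab(4) by (simp add: emeasure_kernel[OF x] S k_def)
  also have "\<dots> = ennreal (?a * q x + ?b * (1 - q x))"
    using q_bounds[OF x xc] ab by (simp add: ennreal_mult ennreal_plus)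
  also have "?a * q x + ?b * (1 - q x) = x"
  proof -
    have "w x * (?a * q x + ?b * (1 - q x)) = ?a * (x - ?b) + ?b * (?a - x)"
      unfolding q_eq'(2)[OF x xc] unfolding q_eq'(1)[OF x xc]
      using w_pos[OF x xc] by (simp add: distrib_left)
    also have "\<dots> = w x * x" by (simp add: w_def algebra_simps)
    finally show ?thesis using w_pos[OF x xc] by simp
  qed
  finally show ?thesis .
qed

text \<open>An indicator of \<open>B\<close> is, given \<open>T y\<close>, an affine function of \<open>y\<close>, because \<open>y\<close> then takes only two
  values. The terms are arranged so that no subtraction occurs.\<close>

lemma affine_T:
  assumes y: "0 < y"
  shows "indicator B y * w (T y) + rd (T y) * indicator B (ru (T y)) + y * indicator B (rd (T y)) =
    ru (T y) * indicator B (rd (T y)) + y * (indicator B (ru (T y)) :: real)"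
proof -
  have T: "0 < T y" "T y \<le> c" using T_range[OF y] by auto
  have "y = rd (T y) \<or> y = ru (T y)"
    using T_endpoint[OF y] by (simp only: rd_eq[OF T] ru_eq[OF T])
  then show ?thesis
  proof
    assume "y = rd (T y)"
    then have "indicator B y = (indicator B (rd (T y)) :: real)" by simp
    then show ?thesis using \<open>y = rd (T y)\<close> by (simp add: w_def algebra_simps)
  next
    assume "y = ru (T y)"
    then have "indicator B y = (indicator B (ru (T y)) :: real)" by simp
    then show ?thesis using \<open>y = ru (T y)\<close> by (simp add: w_def algebra_simps)
  qed
qed

text \<open>The relation of \<open>affine_T\<close> with \<open>k B x\<close> in place of the
  indicator. Below c it is the definition of \<open>k\<close> after clearing \<open>w\<close>; at c
  the branches coincide and \<open>w\<close> vanishes; above c it is \<open>affine_T\<close>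
  itself.\<close>

lemma affine_Z:
  assumes x: "0 < x"
  shows "k B x * w (Z x) + rd (Z x) * indicator B (ru (Z x)) + x * indicator B (rd (Z x)) =
    ru (Z x) * indicator B (rd (Z x)) + x * (indicator B (ru (Z x)) :: real)"
proof -
  consider "x < c" | "x = c" | "c < x" by linarith
  then show ?thesis
  proof cases
    case 1
    then have "k B x * w x = (x - rd x) * indicator B (ru x) + (ru x - x) * indicator B (rd x)"
      using w_pos[OF x 1] by (simp add: k_def distrib_right)
    then show ?thesis using 1 by (simp add: Z_def algebra_simps)
  next
    case 2
    then show ?thesis by (simp add: Z_def rd_def ru_def w_def)
  next
    case 3
    then have "Z x = T x" "k B x = indicator B x" by (simp_all add: Z_def k_def)
    then show ?thesis using affine_T[OF x, of B] by simp
  qed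
qed

text \<open>Weighted by \<open>w\<close>, the indicator of B under \<nu> and \<open>k B\<close>
  under \<mu> satisfy the same affine relation, whose other terms are functions of the starting
  point and their products with y. \<open>T_mean\<close> identifies the integrals of those
  terms.\<close>

lemma kernel_transport:
  assumes B: "B \<in> sets pos_borel"
  shows "emeasure \<nu> B = (\<integral>\<^sup>+x. emeasure (K x) B \<partial>\<mu>)"
proof -
  have B': "B \<in> sets borel" using B by (simp add: sets_pos_borel_iff)
  note [measurable] = B' k_meas[OF B']
  have T[measurable]: "T \<in> borel_measurable \<nu>" using T_meas measurable_cong_sets[OF nu.sets_M0 refl] by blast
  have Z[measurable]: "Z \<in> borel_measurable \<mu>" using Z_meas measurable_cong_sets[OF mu.sets_M0 refl] by blast
  have kM[measurable]: "k B \<in> borel_measurable \<mu>" by (intro mu.F.borel_measurable_M k_meas B')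
  have iM[measurable]: "indicator B \<in> borel_measurable \<nu>" "(\<lambda>x. x) \<in> borel_measurable \<nu>" "(\<lambda>x. x) \<in> borel_measurable \<mu>"
    using B' by (intro nu.F.borel_measurable_M mu.F.borel_measurable_M; simp)+
  \<comment> \<open>Both weighted measures are pushed to the starting points, so that the factor 1 /
    w can be integrated against them at the end.\<close>
  define \<sigma>1 where "\<sigma>1 = distr (density \<nu> (\<lambda>y. ennreal (indicator B y * w (T y)))) borel T"
  define \<sigma>2 where "\<sigma>2 = distr (density \<mu> (\<lambda>x. ennreal (k B x * w (Z x)))) borel Z"
  have "\<sigma>1 = \<sigma>2"
  proof (rule measure_eqI)
    fix D assume "D \<in> sets \<sigma>1"
    then have D[measurable]: "D \<in> sets borel" by (simp add: \<sigma>1_def)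
    let ?i = "\<lambda>t. indicator D t :: real"
    let ?P1 = "\<lambda>t. ennreal (rd t * indicator B (ru t) * ?i t)" and ?P2 = "\<lambda>t. ennreal (indicator B (rd t) * ?i t)"
    let ?R1 = "\<lambda>t. ennreal (ru t * indicator B (rd t) * ?i t)" and ?R2 = "\<lambda>t. ennreal (indicator B (ru t) * ?i t)"
    have pm: "?P1 \<in> borel_measurable borel" "?P2 \<in> borel_measurable borel"
      "?R1 \<in> borel_measurable borel" "?R2 \<in> borel_measurable borel" by measurable
    \<comment> \<open>The remaining terms of the affine relation, restricted to starting points in
      D: the weighted integral plus P is R on either side. P and R are the same for \<open>Z\<close>
      under \<mu> and \<open>T\<close> under \<nu>.\<close>
    define P where "P = (\<integral>\<^sup>+x. ?P1 (Z x) \<partial>\<mu>) + (\<integral>\<^sup>+x. ennreal x * ?P2 (Z x) \<partial>\<mu>)"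
    define R where "R = (\<integral>\<^sup>+x. ?R1 (Z x) \<partial>\<mu>) + (\<integral>\<^sup>+x. ennreal x * ?R2 (Z x) \<partial>\<mu>)"
    have P_nu: "P = (\<integral>\<^sup>+y. ?P1 (T y) \<partial>\<nu>) + (\<integral>\<^sup>+y. ennreal y * ?P2 (T y) \<partial>\<nu>)"
      unfolding P_def T_mean[OF pm(1)] T_mean[OF pm(2)] ..
    have R_nu: "R = (\<integral>\<^sup>+y. ?R1 (T y) \<partial>\<nu>) + (\<integral>\<^sup>+y. ennreal y * ?R2 (T y) \<partial>\<nu>)"
      unfolding R_def T_mean[OF pm(3)] T_mean[OF pm(4)] ..
    \<comment> \<open>Needed to cancel P in \<open>ennreal\<close>. One term is bounded by c, the
      other by the mean of \<mu>.\<close>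
    have P_fin: "P \<noteq> \<top>"
    proof -
      have "(\<integral>\<^sup>+x. ?P1 (Z x) \<partial>\<mu>) \<le> (\<integral>\<^sup>+x. ennreal c \<partial>\<mu>)"
        using rd_le_c rd_pos c_pos by (intro nn_integral_mono ennreal_leI) (auto simp: indicator_def)
      also have "\<dots> < \<top>" by (simp add: mu.F.emeasure_space_1[simplified] ennreal_mult_less_top)
      finally have 1: "(\<integral>\<^sup>+x. ?P1 (Z x) \<partial>\<mu>) < \<top>" .
      have "(\<integral>\<^sup>+x. ennreal x * ?P2 (Z x) \<partial>\<mu>) \<le> (\<integral>\<^sup>+x. ennreal x \<partial>\<mu>)"
        by (intro nn_integral_mono) (auto simp: indicator_def)
      also have "\<dots> < \<top>"
        using mu.integrable_id mu.integral_id by (subst nn_integral_eq_integral) (auto intro: AE_I2)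
      finally show ?thesis using 1 by (simp add: P_def less_top)
    qed
    have cancel: "X = Y" if "X + P = Y + P" for X Y :: ennreal
      using ennreal_add_left_cancel[of P X Y] that P_fin
      by (simp only: add.commute[of P] infinity_ennreal_def simp_thms)
    have nu: "(\<integral>\<^sup>+y. ennreal (indicator B y * w (T y) * ?i (T y)) \<partial>\<nu>) + P = R"
    proof -
      have "(\<integral>\<^sup>+y. ennreal (indicator B y * w (T y) * ?i (T y)) \<partial>\<nu>) + P =
        (\<integral>\<^sup>+y. ennreal (indicator B y * w (T y) * ?i (T y)) + (?P1 (T y) + ennreal y * ?P2 (T y)) \<partial>\<nu>)"
      proof -
        have "(\<lambda>y. ennreal (indicator B y * w (T y) * ?i (T y))) \<in> borel_measurable \<nu>"
          "(\<lambda>y. ?P1 (T y)) \<in> borel_measurable \<nu>" "(\<lambda>y. ennreal y * ?P2 (T y)) \<in> borel_measurable \<nu>"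
          by measurable
        then show ?thesis unfolding P_nu by (simp only: nn_integral_add borel_measurable_add)
      qed
      also have "\<dots> = (\<integral>\<^sup>+y. ?R1 (T y) + ennreal y * ?R2 (T y) \<partial>\<nu>)"
      proof (rule nn_integral_cong)
        fix y assume "y \<in> space \<nu>"
        then have y: "0 < y" by simp
        have "ennreal (indicator B y * w (T y) * ?i (T y)) + (?P1 (T y) + ennreal y * ?P2 (T y)) =
          ennreal ((indicator B y * w (T y) + rd (T y) * indicator B (ru (T y)) + y * indicator B (rd (T y))) * ?i (T y))"
          using y w_nonneg[of "T y"] rd_pos[of "T y"]
          by (simp add: ennreal_mult[symmetric] ennreal_plus[symmetric] algebra_simps del: ennreal_plus)
        also have "\<dots> = ?R1 (T y) + ennreal y * ?R2 (T y)"
          unfolding affine_T[OF y] using y ru_pos[of "T y"]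
          by (simp add: ennreal_mult[symmetric] ennreal_plus[symmetric] algebra_simps del: ennreal_plus)
        finally show "ennreal (indicator B y * w (T y) * ?i (T y)) + (?P1 (T y) + ennreal y * ?P2 (T y)) =
          ?R1 (T y) + ennreal y * ?R2 (T y)" .
      qed
      also have "\<dots> = R" unfolding R_nu by (rule nn_integral_add) measurable
      finally show ?thesis .
    qed
    have mu: "(\<integral>\<^sup>+y. ennreal (k B y * w (Z y) * ?i (Z y)) \<partial>\<mu>) + P = R"
    proof -
      have "(\<integral>\<^sup>+y. ennreal (k B y * w (Z y) * ?i (Z y)) \<partial>\<mu>) + P =
        (\<integral>\<^sup>+y. ennreal (k B y * w (Z y) * ?i (Z y)) + (?P1 (Z y) + ennreal y * ?P2 (Z y)) \<partial>\<mu>)"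
      proof -
        have "(\<lambda>y. ennreal (k B y * w (Z y) * ?i (Z y))) \<in> borel_measurable \<mu>"
          "(\<lambda>y. ?P1 (Z y)) \<in> borel_measurable \<mu>" "(\<lambda>y. ennreal y * ?P2 (Z y)) \<in> borel_measurable \<mu>"
          by measurable
        then show ?thesis unfolding P_def by (simp only: nn_integral_add borel_measurable_add)
      qed
      also have "\<dots> = (\<integral>\<^sup>+y. ?R1 (Z y) + ennreal y * ?R2 (Z y) \<partial>\<mu>)"
      proof (rule nn_integral_cong)
        fix y assume "y \<in> space \<mu>"
        then have y: "0 < y" by simp
        have "ennreal (k B y * w (Z y) * ?i (Z y)) + (?P1 (Z y) + ennreal y * ?P2 (Z y)) =
          ennreal ((k B y * w (Z y) + rd (Z y) * indicator B (ru (Z y)) + y * indicator B (rd (Z y))) * ?i (Z y))"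
          using y w_nonneg[of "Z y"] rd_pos[of "Z y"] k_nonneg[OF y, of B]
          by (simp add: ennreal_mult[symmetric] ennreal_plus[symmetric] algebra_simps del: ennreal_plus)
        also have "\<dots> = ?R1 (Z y) + ennreal y * ?R2 (Z y)"
          unfolding affine_Z[OF y] using y ru_pos[of "Z y"]
          by (simp add: ennreal_mult[symmetric] ennreal_plus[symmetric] algebra_simps del: ennreal_plus)
        finally show "ennreal (k B y * w (Z y) * ?i (Z y)) + (?P1 (Z y) + ennreal y * ?P2 (Z y)) =
          ?R1 (Z y) + ennreal y * ?R2 (Z y)" .
      qed
      also have "\<dots> = R" unfolding R_def by (rule nn_integral_add) measurable
      finally show ?thesis .
    qed
    have "(\<integral>\<^sup>+y. ennreal (indicator B y * w (T y) * ?i (T y)) \<partial>\<nu>) =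
      (\<integral>\<^sup>+y. ennreal (k B y * w (Z y) * ?i (Z y)) \<partial>\<mu>)"
      by (rule cancel) (simp only: nu mu)
    moreover have "emeasure \<sigma>1 D = (\<integral>\<^sup>+y. ennreal (indicator B y * w (T y) * ?i (T y)) \<partial>\<nu>)"
    proof -
      have TD: "T -` D \<inter> space \<nu> \<in> sets \<nu>" by measurable
      have "emeasure \<sigma>1 D = (\<integral>\<^sup>+y. ennreal (indicator B y * w (T y)) * indicator (T -` D \<inter> space \<nu>) y \<partial>\<nu>)"
        unfolding \<sigma>1_def by (subst emeasure_distr) (use TD in \<open>auto intro!: emeasure_density\<close>)
      also have "\<dots> = (\<integral>\<^sup>+y. ennreal (indicator B y * w (T y) * ?i (T y)) \<partial>\<nu>)"
        by (intro nn_integral_cong) (simp add: indicator_def)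
      finally show ?thesis .
    qed
    moreover have "emeasure \<sigma>2 D = (\<integral>\<^sup>+y. ennreal (k B y * w (Z y) * ?i (Z y)) \<partial>\<mu>)"
    proof -
      have ZD: "Z -` D \<inter> space \<mu> \<in> sets \<mu>" by measurable
      have "emeasure \<sigma>2 D = (\<integral>\<^sup>+y. ennreal (k B y * w (Z y)) * indicator (Z -` D \<inter> space \<mu>) y \<partial>\<mu>)"
        unfolding \<sigma>2_def by (subst emeasure_distr) (use ZD in \<open>auto intro!: emeasure_density\<close>)
      also have "\<dots> = (\<integral>\<^sup>+y. ennreal (k B y * w (Z y) * ?i (Z y)) \<partial>\<mu>)"
        by (intro nn_integral_cong) (simp add: indicator_def)
      finally show ?thesis .
    qed
    ultimately show "emeasure \<sigma>1 D = emeasure \<sigma>2 D" by simp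
  qed (simp add: \<sigma>1_def \<sigma>2_def)
  then have eq: "(\<integral>\<^sup>+t. ennreal (1 / w t) \<partial>\<sigma>1) = (\<integral>\<^sup>+t. ennreal (1 / w t) \<partial>\<sigma>2)" by simp
  have wc: "ennreal (a * w t) * ennreal (1 / w t) = ennreal a" if "0 \<le> a" "0 < w t" for a t
    using that by (simp add: ennreal_mult[symmetric])
  \<comment> \<open>On (0, c] the weight \<open>w\<close> vanishes only at c, and T y = c or Z y = c
    only for y = c, a null set for both laws.\<close>
  have ae_nu: "AE y in \<nu>. y \<noteq> c" and ae_mu: "AE x in \<mu>. x \<noteq> c"
    using AE_not_in[OF null_setsI[OF nu.F.null_singleton]] AE_not_in[OF null_setsI[OF mu.F.null_singleton]]
      c_pos by (auto simp: nu.F.sets_M_iff mu.F.sets_M_iff)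
  have "(\<integral>\<^sup>+t. ennreal (1 / w t) \<partial>\<sigma>1) = (\<integral>\<^sup>+y. ennreal (indicator B y * w (T y)) * ennreal (1 / w (T y)) \<partial>\<nu>)"
  proof -
    have w': "(\<lambda>t. ennreal (1 / w t)) \<in> borel_measurable (distr M borel f)" for M :: "real measure" and f
      unfolding measurable_distr_eq1 by measurable
    have m: "(\<lambda>y. ennreal (indicator B y * w (T y))) \<in> borel_measurable \<nu>"
      "(\<lambda>y. ennreal (1 / w (T y))) \<in> borel_measurable \<nu>" by measurable
    have T': "T \<in> density \<nu> (\<lambda>y. ennreal (indicator B y * w (T y))) \<rightarrow>\<^sub>M borel"
      using T by simp
    show ?thesis unfolding \<sigma>1_def nn_integral_distr[OF T' w'] nn_integral_density[OF m] ..
  qed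
  also have "\<dots> = (\<integral>\<^sup>+y. ennreal (indicator B y) \<partial>\<nu>)"
  proof (rule nn_integral_cong_AE)
    show "AE y in \<nu>. ennreal (indicator B y * w (T y)) * ennreal (1 / w (T y)) = ennreal (indicator B y)"
      using ae_nu AE_space
    proof eventually_elim
      case (elim y)
      have y: "0 < y" using elim(2) by simp
      have "T y \<noteq> c" using T_eq_c[OF y] elim(1) by simp
      then have "T y < c" using T_range(2)[OF y] by (simp add: less_le)
      then have "0 < w (T y)" by (rule w_pos[OF T_range(1)[OF y]])
      then show ?case by (intro wc) simp
    qed
  qed
  also have "\<dots> = emeasure \<nu> B" using B by (simp add: ennreal_indicator nu.sets_M0)
  finally have 1: "(\<integral>\<^sup>+t. ennreal (1 / w t) \<partial>\<sigma>1) = emeasure \<nu> B" .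
  have "(\<integral>\<^sup>+t. ennreal (1 / w t) \<partial>\<sigma>2) = (\<integral>\<^sup>+y. ennreal (k B y * w (Z y)) * ennreal (1 / w (Z y)) \<partial>\<mu>)"
  proof -
    have w': "(\<lambda>t. ennreal (1 / w t)) \<in> borel_measurable (distr M borel f)" for M :: "real measure" and f
      unfolding measurable_distr_eq1 by measurable
    have m: "(\<lambda>y. ennreal (k B y * w (Z y))) \<in> borel_measurable \<mu>"
      "(\<lambda>y. ennreal (1 / w (Z y))) \<in> borel_measurable \<mu>" by measurable
    have Z': "Z \<in> density \<mu> (\<lambda>y. ennreal (k B y * w (Z y))) \<rightarrow>\<^sub>M borel"
      using Z by simp
    show ?thesis unfolding \<sigma>2_def nn_integral_distr[OF Z' w'] nn_integral_density[OF m] ..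
  qed
  also have "\<dots> = (\<integral>\<^sup>+x. emeasure (K x) B \<partial>\<mu>)"
  proof (rule nn_integral_cong_AE)
    show "AE y in \<mu>. ennreal (k B y * w (Z y)) * ennreal (1 / w (Z y)) = emeasure (K y) B"
      using ae_mu AE_space
    proof eventually_elim
      case (elim y)
      have y: "0 < y" using elim(2) by simp
      have "Z y \<noteq> c" using T_eq_c[OF y] elim(1) by (simp add: Z_def)
      then have "Z y < c" using Z_le[OF y] by (simp add: less_le)
      then have "0 < w (Z y)" by (rule w_pos[OF Z_pos[OF y]])
      then show ?case using k_nonneg[OF y] by (simp add: wc emeasure_kernel[OF y B])
    qed
  qed
  finally show ?thesis using 1 eq by simp
qed

end

section \<open>The semidirect product as a coupling\<close>

context right_plan
begin

abbreviation PQ :: "(real \<times> real) measure" where "PQ \<equiv> semidirect \<mu> K"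

lemma fiber_meas:
  "(\<lambda>x. distr (K x) (pos_borel \<Otimes>\<^sub>M pos_borel) (\<lambda>y. (x, y))) \<in> \<mu> \<rightarrow>\<^sub>M subprob_algebra (pos_borel \<Otimes>\<^sub>M pos_borel)"
proof (rule measurable_distr2[where M = pos_borel])
  have "K \<in> pos_borel \<rightarrow>\<^sub>M subprob_algebra pos_borel"
    using kernel_meas by (rule measurable_prob_algebraD)
  then show "K \<in> \<mu> \<rightarrow>\<^sub>M subprob_algebra pos_borel"
    unfolding measurable_cong_sets[OF mu.sets_M0 refl] .
  have "(\<lambda>z. z) \<in> \<mu> \<Otimes>\<^sub>M pos_borel \<rightarrow>\<^sub>M pos_borel \<Otimes>\<^sub>M pos_borel"
    by (rule measurable_ident_sets) (rule sets_pair_measure_cong[OF mu.sets_M0 refl])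
  then show "(\<lambda>(x, y). (x, y)) \<in> \<mu> \<Otimes>\<^sub>M pos_borel \<rightarrow>\<^sub>M pos_borel \<Otimes>\<^sub>M pos_borel"
    by (simp add: case_prod_beta)
qed

lemma sets_PQ: "sets PQ = sets (pos_borel \<Otimes>\<^sub>M pos_borel)"
  unfolding semidirect_def by (rule sets_bind) (use c_pos in auto)

lemma space_PQ: "space PQ = {0<..} \<times> {0<..}"
  using sets_eq_imp_space_eq[OF sets_PQ] by (simp add: space_pair_measure)

lemma pair_meas: "0 < x \<Longrightarrow> (\<lambda>y. (x, y)) \<in> K x \<rightarrow>\<^sub>M pos_borel \<Otimes>\<^sub>M pos_borel"
  unfolding measurable_cong_sets[OF sets_kernel refl] by (rule measurable_Pair1') simp

lemma nn_integral_PQ: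
  assumes f: "f \<in> borel_measurable (pos_borel \<Otimes>\<^sub>M pos_borel)"
  shows "(\<integral>\<^sup>+\<omega>. f \<omega> \<partial>PQ) = (\<integral>\<^sup>+x. \<integral>\<^sup>+y. f (x, y) \<partial>K x \<partial>\<mu>)"
proof -
  have "(\<integral>\<^sup>+\<omega>. f \<omega> \<partial>PQ) =
      (\<integral>\<^sup>+x. \<integral>\<^sup>+\<omega>. f \<omega> \<partial>distr (K x) (pos_borel \<Otimes>\<^sub>M pos_borel) (\<lambda>y. (x, y)) \<partial>\<mu>)"
    unfolding semidirect_def by (rule nn_integral_bind[OF f fiber_meas])
  also have "\<dots> = (\<integral>\<^sup>+x. \<integral>\<^sup>+y. f (x, y) \<partial>K x \<partial>\<mu>)"
  proof (rule nn_integral_cong)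
    fix x assume "x \<in> space \<mu>"
    then have x: "0 < x" by simp
    show "(\<integral>\<^sup>+\<omega>. f \<omega> \<partial>distr (K x) (pos_borel \<Otimes>\<^sub>M pos_borel) (\<lambda>y. (x, y))) = (\<integral>\<^sup>+y. f (x, y) \<partial>K x)"
      by (rule nn_integral_distr[OF pair_meas[OF x]]) (simp add: f)
  qed
  finally show ?thesis .
qed

lemma emeasure_PQ:
  assumes A: "A \<in> sets (pos_borel \<Otimes>\<^sub>M pos_borel)"
  shows "emeasure PQ A = (\<integral>\<^sup>+x. emeasure (K x) {y \<in> {0<..}. (x, y) \<in> A} \<partial>\<mu>)"
proof -
  have "emeasure PQ A = (\<integral>\<^sup>+x. emeasure (distr (K x) (pos_borel \<Otimes>\<^sub>M pos_borel) (\<lambda>y. (x, y))) A \<partial>\<mu>)"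
    unfolding semidirect_def by (rule emeasure_bind[OF _ fiber_meas A]) (use c_pos in auto)
  also have "\<dots> = (\<integral>\<^sup>+x. emeasure (K x) {y \<in> {0<..}. (x, y) \<in> A} \<partial>\<mu>)"
  proof (rule nn_integral_cong)
    fix x assume "x \<in> space \<mu>"
    then have x: "0 < x" by simp
    have "(\<lambda>y. (x, y)) -` A \<inter> space (K x) = {y \<in> {0<..}. (x, y) \<in> A}"
      unfolding space_kernel by blast
    then show "emeasure (distr (K x) (pos_borel \<Otimes>\<^sub>M pos_borel) (\<lambda>y. (x, y))) A = emeasure (K x) {y \<in> {0<..}. (x, y) \<in> A}"
      by (simp only: emeasure_distr[OF pair_meas[OF x] A])
  qed
  finally show ?thesis .
qed

lemma pos_borel_top: "{0<..} \<in> sets pos_borel" by (simp add: sets_pos_borel_iff)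

lemma distr_fst_PQ: "distr PQ pos_borel fst = \<mu>"
proof (rule measure_eqI)
  fix A assume "A \<in> sets (distr PQ pos_borel fst)"
  then have A: "A \<in> sets pos_borel" by simp
  have fm: "fst \<in> PQ \<rightarrow>\<^sub>M pos_borel"
    unfolding measurable_cong_sets[OF sets_PQ refl] by (rule measurable_fst)
  have Ap: "A \<subseteq> {0<..}" using A by (simp add: sets_pos_borel_iff)
  have v: "fst -` A \<inter> space PQ = A \<times> {0<..}" unfolding space_PQ using Ap by (auto simp: subset_eq)
  have "emeasure (distr PQ pos_borel fst) A = emeasure PQ (A \<times> {0<..})"
    by (simp only: emeasure_distr[OF fm A] v)
  also have "\<dots> = (\<integral>\<^sup>+x. emeasure (K x) {y \<in> {0<..}. (x, y) \<in> A \<times> {0<..}} \<partial>\<mu>)"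
    by (rule emeasure_PQ) (intro pair_measureI A pos_borel_top)
  also have "\<dots> = (\<integral>\<^sup>+x. indicator A x \<partial>\<mu>)"
  proof (rule nn_integral_cong)
    fix x assume "x \<in> space \<mu>"
    then have x: "0 < x" by simp
    have e: "emeasure (K x) {0<..} = 1"
      using prob_space.emeasure_space_1[OF prob_kernel[OF x]] by (simp only: space_kernel)
    show "emeasure (K x) {y \<in> {0<..}. (x, y) \<in> A \<times> {0<..}} = indicator A x"
    proof (cases "x \<in> A")
      case True
      then have s: "{y \<in> {0<..}. (x, y) \<in> A \<times> {0<..}} = {0<..}" by auto
      show ?thesis unfolding s e using True by simp
    next
      case False
      then have s: "{y \<in> {0<..}. (x, y) \<in> A \<times> {0<..}} = {}" by auto
      show ?thesis unfolding s using False by simp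
    qed
  qed
  also have "\<dots> = emeasure \<mu> A" using A by (simp add: mu.sets_M0)
  finally show "emeasure (distr PQ pos_borel fst) A = emeasure \<mu> A" .
qed (simp add: mu.sets_M0)

lemma distr_snd_PQ: "distr PQ pos_borel snd = \<nu>"
proof (rule measure_eqI)
  fix B assume "B \<in> sets (distr PQ pos_borel snd)"
  then have B: "B \<in> sets pos_borel" by simp
  have sm: "snd \<in> PQ \<rightarrow>\<^sub>M pos_borel"
    unfolding measurable_cong_sets[OF sets_PQ refl] by (rule measurable_snd)
  have Bp: "B \<subseteq> {0<..}" using B by (simp add: sets_pos_borel_iff)
  have v: "snd -` B \<inter> space PQ = {0<..} \<times> B" unfolding space_PQ using Bp by (auto simp: subset_eq)
  have "emeasure (distr PQ pos_borel snd) B = emeasure PQ ({0<..} \<times> B)"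
    by (simp only: emeasure_distr[OF sm B] v)
  also have "\<dots> = (\<integral>\<^sup>+x. emeasure (K x) {y \<in> {0<..}. (x, y) \<in> {0<..} \<times> B} \<partial>\<mu>)"
    by (rule emeasure_PQ) (intro pair_measureI B pos_borel_top)
  also have "\<dots> = (\<integral>\<^sup>+x. emeasure (K x) B \<partial>\<mu>)"
  proof (rule nn_integral_cong)
    fix x assume "x \<in> space \<mu>"
    then have x: "0 < x" by simp
    then have "{y \<in> {0<..}. (x, y) \<in> {0<..} \<times> B} = B" using Bp by (auto simp: subset_eq)
    then show "emeasure (K x) {y \<in> {0<..}. (x, y) \<in> {0<..} \<times> B} = emeasure (K x) B" by simp
  qed
  also have "\<dots> = emeasure \<nu> B" using kernel_transport[OF B] by simp
  finally show "emeasure (distr PQ pos_borel snd) B = emeasure \<nu> B" .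
qed (simp add: nu.sets_M0)

lemma prob_PQ: "prob_space PQ"
proof (rule prob_spaceI)
  have fm: "fst \<in> PQ \<rightarrow>\<^sub>M pos_borel"
    unfolding measurable_cong_sets[OF sets_PQ refl] by (rule measurable_fst)
  have "emeasure PQ (space PQ) = emeasure (distr PQ pos_borel fst) (space pos_borel)"
  proof -
    have "fst -` space pos_borel \<inter> space PQ = space PQ" by (auto simp: space_PQ)
    then show ?thesis by (simp only: emeasure_distr[OF fm sets.top])
  qed
  also have "\<dots> = 1" unfolding distr_fst_PQ using mu.F.emeasure_space_1 by simp
  finally show "emeasure PQ (space PQ) = 1" .
qed

lemma PQ_coupling: "PQ \<in> mart_couplings \<mu> \<nu>"
proof -
  interpret PQ: prob_space PQ by (rule prob_PQ)
  have fm: "fst \<in> PQ \<rightarrow>\<^sub>M pos_borel" and sm: "snd \<in> PQ \<rightarrow>\<^sub>M pos_borel"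
    unfolding measurable_cong_sets[OF sets_PQ refl] by (rule measurable_fst, rule measurable_snd)
  have idm: "(\<lambda>x. x) \<in> pos_borel \<rightarrow>\<^sub>M borel"
    unfolding pos_borel_def by (rule measurable_restrict_space1) simp
  have bf: "fst \<in> borel_measurable PQ" and bs: "snd \<in> borel_measurable PQ"
    using measurable_compose[OF fm idm] measurable_compose[OF sm idm] by simp_all
  let ?F = "vimage_algebra (space PQ) fst pos_borel"
  have sub: "subalgebra PQ ?F"
    unfolding subalgebra_def using fm measurable_sets[OF fm]
    by (subst sets_vimage_algebra2) (auto simp: space_PQ)
  interpret S: sigma_finite_subalgebra PQ ?F
    by (intro finite_measure_subalgebra_is_sigma_finite finite_measure_subalgebra.intro
        finite_measure_subalgebra_axioms.intro PQ.finite_measure_axioms sub)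
  have "integrable (distr PQ pos_borel fst) (\<lambda>x. x)" unfolding distr_fst_PQ by (rule mu.integrable_id)
  then have ifst: "integrable PQ fst" by (simp only: integrable_distr_eq[OF fm idm])
  have "integrable (distr PQ pos_borel snd) (\<lambda>x. x)" unfolding distr_snd_PQ by (rule nu.integrable_id)
  then have isnd: "integrable PQ snd" by (simp only: integrable_distr_eq[OF sm idm])
  have "AE \<omega> in PQ. real_cond_exp PQ ?F snd \<omega> = fst \<omega>"
  proof (rule S.real_cond_exp_charact[OF _ isnd ifst])
    show "fst \<in> borel_measurable ?F"
    proof -
      have "fst \<in> ?F \<rightarrow>\<^sub>M pos_borel"
        by (rule measurable_vimage_algebra1) (auto simp: space_PQ)
      from measurable_compose[OF this idm] show ?thesis by simp
    qed
    fix C assume "C \<in> sets ?F"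
    then obtain A where A: "A \<in> sets pos_borel" and C: "C = fst -` A \<inter> space PQ"
      by (subst (asm) sets_vimage_algebra2) (auto simp: space_PQ)
    have Cm: "C \<in> sets PQ" unfolding C using fm A by (rule measurable_sets)
    \<comment> \<open>Both coordinates are positive, so their integrals over C can be computed as
      nonnegative iterated integrals against the kernel.\<close>
    have conv: "(\<integral>\<omega>\<in>C. h \<omega> \<partial>PQ) = enn2real (\<integral>\<^sup>+x. \<integral>\<^sup>+y. indicator A x * ennreal (h (x, y)) \<partial>K x \<partial>\<mu>)"
      if h: "h \<in> borel_measurable PQ" "\<And>x y. 0 < x \<Longrightarrow> 0 < y \<Longrightarrow> 0 \<le> h (x, y)" for h
    proof -
      have g: "(\<lambda>\<omega>. indicator A (fst \<omega>) * ennreal (h \<omega>)) \<in> borel_measurable (pos_borel \<Otimes>\<^sub>M pos_borel)"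
      proof -
        have "h \<in> borel_measurable (pos_borel \<Otimes>\<^sub>M pos_borel)"
          using h(1) unfolding measurable_cong_sets[OF sets_PQ refl] .
        then show ?thesis using A by measurable
      qed
      have "(\<integral>\<omega>\<in>C. h \<omega> \<partial>PQ) = enn2real (\<integral>\<^sup>+\<omega>. ennreal (indicator C \<omega> *\<^sub>R h \<omega>) \<partial>PQ)"
        unfolding set_lebesgue_integral_def
      proof (rule integral_eq_nn_integral)
        show "(\<lambda>\<omega>. indicator C \<omega> *\<^sub>R h \<omega>) \<in> borel_measurable PQ" using h(1) Cm by measurable
        show "AE \<omega> in PQ. 0 \<le> indicator C \<omega> *\<^sub>R h \<omega>"
          by (rule AE_I2) (auto simp: space_PQ intro!: mult_nonneg_nonneg h(2))
      qed
      also have "(\<integral>\<^sup>+\<omega>. ennreal (indicator C \<omega> *\<^sub>R h \<omega>) \<partial>PQ) = (\<integral>\<^sup>+\<omega>. indicator A (fst \<omega>) * ennreal (h \<omega>) \<partial>PQ)"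
        by (intro nn_integral_cong) (simp add: C indicator_def)
      also have "\<dots> = (\<integral>\<^sup>+x. \<integral>\<^sup>+y. indicator A x * ennreal (h (x, y)) \<partial>K x \<partial>\<mu>)"
        by (subst nn_integral_PQ[OF g]) simp
      finally show ?thesis .
    qed
    have "(\<integral>\<^sup>+x. \<integral>\<^sup>+y. indicator A x * ennreal (snd (x, y)) \<partial>K x \<partial>\<mu>) =
        (\<integral>\<^sup>+x. \<integral>\<^sup>+y. indicator A x * ennreal (fst (x, y)) \<partial>K x \<partial>\<mu>)"
    proof (rule nn_integral_cong)
      fix x assume "x \<in> space \<mu>"
      then have x: "0 < x" by simp
      have i: "(\<lambda>y. ennreal y) \<in> borel_measurable (K x)"
        unfolding measurable_cong_sets[OF sets_kernel refl] using idm by measurable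
      have "(\<integral>\<^sup>+y. indicator A x * ennreal y \<partial>K x) = indicator A x * ennreal x"
        by (simp add: nn_integral_cmult[OF i] kernel_mean[OF x])
      also have "\<dots> = (\<integral>\<^sup>+y. indicator A x * ennreal x \<partial>K x)"
        using prob_space.emeasure_space_1[OF prob_kernel[OF x]] by simp
      finally show "(\<integral>\<^sup>+y. indicator A x * ennreal (snd (x, y)) \<partial>K x) = (\<integral>\<^sup>+y. indicator A x * ennreal (fst (x, y)) \<partial>K x)"
        by simp
    qed
    then show "(\<integral>\<omega>\<in>C. snd \<omega> \<partial>PQ) = (\<integral>\<omega>\<in>C. fst \<omega> \<partial>PQ)"
      using conv[OF bs] conv[OF bf] by simp
  qed
  then show ?thesis
    using sets_PQ prob_PQ distr_fst_PQ distr_snd_PQ by (simp add: mart_couplings_def)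
qed

text \<open>For x' < x < c the interval [Rd x', Ru x'] contains [Rd x, Ru x], so an end point of the
  outer interval cannot lie strictly inside the inner one. Over x \<ge> c the fiber is a single
  point and straddles nothing.\<close>

lemma PQ_right_monotone: "right_monotone PQ"
proof -
  define \<Gamma> where "\<Gamma> = {\<omega> \<in> space (pos_borel \<Otimes>\<^sub>M pos_borel). (c \<le> fst \<omega> \<and> snd \<omega> = fst \<omega>) \<or>
    (fst \<omega> < c \<and> (snd \<omega> = rd (fst \<omega>) \<or> snd \<omega> = ru (fst \<omega>)))}"
  have idm: "(\<lambda>x. x) \<in> pos_borel \<rightarrow>\<^sub>M borel"
    unfolding pos_borel_def by (rule measurable_restrict_space1) simp
  have [measurable]: "fst \<in> borel_measurable (pos_borel \<Otimes>\<^sub>M pos_borel)" "snd \<in> borel_measurable (pos_borel \<Otimes>\<^sub>M pos_borel)"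
    using measurable_compose[OF measurable_fst[of pos_borel pos_borel] idm]
      measurable_compose[OF measurable_snd[of pos_borel pos_borel] idm] by simp_all
  have G: "\<Gamma> \<in> sets (pos_borel \<Otimes>\<^sub>M pos_borel)"
    unfolding \<Gamma>_def by measurable
  have fib: "emeasure (K x) {y \<in> {0<..}. (x, y) \<in> \<Gamma>} = 1" if x: "0 < x" for x
  proof -
    have e: "{y \<in> {0<..}. (x, y) \<in> \<Gamma>} = (if c \<le> x then {x} else {rd x, ru x})"
      using x rd_pos[of x] ru_pos[of x] unfolding \<Gamma>_def by (simp add: space_pair_measure) auto
    have m: "(if c \<le> x then {x} else {rd x, ru x}) \<in> sets pos_borel"
      using x rd_pos[of x] ru_pos[of x] by (simp add: sets_pos_borel_iff)
    have "k (if c \<le> x then {x} else {rd x, ru x}) x = 1"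
    proof (cases "c \<le> x")
      case False
      then have xc: "x < c" by simp
      show ?thesis using False q_eq'[OF x xc] by (simp add: k_def)
    qed (simp add: k_def)
    then show ?thesis unfolding e by (simp add: emeasure_kernel[OF x m])
  qed
  have "emeasure PQ \<Gamma> = (\<integral>\<^sup>+x. 1 \<partial>\<mu>)"
    unfolding emeasure_PQ[OF G] by (rule nn_integral_cong) (rule fib, simp)
  also have "\<dots> = 1" using mu.F.emeasure_space_1 by simp
  finally have one: "emeasure PQ \<Gamma> = 1" .
  have "\<not> (x' < x \<and> y1 < y' \<and> y' < y2)"
    if 1: "(x, y1) \<in> \<Gamma>" and 2: "(x, y2) \<in> \<Gamma>" and 3: "(x', y') \<in> \<Gamma>" for x y1 y2 x' y'
  proof
    assume *: "x' < x \<and> y1 < y' \<and> y' < y2"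
    have pos: "0 < x" "0 < x'" using 1 3 unfolding \<Gamma>_def by (simp_all add: space_pair_measure)
    have xc: "x < c"
    proof (rule ccontr)
      assume "\<not> x < c"
      then have "y1 = x" "y2 = x" using 1 2 unfolding \<Gamma>_def by simp_all
      then show False using * by simp
    qed
    have le: "rd x \<le> ru x" using w_nonneg[of x] by (simp add: w_def)
    have b: "rd x \<le> y1" "y2 \<le> ru x"
      using 1 2 xc le unfolding \<Gamma>_def by auto
    have "y' = rd x' \<or> y' = ru x'" using 3 xc * unfolding \<Gamma>_def by auto
    moreover have "rd x' \<le> rd x" "ru x \<le> ru x'"
      using Rd_mono[of x' x] Ru_antimono[of x' x] * xc pos by (simp_all add: rd_eq ru_eq)
    ultimately show False using b * by linarith
  qed
  then show ?thesis unfolding right_monotone_def using G one by blast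
qed

theorem Q_R_eq: "Q_R \<mu> \<nu> = PQ"
  unfolding Q_R_def
proof (rule the_equality)
  show "PQ \<in> mart_couplings \<mu> \<nu> \<and> right_monotone PQ" using PQ_coupling PQ_right_monotone by blast
  show "Q = PQ" if "Q \<in> mart_couplings \<mu> \<nu> \<and> right_monotone Q" for Q
    using that PQ_coupling PQ_right_monotone by (intro right_monotone_unique) auto
qed

end

section \<open>Inversion of the half-line\<close>

context P1d_law
begin

lemma inverse_le_iff: "0 < y \<Longrightarrow> {x \<in> {0<..}. 1 / x \<in> {0<..y}} = {1 / y..}" for y :: real
proof (intro set_eqI)
  fix x :: real assume y: "0 < y"
  have "1 / y > 0" using y by simp
  show "x \<in> {x \<in> {0<..}. 1 / x \<in> {0<..y}} \<longleftrightarrow> x \<in> {1 / y..}"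
  proof
    assume "x \<in> {x \<in> {0<..}. 1 / x \<in> {0<..y}}"
    then have "0 < x" "1 / x \<le> y" by simp_all
    then show "x \<in> {1 / y..}" using y by (simp add: field_simps)
  next
    assume "x \<in> {1 / y..}"
    then have "1 / y \<le> x" by simp
    moreover from this have "0 < x" using \<open>1 / y > 0\<close> by linarith
    ultimately show "x \<in> {x \<in> {0<..}. 1 / x \<in> {0<..y}}" using y by (simp add: field_simps)
  qed
qed

text \<open>\<open>S_transform M\<close> is the image of the size-biased law under inversion, which
  pulls (0, y] back to [1 / y, \<infinity>).\<close>

lemma Fcdf_S_transform: assumes y: "0 < y" shows "Fcdf (S_transform M) y = 1 - Gmom M (1 / y)"
proof -
  have inv: "(\<lambda>x. 1 / x) \<in> size_biased M \<rightarrow>\<^sub>M pos_borel"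
    unfolding measurable_cong_sets[OF G.sets_M refl] pos_borel_def
    by (rule measurable_restrict_space3) auto
  have I: "{0<..y} \<in> sets pos_borel" by (auto simp: sets_pos_borel_iff)
  have "(\<lambda>x. 1 / x) -` {0<..y} \<inter> space (size_biased M) = {x \<in> {0<..}. 1 / x \<in> {0<..y}}"
    unfolding G.space_M by blast
  then have v: "(\<lambda>x. 1 / x) -` {0<..y} \<inter> space (size_biased M) = {1 / y..}"
    unfolding inverse_le_iff[OF y] .
  have "Fcdf (S_transform M) y = measure (size_biased M) {1 / y..}"
    unfolding Fcdf_def S_transform_def size_biased_def[symmetric] measure_distr[OF inv I] v ..
  also have "\<dots> = 1 - Gmom M (1 / y)"
    using G.measure_Ici[of "1 / y"] y by (simp add: Fcdf_size_biased)
  finally show ?thesis .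
qed

text \<open>The size-biasing factor x cancels the integrand 1 / x, leaving the mass of [1 / y,
  \<infinity>).\<close>

lemma Gmom_S_transform: assumes y: "0 < y" shows "Gmom (S_transform M) y = 1 - Fcdf M (1 / y)"
proof -
  have m: "(\<lambda>z. indicator {0<..y} z * z :: real) \<in> borel_measurable pos_borel"
    unfolding pos_borel_def by (rule measurable_restrict_space1) measurable
  have "Gmom (S_transform M) y = (\<integral>x. x * (indicator {0<..y} (1 / x) * (1 / x)) \<partial>M)"
    unfolding Gmom_def set_lebesgue_integral_def using integral_S_transform[OF sets_M0 m] by simp
  also have "\<dots> = (\<integral>x. indicator {1 / y..} x \<partial>M)"
  proof (rule Bochner_Integration.integral_cong)
    fix x assume "x \<in> space M"
    then have x: "0 < x" by simp
    have "1 / x \<in> {0<..y} \<longleftrightarrow> x \<in> {1 / y..}"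
      unfolding inverse_le_iff[OF y, symmetric] using x by simp
    then have "indicator {0<..y} (1 / x) = (indicator {1 / y..} x :: real)" by (simp only: indicator_def)
    then show "x * (indicator {0<..y} (1 / x) * (1 / x)) = indicator {1 / y..} x" using x by simp
  qed simp
  also have "\<dots> = measure M {1 / y..}"
  proof -
    have "{1 / y..} \<inter> space M = {1 / y..}"
      unfolding inverse_le_iff[OF y, symmetric] F.space_M by blast
    then show ?thesis by (simp only: Bochner_Integration.integral_indicator)
  qed
  also have "\<dots> = 1 - Fcdf M (1 / y)" using F.measure_Ici[of "1 / y"] y by simp
  finally show ?thesis .
qed

text \<open>Makes \<open>the_inv_into\<close> in the left characteristics a true inverse on the
  image.\<close>

lemma inj_on_S_transform:
  "inj_on (Fcdf (S_transform M)) {0<..}" "inj_on (Gmom (S_transform M)) {0<..}"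
proof -
  have less: "1 / v < 1 / u" "0 \<le> 1 / v" if "0 < u" "u < v" for u v :: real
    using that by (simp_all add: field_simps)
  have "Fcdf (S_transform M) u < Fcdf (S_transform M) v" if "0 < u" "u < v" for u v
    using Gmom_strict_mono[of "1 / v" "1 / u"] less[OF that] that by (simp add: Fcdf_S_transform)
  then have "strict_mono_on {0<..} (Fcdf (S_transform M))" by (intro strict_mono_onI) simp
  then show "inj_on (Fcdf (S_transform M)) {0<..}" by (rule strict_mono_on_imp_inj_on)
  have "Gmom (S_transform M) u < Gmom (S_transform M) v" if "0 < u" "u < v" for u v
    using Fcdf_strict_mono[of "1 / v" "1 / u"] less[OF that] that by (simp add: Gmom_S_transform)
  then have "strict_mono_on {0<..} (Gmom (S_transform M))" by (intro strict_mono_onI) simp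
  then show "inj_on (Gmom (S_transform M)) {0<..}" by (rule strict_mono_on_imp_inj_on)
qed

end

context P1d_pair
begin

lemma deltaF_S_transform: "0 < y \<Longrightarrow> deltaF (S_transform \<mu>) (S_transform \<nu>) y = - deltaG \<mu> \<nu> (1 / y)"
  by (simp add: deltaF_def deltaG_def mu.Fcdf_S_transform nu.Fcdf_S_transform)

lemma deltaG_S_transform: "0 < y \<Longrightarrow> deltaG (S_transform \<mu>) (S_transform \<nu>) y = - deltaF \<mu> \<nu> (1 / y)"
  by (simp add: deltaF_def deltaG_def mu.Gmom_S_transform nu.Gmom_S_transform)

end

text \<open>The function to maximize is - \<delta>G (1 / y), and c minimizes \<delta>G on (m,
  \<infinity>), whose image under inversion is the neighbourhood (0, 1 / m) of 1 / c.\<close>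

lemma (in unimodal_pair) left_maximizer:
  assumes "single_local_maximizer (deltaF (S_transform \<mu>) (S_transform \<nu>)) xS"
  shows "xS = 1 / c"
proof -
  let ?f = "deltaF (S_transform \<mu>) (S_transform \<nu>)"
  have ev: "\<forall>\<^sub>F y in nhds (1 / c). y \<in> {0<..<1 / m}"
    using m_pos m_less_c by (intro eventually_nhds_in_open) (auto simp: field_simps)
  have "\<forall>\<^sub>F y in nhds (1 / c). ?f y \<le> ?f (1 / c)"
    using ev
  proof eventually_elim
    case (elim y)
    then have y: "0 < y" "m < 1 / y" using m_pos by (simp_all add: field_simps)
    then show ?case using deltaG_min[OF y(2)] c_pos by (simp add: deltaF_S_transform)
  qed
  then have "local_maximizer ?f (1 / c)" using c_pos by (simp add: local_maximizer_def)
  then show ?thesis using assms by (simp add: single_local_maximizer_def)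
qed

theorem mainTheorem4:
  fixes \<mu> \<nu> :: "real measure"
    and xS :: real and LdS LuS qS :: "real \<Rightarrow> real"
  assumes "\<mu> \<in> P1d" and "\<nu> \<in> P1d" and "\<mu> \<preceq>\<^sub>c \<nu>"
    and "\<exists>x. single_local_maximizer (deltaF \<mu> \<nu>) x"
    and "left_characteristics (S_transform \<mu>) (S_transform \<nu>) xS LdS LuS qS"
  shows "let xR = 1 / xS;
             Rd = (\<lambda>x. 1 / LuS (1 / x));
             Ru = (\<lambda>x. 1 / LdS (1 / x));
             qR = (\<lambda>x. x / Ru x * (1 - qS (1 / x)))
         in (\<forall>y. is_arg_min (deltaF \<mu> \<nu>) (\<lambda>x. 0 < x) y \<longleftrightarrow> y = xR) \<and>
            right_kernel xR qR Ru Rd \<in> pos_borel \<rightarrow>\<^sub>M prob_algebra pos_borel \<and>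
            Q_R \<mu> \<nu> = semidirect \<mu> (right_kernel xR qR Ru Rd)"
proof -
  interpret P1d_pair \<mu> \<nu> by (rule P1d_pairI) fact+
  obtain m where "single_local_maximizer \<delta> m" using assms(4) by blast
  then obtain c where "unimodal_pair \<mu> \<nu> m c" by (rule unimodal)
  then interpret unimodal_pair \<mu> \<nu> m c .
  note L = assms(5)[unfolded left_characteristics_def]
  have xS: "xS = 1 / c" using left_maximizer L by blast
  have xS_pos: "0 < xS" and xR: "1 / xS = c" using c_pos xS by simp_all
  have Lcont: "continuous_on {0<..} LdS" "continuous_on {0<..} LuS"
    and Lpos: "\<And>x. 0 < x \<Longrightarrow> 0 < LdS x" "\<And>x. 0 < x \<Longrightarrow> 0 < LuS x"
    and Lx: "LdS xS = xS" "LuS xS = xS"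
    and Lless: "\<And>x. xS < x \<Longrightarrow> LdS x < x" "\<And>x. xS < x \<Longrightarrow> x < LuS x"
    using L xS_pos by auto
  have Lm: "antimono_on {xS<..} LdS" "mono_on {xS<..} LuS" using L by blast+
  have Lmono: "LdS y \<le> LdS x" "LuS x \<le> LuS y" if "xS < x" "x \<le> y" for x y
    using monotone_onD[OF Lm(1), of x y] monotone_onD[OF Lm(2), of x y] that by auto
  have qS: "qS x = (x - LdS x) / (LuS x - LdS x)" if "xS < x" for x using L that by blast
  let ?A = "{0<..} :: real set"
  have LF: "Fcdf (S_transform \<nu>) (LuS x) =
      Fcdf (S_transform \<mu>) x + deltaF (S_transform \<mu>) (S_transform \<nu>) (LdS x)" if "xS < x" for x
    using L that by blast
  \<comment> \<open>The mass equation says that LuS x is the inverse of the distribution function at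
    the given value. The equation for LdS makes it the inverse of the moment function as
    well.\<close>
  have LG: "Gmom (S_transform \<nu>) (LuS x) =
      Gmom (S_transform \<mu>) x + deltaG (S_transform \<mu>) (S_transform \<nu>) (LdS x)" if x: "xS < x" for x
  proof -
    let ?v = "Fcdf (S_transform \<mu>) x + deltaF (S_transform \<mu>) (S_transform \<nu>) (LdS x)"
    let ?u = "Gmom (S_transform \<mu>) x + deltaG (S_transform \<mu>) (S_transform \<nu>) (LdS x)"
    have u: "?u \<in> Gmom (S_transform \<nu>) ` ?A"
      and eq: "the_inv_into ?A (Fcdf (S_transform \<nu>)) ?v = the_inv_into ?A (Gmom (S_transform \<nu>)) ?u"
      using L x by blast+
    have "LuS x \<in> ?A" using Lpos(2)[of x] x xS_pos by simp
    then have "the_inv_into ?A (Fcdf (S_transform \<nu>)) ?v = LuS x"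
      using the_inv_into_f_f[OF nu.inj_on_S_transform(1)] LF[OF x] by metis
    then have "LuS x = the_inv_into ?A (Gmom (S_transform \<nu>)) ?u" using eq by simp
    then show ?thesis using f_the_inv_into_f[OF nu.inj_on_S_transform(2) u] by simp
  qed
  define Rd where "Rd = (\<lambda>x. 1 / LuS (1 / x))"
  define Ru where "Ru = (\<lambda>x. 1 / LdS (1 / x))"
  define qR where "qR = (\<lambda>x. x / Ru x * (1 - qS (1 / x)))"
  have inv: "xS < 1 / x" if "0 < x" "x < c" for x using that c_pos by (simp add: xS field_simps)
  have inv_le: "1 / y \<le> 1 / x" if "0 < x" "x \<le> y" for x y :: real using that by (simp add: field_simps)
  have flip: "1 / v < 1 / u" if "0 < u" "u < v" for u v :: real using that by (simp add: field_simps)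
  interpret R: right_plan \<mu> \<nu> m c Rd Ru qR
  proof
    have ic: "continuous_on {0<..c} (\<lambda>x. 1 / x)" by (intro continuous_intros) auto
    have im: "(\<lambda>x. 1 / x) ` {0<..c} \<subseteq> ?A" by auto
    show "continuous_on {0<..c} Rd" unfolding Rd_def
      using Lpos(2) by (intro continuous_intros continuous_on_compose2[OF Lcont(2) ic im]) (auto simp: less_imp_neq[symmetric])
    show "continuous_on {0<..c} Ru" unfolding Ru_def
      using Lpos(1) by (intro continuous_intros continuous_on_compose2[OF Lcont(1) ic im]) (auto simp: less_imp_neq[symmetric])
    show "Rd c = c" "Ru c = c" using Lx xR unfolding Rd_def Ru_def xS[symmetric] by simp_all
    fix x assume x: "0 < x" "x < c"
    have z: "xS < 1 / x" "0 < 1 / x" using inv[OF x] x by simp_all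
    show "0 < Rd x" using Lpos(2)[OF z(2)] by (simp add: Rd_def)
    show "Rd x < x" using flip[OF z(2) Lless(2)[OF z(1)]] by (simp add: Rd_def)
    show "x < Ru x" using flip[OF Lpos(1)[OF z(2)] Lless(1)[OF z(1)]] by (simp add: Ru_def)
    \<comment> \<open>Inversion exchanges mass and moment: \<open>LG\<close> gives the mass equation
      here, and \<open>LF\<close> gives the moment equation below.\<close>
    show "Fcdf \<nu> (Rd x) = Fcdf \<mu> x + deltaF \<mu> \<nu> (Ru x)"
      using LG[OF z(1)] Lpos[OF z(2)] x
      by (simp add: Rd_def Ru_def mu.Gmom_S_transform nu.Gmom_S_transform deltaG_S_transform)
    show "Gmom \<nu> (Rd x) = Gmom \<mu> x + deltaG \<mu> \<nu> (Ru x)"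
      using LF[OF z(1)] Lpos[OF z(2)] x
      by (simp add: Rd_def Ru_def mu.Fcdf_S_transform nu.Fcdf_S_transform deltaF_S_transform)
    show "qR x = (x - Rd x) / (Ru x - Rd x)"
    proof -
      \<comment> \<open>The numbers a and b are the reciprocals of Ru x and Rd x. Inversion
        exchanges the upper and the lower branch, hence the complement 1 - qS.\<close>
      define a where "a = LdS (1 / x)"
      define b where "b = LuS (1 / x)"
      have ab: "0 < a" "a < 1 / x" "1 / x < b" using Lpos(1)[OF z(2)] Lless[OF z(1)] by (auto simp: a_def b_def)
      then have lt: "a < b" "0 < b" using z(2) by linarith+
      have "1 - (1 / x - a) / (b - a) = (b - 1 / x) / (b - a)" using lt by (simp add: field_simps)
      then have "qR x = x * a * ((b - 1 / x) / (b - a))"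
        by (simp add: qR_def Ru_def qS[OF z(1)] a_def b_def)
      also have "\<dots> = a * (x * (b - 1 / x)) / (b - a)" by (simp add: mult_ac)
      also have "x * (b - 1 / x) = b * x - 1" using x(1) by (simp add: right_diff_distrib mult.commute)
      also have "a * (b * x - 1) / (b - a) = ((b * x - 1) / b) / ((b - a) / (a * b))" using lt ab(1) by simp
      also have "(b * x - 1) / b = x - Rd x" using lt by (simp add: Rd_def b_def[symmetric] field_simps)
      also have "(b - a) / (a * b) = Ru x - Rd x"
        using lt ab(1) by (simp add: Rd_def Ru_def a_def[symmetric] b_def[symmetric] field_simps)
      finally show ?thesis .
    qed
  next
    fix x y assume xy: "0 < x" "x \<le> y" "y < c"
    have z: "xS < 1 / y" "1 / y \<le> 1 / x" "0 < 1 / y" "0 < 1 / x" using inv[of y] inv_le[of x y] xy by auto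
    show "Rd x \<le> Rd y" unfolding Rd_def by (rule inv_le[OF Lpos(2)[OF z(3)] Lmono(2)[OF z(1,2)]])
    show "Ru y \<le> Ru x" unfolding Ru_def by (rule inv_le[OF Lpos(1)[OF z(4)] Lmono(1)[OF z(1,2)]])
  qed
  have "is_arg_min \<delta> (\<lambda>x. 0 < x) y \<longleftrightarrow> y = c" for y
    using delta_min c_pos unfolding is_arg_min_def by (metis less_irrefl order.asym)
  then show ?thesis
    unfolding xR Let_def Rd_def[symmetric] Ru_def[symmetric] qR_def[symmetric]
    using R.kernel_meas R.Q_R_eq by blast
qed

end
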